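(* Let $d\ge2$, $\varepsilon\in(0,\tfrac12]$, and let $M$ be a Riemannian manifold isometric to $\mathbb{S}^d/\Gamma$, $\mathbb{E}^d/\Gamma$ or $\mathbb{H}^d/\Gamma$ for some finite group $\Gamma$ of isometries. For any set $P$ of $n$ points of $M$ there is a Steiner $(1+\varepsilon)$-spanner for $P$ (with respect to the geodesic distance of $M$) with $d^{O(d)}\,\varepsilon^{(1-d)/2}\log\frac1\varepsilon\cdot n|\Gamma|$ edges.
   Context: A Steiner $t$-spanner for finite $P$ in a metric space is a geometric graph (edges weighted by the distance between endpoints) on $P\cup S$ for a finite set $S$ of further points of the space, with shortest-path distance at most $t$ times the true distance for every pair of points of $P$. $O(\cdot)$ constants absolute. *)

theory Defs
  imports "HOL-Analysis.Analysis" "HOL-Library.FuncSet"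
begin

text \<open>Points of the model spaces are represented as functions nat => real
  with finitely many (explicitly bounded) nonzero coordinates, since the
  dimension d is quantified inside the statement.\<close>

datatype geom = Sph | Euc | Hyp

text \<open>Carrier of the model space:
  Euc: E^d = R^d (coordinates 0..d-1);
  Sph: unit sphere S^d in R^(d+1);
  Hyp: hyperboloid model of H^d in R^(d,1), coordinate d is the time coordinate.\<close>
fun model_carrier :: "geom \<Rightarrow> nat \<Rightarrow> (nat \<Rightarrow> real) set" where
  "model_carrier Euc d = {x. \<forall>i\<ge>d. x i = 0}"
| "model_carrier Sph d = {x. (\<forall>i\<ge>Suc d. x i = 0) \<and> (\<Sum>i<Suc d. (x i)\<^sup>2) = 1}"
| "model_carrier Hyp d = {x. (\<forall>i\<ge>Suc d. x i = 0) \<and> x d > 0 \<and>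
                              (\<Sum>i<d. (x i)\<^sup>2) - (x d)\<^sup>2 = -1}"

fun model_dist :: "geom \<Rightarrow> nat \<Rightarrow> (nat \<Rightarrow> real) \<Rightarrow> (nat \<Rightarrow> real) \<Rightarrow> real" where
  "model_dist Euc d x y = sqrt (\<Sum>i<d. (x i - y i)\<^sup>2)"
| "model_dist Sph d x y = arccos (\<Sum>i<Suc d. x i * y i)"
| "model_dist Hyp d x y = arcosh (x d * y d - (\<Sum>i<d. x i * y i))"

definition fin_isom_group :: "geom \<Rightarrow> nat \<Rightarrow> ((nat \<Rightarrow> real) \<Rightarrow> (nat \<Rightarrow> real)) set \<Rightarrow> bool" where
  "fin_isom_group k d G \<longleftrightarrow>
     (let X = model_carrier k d in
      finite G \<and> G \<subseteq> (X \<rightarrow>\<^sub>E X) \<and>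
      restrict id X \<in> G \<and>
      (\<forall>g\<in>G. \<forall>h\<in>G. compose X g h \<in> G) \<and>
      (\<forall>g\<in>G. bij_betw g X X \<and>
          (\<forall>x\<in>X. \<forall>y\<in>X. model_dist k d (g x) (g y) = model_dist k d x y)))"

text \<open>The action is free (needed for X/G to be a manifold).\<close>
definition acts_freely :: "geom \<Rightarrow> nat \<Rightarrow> ((nat \<Rightarrow> real) \<Rightarrow> (nat \<Rightarrow> real)) set \<Rightarrow> bool" where
  "acts_freely k d G \<longleftrightarrow>
     (\<forall>g\<in>G. \<forall>x\<in>model_carrier k d. g x = x \<longrightarrow> g = restrict id (model_carrier k d))"

definition orbit :: "('a \<Rightarrow> 'a) set \<Rightarrow> 'a \<Rightarrow> 'a set" where
  "orbit G x = (\<lambda>g. g x) ` G"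

text \<open>The quotient space X/G: its points are the G-orbits; its geodesic
  distance is the quotient metric (minimal distance between orbit representatives).\<close>
definition quot_carrier :: "geom \<Rightarrow> nat \<Rightarrow> ((nat \<Rightarrow> real) \<Rightarrow> (nat \<Rightarrow> real)) set \<Rightarrow> (nat \<Rightarrow> real) set set" where
  "quot_carrier k d G = orbit G ` model_carrier k d"

definition quot_dist :: "geom \<Rightarrow> nat \<Rightarrow> (nat \<Rightarrow> real) set \<Rightarrow> (nat \<Rightarrow> real) set \<Rightarrow> real" where
  "quot_dist k d A B = Min ((\<lambda>(a, b). model_dist k d a b) ` (A \<times> B))"

fun walk_weight :: "('a \<Rightarrow> 'a \<Rightarrow> real) \<Rightarrow> 'a list \<Rightarrow> real" where
  "walk_weight \<delta> (x # y # xs) = \<delta> x y + walk_weight \<delta> (y # xs)"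
| "walk_weight \<delta> _ = 0"

definition is_walk :: "'a set set \<Rightarrow> 'a list \<Rightarrow> 'a \<Rightarrow> 'a \<Rightarrow> bool" where
  "is_walk E xs p q \<longleftrightarrow> xs \<noteq> [] \<and> hd xs = p \<and> last xs = q \<and>
     (\<forall>i. Suc i < length xs \<longrightarrow> {xs ! i, xs ! Suc i} \<in> E)"

definition steiner_spanner :: "'a set \<Rightarrow> ('a \<Rightarrow> 'a \<Rightarrow> real) \<Rightarrow> real \<Rightarrow> 'a set \<Rightarrow> 'a set \<Rightarrow> 'a set set \<Rightarrow> bool" where
  "steiner_spanner M \<delta> t P V E \<longleftrightarrow>
     finite V \<and> P \<subseteq> V \<and> V \<subseteq> M \<and>
     E \<subseteq> {{u, v} | u v. u \<in> V \<and> v \<in> V \<and> u \<noteq> v} \<and>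
     (\<forall>p\<in>P. \<forall>q\<in>P. \<exists>xs. is_walk E xs p q \<and> walk_weight \<delta> xs \<le> t * \<delta> p q)"

end

theory Submission
  imports Defs
begin

text \<open>A spanner of all lifts of \<open>P\<close> in the model space projects to a spanner of \<open>P\<close>, since projecting
  does not increase distances; so it suffices to treat finite subsets of the three model spaces.
  There, cut space by boundedly many shifted dyadic grids such that any two points lie in a common cube of one of
  them whose side \<open>w\<close> is comparable to their coordinate distance. The geodesic between them crosses a wall of that
  cube far from both ends, and by Stewart's theorem a detour through a point of a net of mesh of order \<open>\<surd>\<epsilon> w\<close> on the
  walls costs only a factor \<open>1 + O(\<epsilon>)\<close>; the walls have dimension \<open>d - 1\<close>, whence \<open>\<epsilon>\<close> to the power \<open>(1 - d) / 2\<close>.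
  Each net point is joined to one representative of every nonempty subcube \<open>O(log (1 / \<epsilon>))\<close> levels down, and
  the remaining gap is closed by induction on the distance. Only cubes that separate points of \<open>P\<close> matter, and a
  telescoping sum over the levels bounds the number of cube-subcube pairs by \<open>O(n log (1 / \<epsilon>))\<close>.

  Hyperbolic space is treated in the half-space model with the same Euclidean grids. A subcube near the
  boundary at infinity has infinite diameter, so its representative is replaced by an anchor point
  above it; nested anchors are joined in a chain, each hop of which is nearly vertical and costs a factor
  \<open>1 + O(\<epsilon>)\<close>.\<close>

section \<open>Weighted connectivity\<close>

inductive connected_within :: "('a \<Rightarrow> 'a \<Rightarrow> real) \<Rightarrow> 'a set set \<Rightarrow> 'a \<Rightarrow> 'a \<Rightarrow> real \<Rightarrow> bool"
  for \<delta> E where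
  stay: "0 \<le> t \<Longrightarrow> connected_within \<delta> E x x t"
| move: "{x, y} \<in> E \<Longrightarrow> connected_within \<delta> E y z s \<Longrightarrow> \<delta> x y + s \<le> t \<Longrightarrow> connected_within \<delta> E x z t"

definition edges_on :: "'a set \<Rightarrow> 'a set set" where
  "edges_on X = {{u, v} | u v. u \<in> X \<and> v \<in> X}"

lemma doubleton_in_edges_on: "{u, v} \<in> edges_on X \<longleftrightarrow> u \<in> X \<and> v \<in> X"
  unfolding edges_on_def by (auto simp: doubleton_eq_iff)

lemma connected_within_mono:
  assumes "connected_within \<delta> E x y s" and "E \<subseteq> E'" and "s \<le> t"
  shows "connected_within \<delta> E' x y t"
  using assms
proof (induction arbitrary: t rule: connected_within.induct)
  case (stay s x)
  then show ?case by (simp add: connected_within.stay)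
next
  case (move x y z s t' t)
  then show ?case by (intro connected_within.move[of x y E' \<delta> z s]) auto
qed

lemma connected_within_trans:
  assumes "connected_within \<delta> E x y s" and "connected_within \<delta> E y z s'" and "s + s' \<le> t"
  shows "connected_within \<delta> E x z t"
  using assms
proof (induction arbitrary: t rule: connected_within.induct)
  case (stay s x)
  then show ?case by (auto elim: connected_within_mono)
next
  case (move x y z s r)
  show ?case
    by (rule connected_within.move[OF move.hyps(1) move.IH[OF move.prems(1) order_refl]])
      (use move.hyps(3) move.prems(2) in simp)
qed

lemma connected_within_edge: "{x, y} \<in> E \<Longrightarrow> \<delta> x y \<le> t \<Longrightarrow> connected_within \<delta> E x y t"
  by (rule connected_within.move[OF _ connected_within.stay[OF order_refl]]) simp_all

lemma connected_within_sym:
  assumes sym: "\<And>x y. {x, y} \<in> E \<Longrightarrow> \<delta> x y = \<delta> y x" and "connected_within \<delta> E x y t"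
  shows "connected_within \<delta> E y x t"
  using assms(2)
proof (induction rule: connected_within.induct)
  case (stay t x)
  then show ?case by (rule connected_within.stay)
next
  case (move x y z s t)
  have "connected_within \<delta> E y x (\<delta> x y)"
    using move.hyps(1) sym[of x y] by (intro connected_within_edge) (auto simp: insert_commute)
  from connected_within_trans[OF move.IH this] show ?case using move.hyps(3) by simp
qed

lemma connected_within_map:
  assumes "connected_within \<delta> E x y t"
    and edge: "\<And>x y. {x, y} \<in> E \<Longrightarrow> f x \<noteq> f y \<Longrightarrow> {f x, f y} \<in> E'"
    and contract: "\<And>x y. {x, y} \<in> E \<Longrightarrow> \<delta>' (f x) (f y) \<le> \<delta> x y"
    and nonneg: "\<And>x y. {x, y} \<in> E \<Longrightarrow> 0 \<le> \<delta> x y"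
  shows "connected_within \<delta>' E' (f x) (f y) t"
  using assms(1)
proof (induction rule: connected_within.induct)
  case (stay t x)
  then show ?case by (rule connected_within.stay)
next
  case (move x y z s t)
  show ?case
  proof (cases "f x = f y")
    case True
    then show ?thesis
      using move.IH move.hyps(3) nonneg[OF move.hyps(1)] by (auto elim: connected_within_mono)
  next
    case False
    show ?thesis
      by (rule connected_within.move[OF edge[OF move.hyps(1) False] move.IH])
        (use contract[OF move.hyps(1)] move.hyps(3) in simp)
  qed
qed

lemma walk_of_connected_within:
  assumes "connected_within \<delta> E x y t"
  shows "\<exists>xs. is_walk E xs x y \<and> walk_weight \<delta> xs \<le> t"
  using assms
proof (induction rule: connected_within.induct)
  case (stay t x)
  then show ?case by (intro exI[of _ "[x]"]) (simp add: is_walk_def)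
next
  case (move x y z s t)
  obtain ys where ys: "is_walk E (y # ys) y z" "walk_weight \<delta> (y # ys) \<le> s"
    using move.IH unfolding is_walk_def by (metis list.exhaust_sel)
  have "{(x # y # ys) ! i, (x # y # ys) ! Suc i} \<in> E" if "Suc i < length (x # y # ys)" for i
    using that move.hyps(1) ys(1) unfolding is_walk_def by (cases i) auto
  then have "is_walk E (x # y # ys) x z" using ys(1) unfolding is_walk_def by simp
  then show ?case using ys(2) move.hyps(3) by (intro exI[of _ "x # y # ys"]) simp
qed

definition has_spanners :: "'a set \<Rightarrow> ('a \<Rightarrow> 'a \<Rightarrow> real) \<Rightarrow> real \<Rightarrow> real \<Rightarrow> bool" where
  "has_spanners X \<delta> t B \<longleftrightarrow> (\<forall>P. finite P \<longrightarrow> P \<subseteq> X \<longrightarrow>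
     (\<exists>E\<subseteq>edges_on X. finite E \<and> real (card E) \<le> B * real (card P) \<and>
       (\<forall>p\<in>P. \<forall>q\<in>P. connected_within \<delta> E p q (t * \<delta> p q))))"

lemma has_spanners_mono: "has_spanners X \<delta> t B \<Longrightarrow> B \<le> B' \<Longrightarrow> has_spanners X \<delta> t B'"
  unfolding has_spanners_def by (meson mult_right_mono of_nat_0_le_iff order_trans)

lemma has_spanners_isometric:
  assumes X: "has_spanners X \<delta> t B" and B: "0 \<le> B"
    and f: "\<And>x. x \<in> X \<Longrightarrow> f x \<in> Y" and g: "\<And>y. y \<in> Y \<Longrightarrow> g y \<in> X \<and> f (g y) = y"
    and iso: "\<And>x x'. x \<in> X \<Longrightarrow> x' \<in> X \<Longrightarrow> \<delta>' (f x) (f x') = \<delta> x x'"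
    and nonneg: "\<And>x x'. x \<in> X \<Longrightarrow> x' \<in> X \<Longrightarrow> 0 \<le> \<delta> x x'"
  shows "has_spanners Y \<delta>' t B"
  unfolding has_spanners_def
proof (intro allI impI)
  fix P assume P: "finite P" "P \<subseteq> Y"
  have "finite (g ` P)" "g ` P \<subseteq> X" using P g by auto
  then obtain E where E: "E \<subseteq> edges_on X" "finite E" "real (card E) \<le> B * real (card (g ` P))"
    and conn: "\<forall>p\<in>g ` P. \<forall>q\<in>g ` P. connected_within \<delta> E p q (t * \<delta> p q)"
    using X[unfolded has_spanners_def, rule_format, of "g ` P"] by blast
  show "\<exists>E\<subseteq>edges_on Y. finite E \<and> real (card E) \<le> B * real (card P) \<and>
      (\<forall>p\<in>P. \<forall>q\<in>P. connected_within \<delta>' E p q (t * \<delta>' p q))"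
  proof (intro exI[of _ "image f ` E"] conjI ballI)
    show "image f ` E \<subseteq> edges_on Y"
    proof (intro image_subsetI)
      fix e assume "e \<in> E"
      then obtain u v where "e = {u, v}" "u \<in> X" "v \<in> X" using E(1) unfolding edges_on_def by blast
      then show "f ` e \<in> edges_on Y" using f by (simp add: doubleton_in_edges_on)
    qed
    show "finite (image f ` E)" using E(2) by simp
    have "real (card (image f ` E)) \<le> real (card E)" using card_image_le[OF E(2)] by simp
    also have "\<dots> \<le> B * real (card (g ` P))" by (rule E(3))
    also have "\<dots> \<le> B * real (card P)" using card_image_le[OF P(1)] B by (intro mult_left_mono) auto
    finally show "real (card (image f ` E)) \<le> B * real (card P)" .
    fix p q assume pq: "p \<in> P" "q \<in> P"
    have ends: "x \<in> X \<and> y \<in> X" if "{x, y} \<in> E" for x y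
      using subsetD[OF E(1) that] by (simp add: doubleton_in_edges_on)
    have "connected_within \<delta>' (image f ` E) (f (g p)) (f (g q)) (t * \<delta> (g p) (g q))"
    proof (rule connected_within_map[where f = f])
      show "connected_within \<delta> E (g p) (g q) (t * \<delta> (g p) (g q))" using conn pq by blast
      show "{f x, f y} \<in> image f ` E" if "{x, y} \<in> E" for x y
        using imageI[OF that, of "image f"] by simp
      show "\<delta>' (f x) (f y) \<le> \<delta> x y" if "{x, y} \<in> E" for x y using iso[of x y] ends[OF that] by simp
      show "0 \<le> \<delta> x y" if "{x, y} \<in> E" for x y using nonneg ends[OF that] by blast
    qed
    moreover have gpq: "g p \<in> X" "f (g p) = p" "g q \<in> X" "f (g q) = q"
      using g[of p] g[of q] pq P(2) by auto
    moreover have "\<delta> (g p) (g q) = \<delta>' p q" using iso[of "g p" "g q"] gpq by simp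
    ultimately show "connected_within \<delta>' (image f ` E) p q (t * \<delta>' p q)" by simp
  qed
qed

section \<open>Counting in refining partitions\<close>

lemma card_image_ge_mult:
  assumes fin: "finite A" and factor: "\<And>x y. x \<in> A \<Longrightarrow> y \<in> A \<Longrightarrow> g x = g y \<Longrightarrow> f x = f y"
    and fibre: "\<And>x. x \<in> A \<Longrightarrow> n \<le> card (g ` {y\<in>A. f y = f x})"
  shows "n * card (f ` A) \<le> card (g ` A)"
proof -
  have "n * card (f ` A) = (\<Sum>c\<in>f ` A. n)" by simp
  also have "\<dots> \<le> (\<Sum>c\<in>f ` A. card (g ` {y\<in>A. f y = c}))" using fibre by (intro sum_mono) auto
  also have "\<dots> = card (\<Union>c\<in>f ` A. g ` {y\<in>A. f y = c})"
  proof (rule card_UN_disjoint[symmetric])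
    show "\<forall>c\<in>f ` A. \<forall>c'\<in>f ` A. c \<noteq> c' \<longrightarrow> g ` {y\<in>A. f y = c} \<inter> g ` {y\<in>A. f y = c'} = {}"
      using factor by blast
  qed (use fin in auto)
  also have "(\<Union>c\<in>f ` A. g ` {y\<in>A. f y = c}) = g ` A" by auto
  finally show ?thesis .
qed

lemma sum_shift_le:
  fixes N :: "nat \<Rightarrow> nat"
  assumes "\<And>l. N l \<le> n"
  shows "(\<Sum>l<L. N (l + m)) \<le> (\<Sum>l<L. N l) + m * n"
proof (induction m)
  case (Suc m)
  have "(\<Sum>l<L. N (l + Suc m)) + N m = (\<Sum>l<L. N (l + m)) + N (L + m)"
    by (induction L) auto
  then show ?case using Suc assms[of "L + m"] by simp
qed simp

locale refining_partitions =
  fixes cell :: "nat \<Rightarrow> 'a \<Rightarrow> 'c" and P :: "'a set" and r :: nat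
  assumes finite_P: "finite P"
    and cell_coarsen: "\<And>l l' p q. p \<in> P \<Longrightarrow> q \<in> P \<Longrightarrow> l \<le> l' \<Longrightarrow> cell l' p = cell l' q \<Longrightarrow> cell l p = cell l q"
    and eventually_inj: "\<exists>L. \<forall>l\<ge>L. inj_on (cell l) P"
begin

definition branching :: "nat \<Rightarrow> 'a \<Rightarrow> bool" where
  "branching l p \<longleftrightarrow>
     (\<exists>q\<in>P. \<exists>q'\<in>P. cell l q = cell l p \<and> cell l q' = cell l p \<and> cell (l + r) q \<noteq> cell (l + r) q')"

definition branch_cells :: "nat \<Rightarrow> (nat \<times> 'c) set" where
  "branch_cells m = {(l, cell (l + m) p) | l p. p \<in> P \<and> branching l p}"

abbreviation branching_points :: "nat \<Rightarrow> 'a set" where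
  "branching_points l \<equiv> {p\<in>P. branching l p}"

lemma branching_cong: "cell l p = cell l q \<Longrightarrow> branching l p \<longleftrightarrow> branching l q"
  unfolding branching_def by simp

lemma card_cells_mono:
  assumes "A \<subseteq> P" "l \<le> l'"
  shows "card (cell l ` A) \<le> card (cell l' ` A)"
proof -
  have fin: "finite A" using assms(1) finite_P finite_subset by blast
  have "1 * card (cell l ` A) \<le> card (cell l' ` A)"
  proof (rule card_image_ge_mult[OF fin])
    show "1 \<le> card (cell l' ` {y\<in>A. cell l y = cell l x})" if "x \<in> A" for x
      unfolding One_nat_def Suc_le_eq card_gt_0_iff using that fin by auto
  qed (use assms cell_coarsen in blast)
  then show ?thesis by simp
qed

lemma card_cells_branching_double:
  "2 * card (cell l ` branching_points l) \<le> card (cell (l + r) ` branching_points l)"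
proof (rule card_image_ge_mult)
  fix x assume "x \<in> branching_points l"
  then obtain q q' where q: "q \<in> P" "q' \<in> P" "cell l q = cell l x" "cell l q' = cell l x"
    "cell (l + r) q \<noteq> cell (l + r) q'" and "branching l x"
    unfolding branching_def by blast
  then have "branching l q" "branching l q'" using branching_cong by blast+
  then have "{cell (l + r) q, cell (l + r) q'} \<subseteq> cell (l + r) ` {y \<in> branching_points l. cell l y = cell l x}"
    using q by auto
  from card_mono[OF _ this] show "2 \<le> card (cell (l + r) ` {y \<in> branching_points l. cell l y = cell l x})"
    using q(5) finite_P by simp
qed (use finite_P cell_coarsen[OF _ _ le_add1] in auto)

lemma card_cells_split:
  assumes "l \<le> l'"
  shows "card (cell l' ` P) = card (cell l' ` branching_points l) + card (cell l' ` (P - branching_points l))"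
proof -
  have "cell l' ` branching_points l \<inter> cell l' ` (P - branching_points l) = {}"
  proof (intro equals0I, elim IntE imageE)
    fix c p q
    assume "c = cell l' p" "c = cell l' q"
      and pq: "p \<in> branching_points l" "q \<in> P - branching_points l"
    then have "cell l p = cell l q" using cell_coarsen[OF _ _ assms, of p q] by simp
    from branching_cong[OF this] show False using pq by simp
  qed
  moreover have "cell l' ` P = cell l' ` branching_points l \<union> cell l' ` (P - branching_points l)"
    by auto
  ultimately show ?thesis using finite_P by (simp add: card_Un_disjoint)
qed

lemma card_cells_telescope:
  "card (cell (l + m) ` branching_points l) + 2 * card (cell l ` P)
    \<le> card (cell (l + m) ` P) + card (cell (l + r) ` P)"
proof -
  have "card (cell l ` (P - branching_points l)) \<le> card (cell (l + k) ` (P - branching_points l))"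
    for k
    by (rule card_cells_mono) auto
  from this[of m] this[of r] show ?thesis
    using card_cells_branching_double[of l] card_cells_split[of l l]
      card_cells_split[of l "l + m"] card_cells_split[of l "l + r"] by linarith
qed

lemma finite_branch_cells: "finite (branch_cells m)"
  and card_branch_cells: "card (branch_cells m) \<le> (m + r) * card P"
proof -
  obtain L where L: "\<And>l. L \<le> l \<Longrightarrow> inj_on (cell l) P" using eventually_inj by blast
  let ?N = "\<lambda>l. card (cell l ` P)" and ?b = "\<lambda>l. Pair l ` cell (l + m) ` branching_points l"
  have "l < L" if "p \<in> P" "branching l p" for l p
    using that L[of l] unfolding branching_def inj_on_def by (cases "L \<le> l") auto
  then have eq: "branch_cells m = (\<Union>l<L. ?b l)" unfolding branch_cells_def by auto
  show "finite (branch_cells m)" unfolding eq using finite_P by simp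
  have "card (branch_cells m) \<le> (\<Sum>l<L. card (?b l))" unfolding eq by (rule card_UN_le) simp
  also have "\<dots> \<le> (\<Sum>l<L. card (cell (l + m) ` branching_points l))"
    using finite_P by (intro sum_mono card_image_le) simp
  finally have "card (branch_cells m) + 2 * (\<Sum>l<L. ?N l)
      \<le> (\<Sum>l<L. card (cell (l + m) ` branching_points l) + 2 * ?N l)"
    by (simp add: sum.distrib sum_distrib_left)
  also have "\<dots> \<le> (\<Sum>l<L. ?N (l + m) + ?N (l + r))" by (intro sum_mono card_cells_telescope)
  also have "\<dots> \<le> ((\<Sum>l<L. ?N l) + m * card P) + ((\<Sum>l<L. ?N l) + r * card P)"
    unfolding sum.distrib by (intro add_mono sum_shift_le card_image_le finite_P)
  finally show "card (branch_cells m) \<le> (m + r) * card P" by (simp add: algebra_simps)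
qed

end

section \<open>Spanners from refining partitions\<close>

lemma real_card_UN_le:
  assumes "finite I" "\<And>i. i \<in> I \<Longrightarrow> real (card (A i)) \<le> K"
  shows "real (card (\<Union>i\<in>I. A i)) \<le> K * real (card I)"
proof -
  have "real (card (\<Union>i\<in>I. A i)) \<le> real (\<Sum>i\<in>I. card (A i))"
    using card_UN_le[OF assms(1)] of_nat_le_iff by blast
  also have "\<dots> \<le> (\<Sum>i\<in>I. K)" unfolding of_nat_sum by (rule sum_mono) (rule assms(2))
  finally show ?thesis by (simp add: mult.commute)
qed

text \<open>\<open>S l c\<close> is the set of Steiner points of the cell \<open>c\<close> of level \<open>l\<close>. The functions \<open>H\<close> and \<open>h\<close> are potentials:
  their differences bound the cost of travelling down a chain of anchors of low cells.\<close>

locale cell_hierarchy = refining_partitions cell P r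
  for cell :: "nat \<Rightarrow> 'a \<Rightarrow> 'c" and P :: "'a set" and r :: nat +
  fixes X :: "'a set" and \<delta> :: "'a \<Rightarrow> 'a \<Rightarrow> real" and S :: "nat \<Rightarrow> 'c \<Rightarrow> 'a set"
    and low :: "nat \<Rightarrow> 'c \<Rightarrow> bool" and anchor :: "nat \<Rightarrow> 'c \<Rightarrow> 'a"
    and H :: "nat \<Rightarrow> real" and h :: "'a \<Rightarrow> real" and m M :: nat and K :: real
  assumes P_subset: "P \<subseteq> X"
    and S_subset: "\<And>l c. S l c \<subseteq> X" and finite_S: "\<And>l c. finite (S l c)"
    and card_S: "\<And>l c. real (card (S l c)) \<le> K" and K_ge_1: "1 \<le> K" and m_le_M: "m \<le> M"
    and anchor_in: "\<And>l c. low l c \<Longrightarrow> anchor l c \<in> X"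
    and anchor_chain: "\<And>l l' p. p \<in> P \<Longrightarrow> l < l' \<Longrightarrow> low l' (cell l' p) \<Longrightarrow>
        \<delta> (anchor l (cell l p)) (anchor l' (cell l' p)) \<le> H l - H l'"
    and anchor_end: "\<And>l p. p \<in> P \<Longrightarrow> low l (cell l p) \<Longrightarrow> \<delta> (anchor l (cell l p)) p \<le> H l - h p"
begin

definition rep :: "nat \<Rightarrow> 'c \<Rightarrow> 'a" where
  "rep l c = (SOME p. p \<in> P \<and> cell l p = c)"

definition star_edges :: "nat \<Rightarrow> (nat \<Rightarrow> 'c \<Rightarrow> 'a) \<Rightarrow> 'a set set" where
  "star_edges k centre =
     (\<Union>(l, c)\<in>branch_cells k. (\<lambda>s. {s, centre (l + k) c}) ` S l (cell l (rep (l + k) c)))"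

definition low_levels :: "'a \<Rightarrow> nat set" where
  "low_levels p = {l + m | l. branching l p \<and> low (l + m) (cell (l + m) p)}"

definition chain_edge :: "nat \<Rightarrow> 'c \<Rightarrow> 'a set" where
  "chain_edge l c = (let p = rep l c; l' = Max {k \<in> low_levels p. k < l} in {anchor l' (cell l' p), anchor l c})"

definition last_edge :: "'a \<Rightarrow> 'a set" where
  "last_edge p = (let l = Max (low_levels p) in {anchor l (cell l p), p})"

text \<open>The intersection discards the junk produced by \<open>Max {}\<close>.\<close>

definition edges :: "'a set set" where
  "edges = (star_edges M rep \<union> star_edges m anchor \<union> (\<lambda>(l, c). chain_edge (l + m) c) ` branch_cells m
     \<union> last_edge ` P) \<inter> edges_on X"

lemma rep_in: "p \<in> P \<Longrightarrow> rep l (cell l p) \<in> P"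
  and cell_rep: "p \<in> P \<Longrightarrow> cell l (rep l (cell l p)) = cell l p"
  using someI[of "\<lambda>q. q \<in> P \<and> cell l q = cell l p" p] unfolding rep_def by auto

lemma cell_rep_coarser: "p \<in> P \<Longrightarrow> k \<le> l \<Longrightarrow> cell k (rep l (cell l p)) = cell k p"
  using cell_coarsen[OF rep_in] cell_rep by blast

lemma finite_star_edges: "finite (star_edges k centre)"
  and card_star_edges: "real (card (star_edges k centre)) \<le> K * (real (k + r) * real (card P))"
proof -
  let ?star = "\<lambda>(l, c). (\<lambda>s. {s, centre (l + k) c}) ` S l (cell l (rep (l + k) c))"
  show "finite (star_edges k centre)"
    unfolding star_edges_def using finite_branch_cells finite_S by auto
  have star: "real (card (?star x)) \<le> K" for x
  proof (cases x)
    case (Pair l c)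
    have "card (?star x) \<le> card (S l (cell l (rep (l + k) c)))"
      unfolding Pair by (simp add: card_image_le finite_S)
    then show ?thesis using card_S[of l "cell l (rep (l + k) c)"] by linarith
  qed
  have "real (card (star_edges k centre)) \<le> K * real (card (branch_cells k))"
    unfolding star_edges_def by (rule real_card_UN_le[OF finite_branch_cells star])
  also have "\<dots> \<le> K * real ((k + r) * card P)"
    using card_branch_cells[of k] K_ge_1 by (intro mult_left_mono of_nat_mono) auto
  finally show "real (card (star_edges k centre)) \<le> K * (real (k + r) * real (card P))" by simp
qed

lemma finite_edges: "finite edges"
  unfolding edges_def using finite_star_edges finite_branch_cells finite_P by auto

lemma card_edges: "real (card edges) \<le> K * (3 * real (M + r) + 1) * real (card P)"
proof -
  let ?n = "real (card P)" and ?chain = "(\<lambda>(l, c). chain_edge (l + m) c) ` branch_cells m"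
  have star: "real (card (star_edges k centre)) \<le> K * (real (M + r) * ?n)" if "k \<le> M" for k centre
    using card_star_edges[of k centre] that K_ge_1
    by (elim order_trans) (intro mult_left_mono mult_right_mono; simp)
  have "card ?chain \<le> (m + r) * card P"
    using card_branch_cells[of m] card_image_le[OF finite_branch_cells] order_trans by blast
  then have "real (card ?chain) \<le> real ((m + r) * card P)" by (rule of_nat_mono)
  also have "\<dots> \<le> real (M + r) * ?n" using m_le_M by (simp add: mult_right_mono)
  also have "\<dots> \<le> K * (real (M + r) * ?n)"
    using mult_right_mono[OF K_ge_1, of "real (M + r) * ?n"] by simp
  finally have chain: "real (card ?chain) \<le> K * (real (M + r) * ?n)" .
  have "real (card (last_edge ` P)) \<le> 1 * ?n" using card_image_le[OF finite_P] by simp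
  also have "\<dots> \<le> K * ?n" using K_ge_1 by (intro mult_right_mono) auto
  finally have last: "real (card (last_edge ` P)) \<le> K * ?n" .
  let ?all = "star_edges M rep \<union> star_edges m anchor \<union> ?chain \<union> last_edge ` P"
  have "card edges \<le> card ?all"
    unfolding edges_def using finite_star_edges finite_branch_cells finite_P
    by (intro card_mono) auto
  also have "\<dots> \<le> card (star_edges M rep) + card (star_edges m anchor) + card ?chain + card (last_edge ` P)"
    by (meson add_mono card_Un_le le_refl order_trans)
  finally have "real (card edges) \<le> 3 * (K * (real (M + r) * ?n)) + K * ?n"
    using star[OF order_refl, of rep] star[OF m_le_M, of anchor] chain last by linarith
  then show ?thesis by (simp add: algebra_simps)
qed

lemma star_edge:
  assumes "p \<in> P" "branching l p" "s \<in> S l (cell l p)" "centre (l + k) (cell (l + k) p) \<in> X"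
  shows "{s, centre (l + k) (cell (l + k) p)} \<in> star_edges k centre \<inter> edges_on X"
proof -
  have "(l, cell (l + k) p) \<in> branch_cells k" unfolding branch_cells_def using assms(1,2) by blast
  moreover have "s \<in> S l (cell l (rep (l + k) (cell (l + k) p)))"
    using assms(1,3) by (simp add: cell_rep_coarser)
  ultimately have "{s, centre (l + k) (cell (l + k) p)} \<in> star_edges k centre"
    unfolding star_edges_def by blast
  then show ?thesis using assms(3,4) S_subset by (auto simp: doubleton_in_edges_on)
qed

lemma connected_rep:
  assumes "p \<in> P" "branching l p" "s \<in> S l (cell l p)"
  shows "\<exists>p'\<in>P. cell (l + M) p' = cell (l + M) p \<and> connected_within \<delta> edges s p' (\<delta> s p')"
proof (intro bexI conjI)
  let ?p' = "rep (l + M) (cell (l + M) p)"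
  show "?p' \<in> P" "cell (l + M) ?p' = cell (l + M) p" using assms(1) rep_in cell_rep by auto
  then show "connected_within \<delta> edges s ?p' (\<delta> s ?p')"
    using star_edge[OF assms, of rep M] P_subset
    unfolding edges_def by (intro connected_within_edge) auto
qed

lemma low_of_low_levels: "k \<in> low_levels p \<Longrightarrow> low k (cell k p)"
  unfolding low_levels_def by auto

lemma finite_low_levels: "p \<in> P \<Longrightarrow> finite (low_levels p)"
proof -
  assume "p \<in> P"
  then have "low_levels p \<subseteq> (\<lambda>(l, c). l + m) ` branch_cells m"
    unfolding low_levels_def branch_cells_def by force
  then show ?thesis using finite_branch_cells finite_surj by blast
qed

lemma low_levels_cong:
  assumes "p \<in> P" "q \<in> P" "cell l p = cell l q" "k \<le> l"
  shows "k \<in> low_levels p \<longleftrightarrow> k \<in> low_levels q"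
proof -
  have "cell j p = cell j q" if "j \<le> k" for j
    using cell_coarsen[OF assms(1,2) _ assms(3)] that assms(4) by simp
  then have "cell k p = cell k q" and "branching i p = branching i q" if "k = i + m" for i
    using branching_cong[of i p q] that by auto
  then show ?thesis unfolding low_levels_def by auto
qed

lemma chain_edge_in_edges:
  assumes p: "p \<in> P" and kl: "k \<in> low_levels p" "l \<in> low_levels p" "l < k"
    and consecutive: "\<And>j. j \<in> low_levels p \<Longrightarrow> j < k \<Longrightarrow> j \<le> l"
  shows "{anchor l (cell l p), anchor k (cell k p)} \<in> edges"
proof -
  let ?q = "rep k (cell k p)"
  have "j \<in> low_levels ?q \<longleftrightarrow> j \<in> low_levels p" if "j < k" for j
    using low_levels_cong[OF rep_in[OF p] p cell_rep[OF p]] that by simp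
  then have "{j \<in> low_levels ?q. j < k} = {j \<in> low_levels p. j < k}" by blast
  moreover have "Max {j \<in> low_levels p. j < k} = l"
    using kl consecutive finite_low_levels[OF p] by (intro Max_eqI) auto
  ultimately have "chain_edge k (cell k p) = {anchor l (cell l p), anchor k (cell k p)}"
    unfolding chain_edge_def Let_def using cell_rep_coarser[OF p, of l k] kl(3) by simp
  moreover obtain i where "k = i + m" "branching i p" using kl(1) unfolding low_levels_def by blast
  then have "chain_edge k (cell k p) \<in> (\<lambda>(l, c). chain_edge (l + m) c) ` branch_cells m"
    using p unfolding branch_cells_def by (intro image_eqI[of _ _ "(i, cell k p)"]) auto
  moreover have "anchor l (cell l p) \<in> X" "anchor k (cell k p) \<in> X"
    using kl anchor_in low_of_low_levels by auto
  ultimately show ?thesis unfolding edges_def by (auto simp: doubleton_in_edges_on)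
qed

lemma last_edge_in_edges:
  assumes p: "p \<in> P" and l: "l \<in> low_levels p" "\<And>j. j \<in> low_levels p \<Longrightarrow> j \<le> l"
  shows "{anchor l (cell l p), p} \<in> edges"
proof -
  have "Max (low_levels p) = l" using l finite_low_levels[OF p] by (intro Max_eqI) auto
  then have "{anchor l (cell l p), p} \<in> last_edge ` P"
    unfolding last_edge_def Let_def using p by auto
  then show ?thesis unfolding edges_def
    using p P_subset anchor_in[OF low_of_low_levels[OF l(1)]] by (auto simp: doubleton_in_edges_on)
qed

lemma connected_anchor:
  assumes p: "p \<in> P"
  shows "l \<in> low_levels p \<Longrightarrow> connected_within \<delta> edges (anchor l (cell l p)) p (H l - h p)"
proof (induction "card {k\<in>low_levels p. l < k}" arbitrary: l rule: less_induct)
  case less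
  let ?above = "\<lambda>l. {k\<in>low_levels p. l < k}"
  have fin: "finite (?above l)" using finite_low_levels[OF p] by simp
  show ?case
  proof (cases "?above l = {}")
    case True
    then have "{anchor l (cell l p), p} \<in> edges"
      using less.prems by (intro last_edge_in_edges p) (auto simp: not_less)
    then show ?thesis using anchor_end[OF p low_of_low_levels[OF less.prems]]
      by (rule connected_within_edge)
  next
    case False
    define k where "k = Min (?above l)"
    have k: "k \<in> low_levels p" "l < k" using Min_in[OF fin False] unfolding k_def by auto
    have below: "j \<le> l" if "j \<in> low_levels p" "j < k" for j
      using that Min_le[OF fin, of j] unfolding k_def by force
    have "connected_within \<delta> edges (anchor l (cell l p)) (anchor k (cell k p)) (H l - H k)"
      using chain_edge_in_edges[OF p k(1) less.prems k(2) below] anchor_chain[OF p k(2)]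
        low_of_low_levels[OF k(1)]
      by (intro connected_within_edge) auto
    moreover have "connected_within \<delta> edges (anchor k (cell k p)) p (H k - h p)"
      using k by (intro less.hyps psubset_card_mono[OF fin]) auto
    ultimately show ?thesis by (rule connected_within_trans) simp
  qed
qed

lemma connected_low:
  assumes "p \<in> P" "branching l p" "s \<in> S l (cell l p)" and low: "low (l + m) (cell (l + m) p)"
  shows "connected_within \<delta> edges s p (\<delta> s (anchor (l + m) (cell (l + m) p)) + (H (l + m) - h p))"
proof (rule connected_within_trans[OF connected_within_edge connected_anchor order_refl])
  show "{s, anchor (l + m) (cell (l + m) p)} \<in> edges"
    using star_edge[OF assms(1-3), of anchor m] anchor_in[OF low] unfolding edges_def by blast
  show "l + m \<in> low_levels p" unfolding low_levels_def using assms(2) low by blast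
qed (use assms(1) in simp_all)

end

lemma finite_pair_distance_induct:
  fixes \<delta> :: "'a \<Rightarrow> 'a \<Rightarrow> real"
  assumes "finite P" "p \<in> P" "q \<in> P"
    and step: "\<And>p q. p \<in> P \<Longrightarrow> q \<in> P \<Longrightarrow> (\<And>x y. x \<in> P \<Longrightarrow> y \<in> P \<Longrightarrow> \<delta> x y < \<delta> p q \<Longrightarrow> Q x y) \<Longrightarrow> Q p q"
  shows "Q p q"
  using assms(2,3)
proof (induction "card {(x, y) \<in> P \<times> P. \<delta> x y < \<delta> p q}" arbitrary: p q rule: less_induct)
  case less
  let ?closer = "\<lambda>p q. {(x, y) \<in> P \<times> P. \<delta> x y < \<delta> p q}"
  have fin: "finite (?closer p q)" by (rule finite_subset[of _ "P \<times> P"]) (use assms(1) in auto)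
  show ?case
  proof (rule step[OF less.prems])
    fix x y assume xy: "x \<in> P" "y \<in> P" "\<delta> x y < \<delta> p q"
    then have "?closer x y \<subset> ?closer p q" by auto
    then show "Q x y" using xy by (intro less.hyps psubset_card_mono fin) auto
  qed
qed

section \<open>Shifted dyadic cubes\<close>

definition cube :: "nat \<Rightarrow> (nat \<Rightarrow> real) \<Rightarrow> real \<Rightarrow> (nat \<Rightarrow> real) set" where
  "cube N c w = {p. \<forall>j<N. c j \<le> p j \<and> p j < c j + w}"

definition cube_pair :: "nat \<Rightarrow> (nat \<Rightarrow> real) \<Rightarrow> real \<Rightarrow> (nat \<Rightarrow> real) \<Rightarrow> (nat \<Rightarrow> real) \<Rightarrow> bool" where
  "cube_pair N c w p q \<longleftrightarrow> p \<in> cube N c w \<and> q \<in> cube N c w \<and>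
     (\<forall>j<N. \<bar>p j - q j\<bar> \<le> w / 3) \<and> (\<exists>i<N. w / 6 < \<bar>p i - q i\<bar>)"

definition dyadic_cell :: "nat \<Rightarrow> real \<Rightarrow> nat set \<Rightarrow> nat \<Rightarrow> (nat \<Rightarrow> real) \<Rightarrow> (nat \<Rightarrow> int)" where
  "dyadic_cell N W \<sigma> l p =
     (\<lambda>i. if i < N then \<lfloor>2 ^ l * (p i / W + (if i \<in> \<sigma> then 1 / 3 else 0))\<rfloor> else 0)"

definition corner :: "real \<Rightarrow> nat set \<Rightarrow> nat \<Rightarrow> (nat \<Rightarrow> int) \<Rightarrow> (nat \<Rightarrow> real)" where
  "corner W \<sigma> l c = (\<lambda>i. W / 2 ^ l * of_int (c i) - (if i \<in> \<sigma> then W / 3 else 0))"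

lemma abs_diff_cube_corner: "p \<in> cube N c w \<Longrightarrow> j < N \<Longrightarrow> \<bar>p j - c j\<bar> \<le> w"
  unfolding cube_def by force

lemma abs_diff_cube: "p \<in> cube N c w \<Longrightarrow> q \<in> cube N c w \<Longrightarrow> j < N \<Longrightarrow> \<bar>p j - q j\<bar> < w"
  unfolding cube_def by (smt (verit) mem_Collect_eq)

lemma cube_pair_sym: "cube_pair N c w p q \<Longrightarrow> cube_pair N c w q p"
  unfolding cube_pair_def by (simp add: abs_minus_commute)

lemma mem_cube_corner:
  assumes W: "0 < W"
  shows "p \<in> cube N (corner W \<sigma> l (dyadic_cell N W \<sigma> l p)) (W / 2 ^ l)"
proof -
  have "corner W \<sigma> l (dyadic_cell N W \<sigma> l p) i \<le> p i
      \<and> p i < corner W \<sigma> l (dyadic_cell N W \<sigma> l p) i + W / 2 ^ l" if "i < N" for i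
  proof -
    define shift k where "shift = (if i \<in> \<sigma> then 1 / 3 else 0 :: real)"
      and "k = \<lfloor>2 ^ l * (p i / W + shift)\<rfloor>"
    have corner: "corner W \<sigma> l (dyadic_cell N W \<sigma> l p) i = W / 2 ^ l * of_int k - W * shift"
      unfolding corner_def dyadic_cell_def k_def shift_def using that by simp
    have "of_int k \<le> 2 ^ l * (p i / W + shift)" "2 ^ l * (p i / W + shift) < of_int k + 1"
      unfolding k_def by linarith+
    then have "W / 2 ^ l * of_int k \<le> W / 2 ^ l * (2 ^ l * (p i / W + shift))"
      "W / 2 ^ l * (2 ^ l * (p i / W + shift)) < W / 2 ^ l * (of_int k + 1)"
      using W by (simp_all only: mult_left_mono mult_strict_left_mono zero_less_divide_iff zero_less_power
          zero_less_numeral less_imp_le simp_thms)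
    moreover have "W / 2 ^ l * (2 ^ l * (p i / W + shift)) = p i + W * shift"
      using W by (simp add: field_simps)
    ultimately show ?thesis unfolding corner by (simp add: distrib_left)
  qed
  then show ?thesis unfolding cube_def by blast
qed

lemma dyadic_cell_close:
  assumes "0 < W" "i < N" "dyadic_cell N W \<sigma> l p = dyadic_cell N W \<sigma> l q"
  shows "\<bar>p i - q i\<bar> < W / 2 ^ l"
  using abs_diff_cube[OF mem_cube_corner[OF assms(1), of p N \<sigma> l] _ assms(2), of q]
    mem_cube_corner[OF assms(1), of q N \<sigma> l] assms(3) by simp

lemma floor_dyadic:
  fixes x :: real
  shows "\<lfloor>2 ^ l * x\<rfloor> = \<lfloor>2 ^ (l + k) * x\<rfloor> div 2 ^ k"
proof -
  have "2 ^ l * x = 2 ^ (l + k) * x / real_of_int (2 ^ k)" by (simp add: power_add)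
  then show ?thesis by (simp only: floor_divide_real_eq_div[of "2 ^ k"] zero_le_power zero_le_numeral)
qed

lemma dyadic_cell_coarsen:
  assumes "l \<le> l'" "dyadic_cell N W \<sigma> l' p = dyadic_cell N W \<sigma> l' q"
  shows "dyadic_cell N W \<sigma> l p = dyadic_cell N W \<sigma> l q"
proof
  fix i
  obtain k where k: "l' = l + k" using assms(1) le_Suc_ex by blast
  show "dyadic_cell N W \<sigma> l p i = dyadic_cell N W \<sigma> l q i"
    using fun_cong[OF assms(2), of i] unfolding dyadic_cell_def k
    by (auto simp: floor_dyadic[of l _ k])
qed

lemma eventually_inj_dyadic_cell:
  assumes W: "0 < W" and fin: "finite P"
    and sep: "\<And>p q. p \<in> P \<Longrightarrow> q \<in> P \<Longrightarrow> (\<And>i. i < N \<Longrightarrow> p i = q i) \<Longrightarrow> p = q"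
  shows "\<exists>L. \<forall>l\<ge>L. inj_on (dyadic_cell N W \<sigma> l) P"
proof -
  have "eventually (\<lambda>l. dyadic_cell N W \<sigma> l p = dyadic_cell N W \<sigma> l q \<longrightarrow> p = q) sequentially"
    if pq: "p \<in> P" "q \<in> P" for p q
  proof (cases "p = q")
    case False
    then obtain i where i: "i < N" "p i \<noteq> q i" using sep[OF pq] by blast
    have "(\<lambda>l. W / 2 ^ l) \<longlonglongrightarrow> 0" by (rule LIMSEQ_divide_realpow_zero) simp
    then have "eventually (\<lambda>l. W / 2 ^ l < \<bar>p i - q i\<bar>) sequentially"
      by (rule order_tendstoD) (use i in simp)
    then show ?thesis by eventually_elim (use dyadic_cell_close[OF W i(1)] in fastforce)
  qed simp
  then have "eventually (\<lambda>l. \<forall>p\<in>P. \<forall>q\<in>P. dyadic_cell N W \<sigma> l p = dyadic_cell N W \<sigma> l q \<longrightarrow> p = q) sequentially"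
    by (intro eventually_ball_finite ballI fin)
  then show ?thesis unfolding eventually_sequentially inj_on_def .
qed

lemma pow2_div_3: "\<exists>k::int. (2::real) ^ l / 3 = of_int k + 1 / 3 \<or> (2::real) ^ l / 3 = of_int k + 2 / 3"
proof (induction l)
  case 0
  show ?case by (rule exI[of _ 0]) simp
next
  case (Suc l)
  then obtain k :: int where "(2::real) ^ l / 3 = of_int k + 1 / 3 \<or> (2::real) ^ l / 3 = of_int k + 2 / 3"
    by blast
  then have "(2::real) ^ Suc l / 3 = of_int (2 * k) + 2 / 3 \<or> (2::real) ^ Suc l / 3 = of_int (2 * k + 1) + 1 / 3"
    by auto
  then show ?case by blast
qed

text \<open>The translation of the grid by a third of the coarsest mesh is one by \<open>2 ^ l / 3\<close> meshes at level \<open>l\<close>,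
  which is never close to an integer.\<close>

lemma floor_eq_or_floor_third_shift_eq:
  fixes a b :: real
  assumes "\<bar>a - b\<bar> \<le> 1 / 3"
  shows "\<lfloor>a\<rfloor> = \<lfloor>b\<rfloor> \<or> \<lfloor>a + 2 ^ l / 3\<rfloor> = \<lfloor>b + 2 ^ l / 3\<rfloor>"
  using assms
proof (induction a b rule: linorder_wlog)
  case (le a b)
  show ?case
  proof (cases "\<lfloor>a\<rfloor> = \<lfloor>b\<rfloor>")
    case False
    then have "\<lfloor>a\<rfloor> < \<lfloor>b\<rfloor>" using floor_mono[OF le(1)] by linarith
    then have "a < of_int \<lfloor>b\<rfloor>" "of_int \<lfloor>b\<rfloor> \<le> b" by (simp_all add: floor_less_iff)
    moreover obtain k :: int where "(2::real) ^ l / 3 = of_int k + 1 / 3 \<or> (2::real) ^ l / 3 = of_int k + 2 / 3"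
      using pow2_div_3 by blast
    ultimately have "\<lfloor>a + 2 ^ l / 3\<rfloor> = \<lfloor>b\<rfloor> + k" "\<lfloor>b + 2 ^ l / 3\<rfloor> = \<lfloor>b\<rfloor> + k"
      unfolding floor_eq_iff of_int_add using le by argo+
    then show ?thesis by simp
  qed simp
next
  case (sym a b)
  then show ?case by (auto simp: abs_minus_commute)
qed

lemma ex_dyadic_scale:
  fixes W :: real
  assumes W: "0 < W" and ne: "\<exists>i<N. p i \<noteq> q i" and le: "\<And>i. i < N \<Longrightarrow> \<bar>p i - q i\<bar> \<le> W / 3"
  obtains l :: nat where "\<And>i. i < N \<Longrightarrow> \<bar>p i - q i\<bar> \<le> W / 2 ^ l / 3"
    and "\<exists>i<N. W / 2 ^ l / 6 < \<bar>p i - q i\<bar>"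
proof -
  obtain i where i: "i < N" "p i \<noteq> q i" using ne by blast
  let ?Q = "\<lambda>l. \<exists>i<N. W / 2 ^ l / 6 < \<bar>p i - q i\<bar>"
  have "(\<lambda>l. W / 6 / 2 ^ l) \<longlonglongrightarrow> 0" by (rule LIMSEQ_divide_realpow_zero) simp
  then have "eventually (\<lambda>l. W / 6 / 2 ^ l < \<bar>p i - q i\<bar>) sequentially"
    by (rule order_tendstoD) (use i in simp)
  then have "\<exists>l. W / 6 / 2 ^ l < \<bar>p i - q i\<bar>" by (auto simp: eventually_sequentially)
  then have "\<exists>l. ?Q l" using i(1) by (auto simp: mult.commute)
  then have "?Q (LEAST l. ?Q l)" by (rule LeastI_ex)
  moreover have "\<bar>p j - q j\<bar> \<le> W / 2 ^ (LEAST l. ?Q l) / 3" if "j < N" for j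
  proof (cases "LEAST l. ?Q l")
    case 0
    then show ?thesis using le[OF that] by simp
  next
    case (Suc k)
    then have "\<not> ?Q k" using not_less_Least[of k ?Q] by simp
    then have "\<bar>p j - q j\<bar> \<le> W / 2 ^ k / 6" using that by (meson not_less)
    then show ?thesis unfolding Suc by simp
  qed
  ultimately show thesis using that by blast
qed

lemma ex_separating_dyadic_cell:
  assumes W: "0 < W" and ne: "\<exists>i<N. p i \<noteq> q i" and le: "\<And>i. i < N \<Longrightarrow> \<bar>p i - q i\<bar> \<le> W / 3"
  obtains \<sigma> l where "\<sigma> \<subseteq> {..<N}" "dyadic_cell N W \<sigma> l p = dyadic_cell N W \<sigma> l q"
    "dyadic_cell N W \<sigma> (l + 3) p \<noteq> dyadic_cell N W \<sigma> (l + 3) q"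
    "cube_pair N (corner W \<sigma> l (dyadic_cell N W \<sigma> l p)) (W / 2 ^ l) p q"
proof -
  obtain l where l: "\<And>i. i < N \<Longrightarrow> \<bar>p i - q i\<bar> \<le> W / 2 ^ l / 3" "\<exists>i<N. W / 2 ^ l / 6 < \<bar>p i - q i\<bar>"
    using ex_dyadic_scale[OF W ne le] by blast
  define \<sigma> where "\<sigma> = {i. i < N \<and> \<lfloor>2 ^ l * (p i / W)\<rfloor> \<noteq> \<lfloor>2 ^ l * (q i / W)\<rfloor>}"
  have same: "dyadic_cell N W \<sigma> l p = dyadic_cell N W \<sigma> l q"
  proof
    fix i
    show "dyadic_cell N W \<sigma> l p i = dyadic_cell N W \<sigma> l q i"
    proof (cases "i < N")
      case True
      have "\<bar>2 ^ l * (p i / W) - 2 ^ l * (q i / W)\<bar> = 2 ^ l / W * \<bar>p i - q i\<bar>"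
        using W by (simp add: abs_mult flip: right_diff_distrib diff_divide_distrib)
      also have "\<dots> \<le> 2 ^ l / W * (W / 2 ^ l / 3)" using W by (intro mult_left_mono l True) simp
      also have "\<dots> = 1 / 3" using W by simp
      finally show ?thesis
        using True floor_eq_or_floor_third_shift_eq[of "2 ^ l * (p i / W)" "2 ^ l * (q i / W)" l]
        unfolding dyadic_cell_def \<sigma>_def by (auto simp: distrib_left)
    qed (simp add: dyadic_cell_def)
  qed
  have "dyadic_cell N W \<sigma> (l + 3) p \<noteq> dyadic_cell N W \<sigma> (l + 3) q"
  proof
    assume eq: "dyadic_cell N W \<sigma> (l + 3) p = dyadic_cell N W \<sigma> (l + 3) q"
    obtain i where "i < N" "W / 2 ^ l / 6 < \<bar>p i - q i\<bar>" using l(2) by blast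
    moreover have "W / 2 ^ (l + 3) \<le> W / 2 ^ l / 6" using W by (simp add: power_add field_simps)
    ultimately show False using dyadic_cell_close[OF W _ eq, of i] by simp
  qed
  moreover have "cube_pair N (corner W \<sigma> l (dyadic_cell N W \<sigma> l p)) (W / 2 ^ l) p q"
    unfolding cube_pair_def
    using mem_cube_corner[OF W, of p N \<sigma> l] mem_cube_corner[OF W, of q N \<sigma> l] same l by simp
  moreover have "\<sigma> \<subseteq> {..<N}" unfolding \<sigma>_def by auto
  ultimately show thesis using that same by blast
qed

lemma finite_coordinate_bound:
  fixes P :: "(nat \<Rightarrow> real) set"
  assumes "finite P"
  obtains W where "0 < W" "\<And>p q i. p \<in> P \<Longrightarrow> q \<in> P \<Longrightarrow> i < N \<Longrightarrow> \<bar>p i - q i\<bar> \<le> W / 3"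
proof -
  let ?D = "(\<lambda>(p, q, i). \<bar>p i - q i\<bar>) ` (P \<times> P \<times> {..<N})"
  define W where "W = 3 * Max (insert 1 ?D)"
  have fin: "finite (insert 1 ?D)" using assms by simp
  have "1 \<le> Max (insert 1 ?D)" using fin by (rule Max_ge) simp
  then have "0 < W" unfolding W_def by simp
  moreover have "\<bar>p i - q i\<bar> \<le> W / 3" if "p \<in> P" "q \<in> P" "i < N" for p q i
  proof -
    have "\<bar>p i - q i\<bar> \<in> insert 1 ?D" using that by force
    then have "\<bar>p i - q i\<bar> \<le> Max (insert 1 ?D)" by (rule Max_ge[OF fin])
    then show ?thesis unfolding W_def by simp
  qed
  ultimately show thesis by (rule that)
qed

section \<open>Spanners from routing in cubes\<close>

definition detour_net ::
  "nat \<Rightarrow> (nat \<Rightarrow> real) set \<Rightarrow> ((nat \<Rightarrow> real) \<Rightarrow> (nat \<Rightarrow> real) \<Rightarrow> real) \<Rightarrow> real \<Rightarrow>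
    (nat \<Rightarrow> real) \<Rightarrow> real \<Rightarrow> (nat \<Rightarrow> real) set \<Rightarrow> bool" where
  "detour_net N X \<delta> \<epsilon> c w S \<longleftrightarrow> (\<forall>p\<in>X. \<forall>q\<in>X. cube_pair N c w p q \<longrightarrow>
     (\<exists>s\<in>S. \<delta> p s + \<delta> s q \<le> (1 + \<epsilon> / 4) * \<delta> p q))"

text \<open>Unlike \<open>Metric_space\<close>, this requires nothing outside \<open>X\<close>, where \<open>arccos\<close> and \<open>arcosh\<close> return junk.\<close>

locale metric_on =
  fixes X :: "'a set" and \<delta> :: "'a \<Rightarrow> 'a \<Rightarrow> real"
  assumes nonneg: "\<And>x y. x \<in> X \<Longrightarrow> y \<in> X \<Longrightarrow> 0 \<le> \<delta> x y"
    and pos: "\<And>x y. x \<in> X \<Longrightarrow> y \<in> X \<Longrightarrow> x \<noteq> y \<Longrightarrow> 0 < \<delta> x y"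
    and sym: "\<And>x y. x \<in> X \<Longrightarrow> y \<in> X \<Longrightarrow> \<delta> x y = \<delta> y x"
    and triangle: "\<And>x y z. x \<in> X \<Longrightarrow> y \<in> X \<Longrightarrow> z \<in> X \<Longrightarrow> \<delta> x z \<le> \<delta> x y + \<delta> y z"

text \<open>\<open>net w c\<close> and \<open>anchor w c\<close> are the Steiner points and the anchor of the cube with corner \<open>c\<close> and side \<open>w\<close>;
  \<open>H\<close> and \<open>h\<close> are potentials as in \<open>cell_hierarchy\<close>. A Steiner point reaches \<open>p\<close> through the anchor of
  the subcube of side \<open>w / 2 ^ m\<close> if that is low, and through any point within \<open>w / 2 ^ M\<close> of \<open>p\<close> otherwise.\<close>

locale cube_routing = metric_on X \<delta>
  for X :: "(nat \<Rightarrow> real) set" and \<delta> +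
  fixes N :: nat and net :: "real \<Rightarrow> (nat \<Rightarrow> real) \<Rightarrow> (nat \<Rightarrow> real) set"
    and low :: "real \<Rightarrow> (nat \<Rightarrow> real) \<Rightarrow> bool" and anchor :: "real \<Rightarrow> (nat \<Rightarrow> real) \<Rightarrow> nat \<Rightarrow> real"
    and H :: "real \<Rightarrow> real" and h :: "(nat \<Rightarrow> real) \<Rightarrow> real" and m M :: nat and K \<epsilon> :: real
  assumes coordinates: "\<And>x y. x \<in> X \<Longrightarrow> y \<in> X \<Longrightarrow> (\<And>i. i < N \<Longrightarrow> x i = y i) \<Longrightarrow> x = y"
    and \<epsilon>_pos: "0 < \<epsilon>" and \<epsilon>_le_1: "\<epsilon> \<le> 1" and K_ge_1: "1 \<le> K" and m_le_M: "m \<le> M"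
    and net_subset: "\<And>w c. 0 < w \<Longrightarrow> net w c \<subseteq> X" and finite_net: "\<And>w c. 0 < w \<Longrightarrow> finite (net w c)"
    and card_net: "\<And>w c. 0 < w \<Longrightarrow> real (card (net w c)) \<le> K"
    and anchor_in: "\<And>w c. 0 < w \<Longrightarrow> low w c \<Longrightarrow> anchor w c \<in> X"
    and anchor_chain: "\<And>w w' c c' p. 0 < w' \<Longrightarrow> 2 * w' \<le> w \<Longrightarrow> p \<in> cube N c w \<Longrightarrow> p \<in> cube N c' w' \<Longrightarrow> low w' c' \<Longrightarrow>
        \<delta> (anchor w c) (anchor w' c') \<le> H w - H w'"
    and anchor_end: "\<And>w c p. 0 < w \<Longrightarrow> p \<in> X \<Longrightarrow> p \<in> cube N c w \<Longrightarrow> low w c \<Longrightarrow> \<delta> (anchor w c) p \<le> H w - h p"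
    and detour: "\<And>w c. 0 < w \<Longrightarrow> detour_net N X \<delta> \<epsilon> c w (net w c)"
    and low_detour: "\<And>w c c' p q s. 0 < w \<Longrightarrow> p \<in> X \<Longrightarrow> q \<in> X \<Longrightarrow> cube_pair N c w p q \<Longrightarrow> s \<in> net w c \<Longrightarrow>
        \<delta> s p \<le> 2 * \<delta> p q \<Longrightarrow> p \<in> cube N c' (w / 2 ^ m) \<Longrightarrow> low (w / 2 ^ m) c' \<Longrightarrow>
        \<delta> s (anchor (w / 2 ^ m) c') + (H (w / 2 ^ m) - h p) \<le> \<delta> s p + \<epsilon> / 4 * \<delta> p q"
    and high_near: "\<And>w c c' p q p'. 0 < w \<Longrightarrow> p \<in> X \<Longrightarrow> q \<in> X \<Longrightarrow> cube_pair N c w p q \<Longrightarrow>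
        p \<in> cube N c' (w / 2 ^ m) \<Longrightarrow> \<not> low (w / 2 ^ m) c' \<Longrightarrow> p' \<in> X \<Longrightarrow>
        (\<And>j. j < N \<Longrightarrow> \<bar>p' j - p j\<bar> \<le> w / 2 ^ M) \<Longrightarrow> \<delta> p' p \<le> \<epsilon> / 16 * \<delta> p q"
begin

context
  fixes P :: "(nat \<Rightarrow> real) set" and W :: real
  assumes finite_P: "finite P" and P_subset: "P \<subseteq> X" and W_pos: "0 < W"
    and P_bounded: "\<And>p q i. p \<in> P \<Longrightarrow> q \<in> P \<Longrightarrow> i < N \<Longrightarrow> \<bar>p i - q i\<bar> \<le> W / 3"
begin

private abbreviation (input) "cell \<equiv> dyadic_cell N W"
private abbreviation (input) "side \<equiv> \<lambda>l. W / 2 ^ l"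

private lemma side_pos: "0 < side l"
  using W_pos by simp

interpretation level: cell_hierarchy "cell \<sigma>" P 3 X \<delta> "\<lambda>l c. net (side l) (corner W \<sigma> l c)"
  "\<lambda>l c. low (side l) (corner W \<sigma> l c)" "\<lambda>l c. anchor (side l) (corner W \<sigma> l c)" "\<lambda>l. H (side l)" h m M K for \<sigma>
proof
  show "\<exists>L. \<forall>l\<ge>L. inj_on (cell \<sigma> l) P"
    using W_pos finite_P coordinates P_subset by (intro eventually_inj_dyadic_cell) blast+
  fix l l' p assume nested: "p \<in> P" "l < l'" "low (side l') (corner W \<sigma> l' (cell \<sigma> l' p))"
  have "(2::real) ^ Suc l \<le> 2 ^ l'" using nested(2) by (intro power_increasing) auto
  then have "side l' \<le> side (Suc l)" using W_pos by (intro divide_left_mono) auto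
  then show "\<delta> (anchor (side l) (corner W \<sigma> l (cell \<sigma> l p))) (anchor (side l') (corner W \<sigma> l' (cell \<sigma> l' p)))
      \<le> H (side l) - H (side l')"
    using nested W_pos by (intro anchor_chain[of _ _ p] mem_cube_corner) auto
qed (use finite_P P_subset side_pos net_subset finite_net card_net K_ge_1 m_le_M anchor_in
  in \<open>auto intro: dyadic_cell_coarsen anchor_end mem_cube_corner W_pos\<close>)

private abbreviation (input) "edges \<equiv> \<Union>\<sigma>\<in>Pow {..<N}. level.edges \<sigma>"

private lemma connected_level:
  "\<sigma> \<subseteq> {..<N} \<Longrightarrow> connected_within \<delta> (level.edges \<sigma>) x y t \<Longrightarrow> connected_within \<delta> edges x y t"
  by (erule connected_within_mono) auto

private lemma connected_leg:
  assumes \<sigma>: "\<sigma> \<subseteq> {..<N}" and p: "p \<in> P" and q: "q \<in> P" and br: "level.branching \<sigma> l p"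
    and pair: "cube_pair N (corner W \<sigma> l (cell \<sigma> l p)) (side l) p q"
    and s: "s \<in> net (side l) (corner W \<sigma> l (cell \<sigma> l p))" and far: "\<delta> s p \<le> 2 * \<delta> p q"
    and pq: "0 < \<delta> p q"
    and IH: "\<And>x. x \<in> P \<Longrightarrow> \<delta> x p < \<delta> p q \<Longrightarrow> connected_within \<delta> edges x p ((1 + \<epsilon>) * \<delta> x p)"
  shows "connected_within \<delta> edges s p (\<delta> s p + \<epsilon> / 4 * \<delta> p q)"
proof -
  have X: "p \<in> X" "q \<in> X" "s \<in> X" using p q s P_subset net_subset[OF side_pos] by auto
  have side: "side l / 2 ^ k = side (l + k)" for k by (simp add: power_add)
  let ?c = "corner W \<sigma> (l + m) (cell \<sigma> (l + m) p)"
  have cube: "p \<in> cube N ?c (side l / 2 ^ m)" unfolding side by (rule mem_cube_corner[OF W_pos])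
  show ?thesis
  proof (cases "low (side l / 2 ^ m) ?c")
    case True
    from level.connected_low[OF p br s] this low_detour[OF side_pos X(1,2) pair s far cube True]
    have "connected_within \<delta> (level.edges \<sigma>) s p (\<delta> s p + \<epsilon> / 4 * \<delta> p q)"
      unfolding side by (blast intro: connected_within_mono)
    then show ?thesis by (rule connected_level[OF \<sigma>])
  next
    case False
    obtain p' where p': "p' \<in> P" "cell \<sigma> (l + M) p' = cell \<sigma> (l + M) p"
      and sp': "connected_within \<delta> (level.edges \<sigma>) s p' (\<delta> s p')"
      using level.connected_rep[OF p br s] by blast
    have p'X: "p' \<in> X" using p'(1) P_subset by blast
    have "\<bar>p' j - p j\<bar> \<le> side l / 2 ^ M" if "j < N" for j
      using dyadic_cell_close[OF W_pos that p'(2)] unfolding side by simp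
    then have near: "\<delta> p' p \<le> \<epsilon> / 16 * \<delta> p q"
      by (rule high_near[OF side_pos X(1,2) pair cube False p'X])
    also have "\<dots> < 1 * \<delta> p q" using \<epsilon>_le_1 pq by (intro mult_strict_right_mono) auto
    finally have "connected_within \<delta> edges p' p ((1 + \<epsilon>) * \<delta> p' p)" using IH[OF p'(1)] by simp
    from connected_within_trans[OF connected_level[OF \<sigma> sp'] this] show ?thesis
    proof this
      have "\<delta> s p' \<le> \<delta> s p + \<delta> p' p" using triangle[OF X(3,1) p'X] sym[OF X(1) p'X] by simp
      moreover have "(1 + \<epsilon>) * \<delta> p' p \<le> 2 * \<delta> p' p"
        using \<epsilon>_le_1 nonneg[OF p'X X(1)] by (intro mult_right_mono) auto
      moreover have "0 \<le> \<epsilon> * \<delta> p q" using \<epsilon>_pos pq by simp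
      ultimately show "\<delta> s p' + (1 + \<epsilon>) * \<delta> p' p \<le> \<delta> s p + \<epsilon> / 4 * \<delta> p q" using near by simp
    qed
  qed
qed

private lemma edges_subset: "edges \<subseteq> edges_on X"
  unfolding level.edges_def by blast

private lemma edge_sym: "{x, y} \<in> edges \<Longrightarrow> \<delta> x y = \<delta> y x"
  by (drule subsetD[OF edges_subset]) (simp add: doubleton_in_edges_on sym)

private lemma connected_pair:
  assumes p: "p \<in> P" and q: "q \<in> P"
    and IH: "\<And>x y. x \<in> P \<Longrightarrow> y \<in> P \<Longrightarrow> \<delta> x y < \<delta> p q \<Longrightarrow> connected_within \<delta> edges x y ((1 + \<epsilon>) * \<delta> x y)"
  shows "connected_within \<delta> edges p q ((1 + \<epsilon>) * \<delta> p q)"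
proof (cases "p = q")
  case True
  then have "0 \<le> (1 + \<epsilon>) * \<delta> p q" using nonneg[of p q] p P_subset \<epsilon>_pos by auto
  then show ?thesis unfolding True by (rule connected_within.stay)
next
  case False
  have X: "p \<in> X" "q \<in> X" using p q P_subset by auto
  have D: "0 < \<delta> p q" by (rule pos[OF X False])
  obtain \<sigma> l where \<sigma>: "\<sigma> \<subseteq> {..<N}" and same: "cell \<sigma> l p = cell \<sigma> l q"
    and split: "cell \<sigma> (l + 3) p \<noteq> cell \<sigma> (l + 3) q"
    and pair: "cube_pair N (corner W \<sigma> l (cell \<sigma> l p)) (side l) p q"
    by (rule ex_separating_dyadic_cell[OF W_pos, of N p q])
      (use coordinates[OF X] False P_bounded[OF p q] in blast)+
  have br: "level.branching \<sigma> l p" "level.branching \<sigma> l q"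
    unfolding level.branching_def using p q same split by metis+
  obtain s where s: "s \<in> net (side l) (corner W \<sigma> l (cell \<sigma> l p))" "\<delta> p s + \<delta> s q \<le> (1 + \<epsilon> / 4) * \<delta> p q"
    using detour[OF side_pos] X pair unfolding detour_net_def by blast
  have sX: "s \<in> X" using s(1) net_subset[OF side_pos] by blast
  have "(1 + \<epsilon> / 4) * \<delta> p q \<le> 2 * \<delta> p q" using \<epsilon>_le_1 D by (intro mult_right_mono) auto
  then have far: "\<delta> s p \<le> 2 * \<delta> p q" "\<delta> s q \<le> 2 * \<delta> q p"
    using s(2) sym[OF sX X(1)] sym[OF X] nonneg[OF X(1) sX] nonneg[OF sX X(2)] by linarith+
  have "connected_within \<delta> edges s p (\<delta> s p + \<epsilon> / 4 * \<delta> p q)"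
    by (rule connected_leg[OF \<sigma> p q br(1) pair s(1) far(1) D]) (rule IH[OF _ p])
  then have ps: "connected_within \<delta> edges p s (\<delta> s p + \<epsilon> / 4 * \<delta> p q)"
    by (rule connected_within_sym[rotated]) (rule edge_sym)
  have sq: "connected_within \<delta> edges s q (\<delta> s q + \<epsilon> / 4 * \<delta> q p)"
    by (rule connected_leg[OF \<sigma> q p br(2) _ _ far(2)])
      (use cube_pair_sym[OF pair] s(1) same D sym[OF X] IH q in auto)
  show ?thesis
  proof (rule connected_within_trans[OF ps sq])
    have "0 \<le> \<epsilon> * \<delta> p q" using \<epsilon>_pos D by simp
    then show "(\<delta> s p + \<epsilon> / 4 * \<delta> p q) + (\<delta> s q + \<epsilon> / 4 * \<delta> q p) \<le> (1 + \<epsilon>) * \<delta> p q"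
      using s(2) sym[OF sX X(1)] sym[OF X] by (simp add: algebra_simps)
  qed
qed

private lemma card_edges: "real (card edges) \<le> 2 ^ N * (K * (3 * real M + 10)) * real (card P)"
proof -
  have "real (card edges) \<le> K * (3 * real (M + 3) + 1) * real (card P) * real (card (Pow {..<N}))"
    by (rule real_card_UN_le) (simp_all add: level.card_edges del: of_nat_add)
  also have "3 * real (M + 3) + 1 = 3 * real M + 10" by simp
  finally show ?thesis by (simp only: card_Pow finite_lessThan card_lessThan of_nat_power of_nat_numeral mult_ac)
qed

lemma ex_spanner_of_bounded:
  "\<exists>E\<subseteq>edges_on X. finite E \<and> real (card E) \<le> 2 ^ N * (K * (3 * real M + 10)) * real (card P) \<and>
     (\<forall>p\<in>P. \<forall>q\<in>P. connected_within \<delta> E p q ((1 + \<epsilon>) * \<delta> p q))"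
proof (intro exI[of _ edges] conjI ballI)
  show "edges \<subseteq> edges_on X" by (rule edges_subset)
  show "finite edges" using level.finite_edges by simp
  show "real (card edges) \<le> 2 ^ N * (K * (3 * real M + 10)) * real (card P)" by (rule card_edges)
  show "connected_within \<delta> edges p q ((1 + \<epsilon>) * \<delta> p q)" if "p \<in> P" "q \<in> P" for p q
    using finite_P that by (rule finite_pair_distance_induct) (rule connected_pair)
qed

end

theorem has_spanners: "has_spanners X \<delta> (1 + \<epsilon>) (2 ^ N * (K * (3 * real M + 10)))"
  unfolding has_spanners_def
proof (intro allI impI)
  fix P assume P: "finite P" "P \<subseteq> X"
  obtain W where "0 < W" "\<And>p q i. p \<in> P \<Longrightarrow> q \<in> P \<Longrightarrow> i < N \<Longrightarrow> \<bar>p i - q i\<bar> \<le> W / 3"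
    using finite_coordinate_bound[OF P(1)] by blast
  with P show "\<exists>E\<subseteq>edges_on X. finite E \<and> real (card E) \<le> 2 ^ N * (K * (3 * real M + 10)) * real (card P) \<and>
      (\<forall>p\<in>P. \<forall>q\<in>P. connected_within \<delta> E p q ((1 + \<epsilon>) * \<delta> p q))"
    by (rule ex_spanner_of_bounded)
qed

end

section \<open>Spaces with a metric comparable to the coordinate distance\<close>

lemma coordinate_metric_has_spanners:
  fixes X :: "(nat \<Rightarrow> real) set"
  assumes metric: "metric_on X \<delta>"
    and lower: "\<And>x y i. x \<in> X \<Longrightarrow> y \<in> X \<Longrightarrow> i < N \<Longrightarrow> \<bar>x i - y i\<bar> \<le> \<delta> x y"
    and upper: "\<And>x y \<rho>. x \<in> X \<Longrightarrow> y \<in> X \<Longrightarrow> (\<And>i. i < N \<Longrightarrow> \<bar>x i - y i\<bar> \<le> \<rho>) \<Longrightarrow> \<delta> x y \<le> C * \<rho>"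
    and net: "\<And>w c. 0 < w \<Longrightarrow> \<exists>S\<subseteq>X. finite S \<and> real (card S) \<le> K \<and> detour_net N X \<delta> \<epsilon> c w S"
    and \<epsilon>: "0 < \<epsilon>" "\<epsilon> \<le> 1" and K: "1 \<le> K" and M: "96 * C / \<epsilon> \<le> 2 ^ M"
  shows "has_spanners X \<delta> (1 + \<epsilon>) (2 ^ N * (K * (3 * real M + 10)))"
proof -
  obtain net where net: "\<And>w c. 0 < w \<Longrightarrow> net w c \<subseteq> X \<and> finite (net w c) \<and> real (card (net w c)) \<le> K \<and>
      detour_net N X \<delta> \<epsilon> c w (net w c)"
    using net by metis
  interpret metric_on X \<delta> by (rule metric)
  interpret cube_routing X \<delta> N net "\<lambda>_ _. False" "\<lambda>_ _. undefined" "\<lambda>_. 0" "\<lambda>_. 0" M M K \<epsilon>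
  proof
    show "x = y" if "x \<in> X" "y \<in> X" "\<And>i. i < N \<Longrightarrow> x i = y i" for x y
      using upper[OF that(1,2), of 0] pos[OF that(1,2)] that(3) by fastforce
    fix w c p q p'
    assume w: "0 < w" and X: "p \<in> X" "q \<in> X" "p' \<in> X" and pair: "cube_pair N c w p q"
      and near: "\<And>j. j < N \<Longrightarrow> \<bar>p' j - p j\<bar> \<le> w / 2 ^ M"
    have "\<delta> p' p \<le> C * (w / 2 ^ M)" by (rule upper[OF X(3,1) near])
    also have "\<dots> = C / 2 ^ M * w" by simp
    also have "\<dots> \<le> \<epsilon> / 96 * w" using M \<epsilon> w by (intro mult_right_mono) (simp_all add: field_simps)
    also have "\<dots> = \<epsilon> / 16 * (w / 6)" by simp
    also have "\<dots> \<le> \<epsilon> / 16 * \<delta> p q"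
      using pair lower[OF X(1,2)] \<epsilon> unfolding cube_pair_def by (intro mult_left_mono) force+
    finally show "\<delta> p' p \<le> \<epsilon> / 16 * \<delta> p q" .
  qed (use net \<epsilon> K in auto)
  show ?thesis by (rule has_spanners)
qed

section \<open>Nets on walls\<close>

lemma ex_representatives:
  assumes "finite (g ` Y)"
  shows "\<exists>S\<subseteq>Y. finite S \<and> card S = card (g ` Y) \<and> (\<forall>y\<in>Y. \<exists>s\<in>S. g s = g y)"
proof -
  obtain S where S: "S \<subseteq> Y" "inj_on g S" "g ` Y = g ` S" by (metis order_refl subset_image_inj)
  then have "finite S" "card S = card (g ` Y)" using assms finite_imageD card_image by metis+
  moreover have "\<exists>s\<in>S. g s = g y" if "y \<in> Y" for y
    using imageI[OF that, of g] unfolding S(3) by force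
  ultimately show ?thesis using S(1) by blast
qed

lemma real_card_floor_interval_le:
  fixes x :: real
  assumes "0 \<le> x"
  shows "real (card {\<lfloor>- x\<rfloor>..\<lfloor>x\<rfloor>}) \<le> 2 * x + 2"
proof -
  have "\<lfloor>- x\<rfloor> \<le> \<lfloor>x\<rfloor>" using assms by (intro floor_mono) simp
  then have "real (card {\<lfloor>- x\<rfloor>..\<lfloor>x\<rfloor>}) = of_int \<lfloor>x\<rfloor> - of_int \<lfloor>- x\<rfloor> + 1" by simp
  then show ?thesis by linarith
qed

lemma ex_grid_net:
  fixes Y :: "('i \<Rightarrow> real) set" and \<theta> \<rho> :: real
  assumes J: "finite J" and \<theta>: "0 < \<theta>" and \<rho>: "0 \<le> \<rho>"
    and bound: "\<And>y j. y \<in> Y \<Longrightarrow> j \<in> J \<Longrightarrow> \<bar>y j - c j\<bar> \<le> \<rho>"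
  shows "\<exists>S\<subseteq>Y. finite S \<and> real (card S) \<le> (2 * \<rho> / \<theta> + 2) ^ card J \<and> (\<forall>y\<in>Y. \<exists>s\<in>S. \<forall>j\<in>J. \<bar>y j - s j\<bar> \<le> \<theta>)"
proof -
  define g where "g y = restrict (\<lambda>j. \<lfloor>(y j - c j) / \<theta>\<rfloor>) J" for y
  define I where "I = {\<lfloor>- (\<rho> / \<theta>)\<rfloor>..\<lfloor>\<rho> / \<theta>\<rfloor>}"
  have "g y \<in> PiE J (\<lambda>_. I)" if y: "y \<in> Y" for y
  proof -
    have "- (\<rho> / \<theta>) \<le> (y j - c j) / \<theta> \<and> (y j - c j) / \<theta> \<le> \<rho> / \<theta>" if "j \<in> J" for j
      unfolding minus_divide_left using bound[OF y that] \<theta> by (intro conjI divide_right_mono) auto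
    then show ?thesis unfolding g_def I_def by (auto simp: floor_mono)
  qed
  then have sub: "g ` Y \<subseteq> PiE J (\<lambda>_. I)" by blast
  have fin: "finite (PiE J (\<lambda>_. I))" using J unfolding I_def by (intro finite_PiE) auto
  obtain S where S: "S \<subseteq> Y" "finite S" "card S = card (g ` Y)" "\<forall>y\<in>Y. \<exists>s\<in>S. g s = g y"
    using ex_representatives[OF finite_subset[OF sub fin]] by blast
  have "card S \<le> card I ^ card J" using card_mono[OF fin sub] S(3) by (simp add: card_PiE[OF J])
  then have "real (card S) \<le> real (card I) ^ card J" by (metis of_nat_le_iff of_nat_power)
  also have "\<dots> \<le> (2 * \<rho> / \<theta> + 2) ^ card J"
    using real_card_floor_interval_le[of "\<rho> / \<theta>"] \<rho> \<theta> unfolding I_def by (intro power_mono) auto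
  finally have card: "real (card S) \<le> (2 * \<rho> / \<theta> + 2) ^ card J" .
  have "\<bar>y j - s j\<bar> \<le> \<theta>" if "g s = g y" "j \<in> J" for y s j
  proof -
    have "\<lfloor>(y j - c j) / \<theta>\<rfloor> = \<lfloor>(s j - c j) / \<theta>\<rfloor>"
      using fun_cong[OF that(1), of j] that(2) unfolding g_def by simp
    then have "\<bar>(y j - c j) / \<theta> - (s j - c j) / \<theta>\<bar> \<le> 1" by linarith
    then show ?thesis using \<theta> by (simp add: abs_divide flip: diff_divide_distrib)
  qed
  then show ?thesis using S card by (intro exI[of _ S]) blast
qed

lemma ex_grid_net_family:
  fixes Y :: "'t \<Rightarrow> ('i \<Rightarrow> real) set" and \<theta> \<rho> :: real
  assumes T: "finite T" and J: "\<And>x. x \<in> T \<Longrightarrow> finite (J x) \<and> card (J x) = n" and \<theta>: "0 < \<theta>"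
    and \<rho>: "0 \<le> \<rho>"
    and bound: "\<And>x y j. x \<in> T \<Longrightarrow> y \<in> Y x \<Longrightarrow> j \<in> J x \<Longrightarrow> \<bar>y j - c j\<bar> \<le> \<rho>"
  shows "\<exists>S\<subseteq>(\<Union>x\<in>T. Y x). finite S \<and> real (card S) \<le> (2 * \<rho> / \<theta> + 2) ^ n * real (card T) \<and>
    (\<forall>x\<in>T. \<forall>y\<in>Y x. \<exists>s\<in>S \<inter> Y x. \<forall>j\<in>J x. \<bar>y j - s j\<bar> \<le> \<theta>)"
proof -
  have "\<forall>x\<in>T. \<exists>S\<subseteq>Y x. finite S \<and> real (card S) \<le> (2 * \<rho> / \<theta> + 2) ^ n \<and>
      (\<forall>y\<in>Y x. \<exists>s\<in>S. \<forall>j\<in>J x. \<bar>y j - s j\<bar> \<le> \<theta>)"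
  proof
    fix x assume "x \<in> T"
    then show "\<exists>S\<subseteq>Y x. finite S \<and> real (card S) \<le> (2 * \<rho> / \<theta> + 2) ^ n \<and>
        (\<forall>y\<in>Y x. \<exists>s\<in>S. \<forall>j\<in>J x. \<bar>y j - s j\<bar> \<le> \<theta>)"
      using ex_grid_net[of "J x" \<theta> \<rho> "Y x" c] J \<theta> \<rho> bound by auto
  qed
  then obtain S where S: "\<And>x. x \<in> T \<Longrightarrow> S x \<subseteq> Y x \<and> finite (S x) \<and> real (card (S x)) \<le> (2 * \<rho> / \<theta> + 2) ^ n \<and>
      (\<forall>y\<in>Y x. \<exists>s\<in>S x. \<forall>j\<in>J x. \<bar>y j - s j\<bar> \<le> \<theta>)"
    by metis
  show ?thesis
  proof (intro exI[of _ "\<Union>x\<in>T. S x"] conjI ballI)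
    show "real (card (\<Union>x\<in>T. S x)) \<le> (2 * \<rho> / \<theta> + 2) ^ n * real (card T)"
      using S by (intro real_card_UN_le T) blast
    show "\<exists>s\<in>(\<Union>x\<in>T. S x) \<inter> Y x. \<forall>j\<in>J x. \<bar>y j - s j\<bar> \<le> \<theta>" if "x \<in> T" "y \<in> Y x" for x y
      using S[OF that(1)] that by blast
  qed (use S T in blast)+
qed

text \<open>The middle third of an interval longer than \<open>w / 6\<close> is longer than the spacing \<open>w / 24\<close> of the walls.\<close>

lemma ex_wall_in_middle_third:
  fixes a b c w :: real
  assumes w: "0 < w" and ab: "c \<le> a" "w / 6 < b - a" "b < c + w"
  shows "\<exists>k\<le>24. c + real k * w / 24 \<in> {a + (b - a) / 3..a + 2 * (b - a) / 3}"
proof -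
  let ?x = "(a + (b - a) / 3 - c) * 24 / w"
  have "0 \<le> a + (b - a) / 3 - c" using w ab by argo
  then have "0 \<le> ?x" using w by (intro divide_nonneg_pos mult_nonneg_nonneg) auto
  then have "real (nat \<lceil>?x\<rceil>) = of_int \<lceil>?x\<rceil>" by simp
  then have "?x \<le> real (nat \<lceil>?x\<rceil>)" "real (nat \<lceil>?x\<rceil>) < ?x + 1" by linarith+
  then have "(a + (b - a) / 3 - c) * 24 \<le> real (nat \<lceil>?x\<rceil>) * w"
    "real (nat \<lceil>?x\<rceil>) * w < (a + (b - a) / 3 - c) * 24 + w"
    using w by (simp_all add: field_simps)
  then have mid: "c + real (nat \<lceil>?x\<rceil>) * w / 24 \<in> {a + (b - a) / 3..a + 2 * (b - a) / 3}"
    using w ab by (simp add: field_simps)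
  then have "real (nat \<lceil>?x\<rceil>) * w \<le> 24 * w" using w ab by (simp add: field_simps)
  then have "nat \<lceil>?x\<rceil> \<le> 24" using w by simp
  then show ?thesis using mid by blast
qed

lemma ex_wall_between:
  fixes a b c w :: real
  assumes "0 < w" "c \<le> a" "a < c + w" "c \<le> b" "b < c + w" "w / 6 < \<bar>a - b\<bar>"
  shows "\<exists>k\<le>24. \<exists>u. 1 / 3 \<le> u \<and> u \<le> 2 / 3 \<and> c + real k * w / 24 = a + u * (b - a)"
  using assms(2-)
proof (induction a b rule: linorder_wlog)
  case (le a b)
  then have ab: "w / 6 < b - a" by simp
  then obtain k where k: "k \<le> 24" "c + real k * w / 24 \<in> {a + (b - a) / 3..a + 2 * (b - a) / 3}"
    using ex_wall_in_middle_third[OF assms(1), of c a b] le by auto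
  define u where "u = (c + real k * w / 24 - a) / (b - a)"
  have "0 < b - a" using ab assms(1) by linarith
  then have "1 / 3 \<le> u" "u \<le> 2 / 3" "c + real k * w / 24 = a + u * (b - a)"
    using k(2) unfolding u_def by (simp_all add: field_simps)
  then show ?case using k(1) by blast
next
  case (sym a b)
  then obtain k u where "k \<le> 24" "1 / 3 \<le> u" "u \<le> 2 / 3" "c + real k * w / 24 = b + u * (a - b)"
    by (auto simp: abs_minus_commute)
  moreover have "b + u * (a - b) = a + (1 - u) * (b - a)" by algebra
  ultimately show ?case by (intro exI[of _ k] conjI exI[of _ "1 - u"]) auto
qed

definition wall_net ::
  "nat \<Rightarrow> (nat \<Rightarrow> real) \<Rightarrow> real \<Rightarrow> real \<Rightarrow> (nat \<Rightarrow> real) set \<Rightarrow> (nat \<Rightarrow> real) set \<Rightarrow> bool" where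
  "wall_net N c w \<theta> Q S \<longleftrightarrow> S \<subseteq> Q \<and> finite S \<and>
     (\<forall>y\<in>Q. \<forall>i<N. \<forall>k\<le>24. y i = c i + real k * w / 24 \<longrightarrow> (\<exists>s\<in>S. \<forall>j<N. \<bar>y j - s j\<bar> \<le> \<theta>))"

lemma wall_net_crossing:
  assumes net: "wall_net N c w \<theta> Q S" and pair: "cube_pair N c w p q" and w: "0 < w"
  obtains i u where "i < N" "w / 6 < \<bar>p i - q i\<bar>" "1 / 3 \<le> u" "u \<le> 2 / 3"
    and "\<And>y. y \<in> Q \<Longrightarrow> y i = p i + u * (q i - p i) \<Longrightarrow> \<exists>s\<in>S. \<forall>j<N. \<bar>y j - s j\<bar> \<le> \<theta>"
proof -
  obtain i where i: "i < N" "w / 6 < \<bar>p i - q i\<bar>" using pair unfolding cube_pair_def by blast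
  then obtain k u where "k \<le> 24" "1 / 3 \<le> u" "u \<le> 2 / 3" "c i + real k * w / 24 = p i + u * (q i - p i)"
    using ex_wall_between[OF w, of "c i" "p i" "q i"] pair unfolding cube_pair_def cube_def by blast
  then show thesis using net i unfolding wall_net_def by (intro that[of i u]) metis+
qed

lemma ex_wall_net:
  assumes \<theta>: "0 < \<theta>" and \<rho>: "0 \<le> \<rho>" and bound: "\<And>y j. y \<in> Q \<Longrightarrow> j < N \<Longrightarrow> \<bar>y j - c j\<bar> \<le> \<rho>"
  shows "\<exists>S. wall_net N c w \<theta> Q S \<and> real (card S) \<le> 25 * real N * (2 * \<rho> / \<theta> + 2) ^ (N - 1)"
proof -
  let ?T = "{..<N} \<times> {..24::nat}" and ?Y = "\<lambda>(i, k). {y\<in>Q. y i = c i + real k * w / 24}"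
  have "\<exists>S\<subseteq>(\<Union>x\<in>?T. ?Y x). finite S \<and> real (card S) \<le> (2 * \<rho> / \<theta> + 2) ^ (N - 1) * real (card ?T) \<and>
    (\<forall>x\<in>?T. \<forall>y\<in>?Y x. \<exists>s\<in>S \<inter> ?Y x. \<forall>j\<in>{..<N} - {fst x}. \<bar>y j - s j\<bar> \<le> \<theta>)"
    by (rule ex_grid_net_family) (use \<theta> \<rho> bound in auto)
  then obtain S where S: "S \<subseteq> (\<Union>x\<in>?T. ?Y x)" "finite S"
      "real (card S) \<le> (2 * \<rho> / \<theta> + 2) ^ (N - 1) * real (card ?T)"
    and net: "\<And>x y. x \<in> ?T \<Longrightarrow> y \<in> ?Y x \<Longrightarrow> \<exists>s\<in>S \<inter> ?Y x. \<forall>j\<in>{..<N} - {fst x}. \<bar>y j - s j\<bar> \<le> \<theta>"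
    by blast
  have "\<exists>s\<in>S. \<forall>j<N. \<bar>y j - s j\<bar> \<le> \<theta>"
    if y: "y \<in> Q" "i < N" "k \<le> 24" "y i = c i + real k * w / 24" for y i k
  proof -
    obtain s where s: "s \<in> S" "s i = c i + real k * w / 24" "\<forall>j\<in>{..<N} - {i}. \<bar>y j - s j\<bar> \<le> \<theta>"
      using net[of "(i, k)" y] y by auto
    have "\<bar>y j - s j\<bar> \<le> \<theta>" if "j < N" for j using that s y(4) \<theta> by (cases "j = i") auto
    then show ?thesis using s(1) by blast
  qed
  then have "wall_net N c w \<theta> Q S" unfolding wall_net_def using S(1,2) by auto
  moreover have "real (card ?T) = 25 * real N" by simp
  ultimately show ?thesis using S(3) by (auto simp only: mult.commute)
qed

section \<open>Euclidean space\<close>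

lemma euc_dist_L2: "model_dist Euc d x y = L2_set (\<lambda>i. x i - y i) {..<d}"
  by (simp add: L2_set_def)

lemma abs_coordinate_le_L2: "i < d \<Longrightarrow> \<bar>x i\<bar> \<le> L2_set x {..<d}" for d :: nat
  using member_le_L2_set[of "{..<d}" i "\<lambda>i. \<bar>x i\<bar>"] unfolding L2_set_def by simp

lemma L2_le_coordinate_bound:
  fixes x :: "nat \<Rightarrow> real"
  assumes "\<And>i. i < d \<Longrightarrow> \<bar>x i\<bar> \<le> \<rho>"
  shows "L2_set x {..<d} \<le> real d * \<rho>"
  using L2_set_le_sum_abs[of x "{..<d}"] sum_bounded_above[of "{..<d}" "\<lambda>i. \<bar>x i\<bar>" \<rho>] assms by simp

lemma metric_on_Euc: "metric_on (model_carrier Euc d) (model_dist Euc d)"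
proof
  fix x y z :: "nat \<Rightarrow> real"
  assume X: "x \<in> model_carrier Euc d" "y \<in> model_carrier Euc d"
  show "0 \<le> model_dist Euc d x y" unfolding euc_dist_L2 by (rule L2_set_nonneg)
  show "model_dist Euc d x y = model_dist Euc d y x" by (simp add: power2_commute)
  show "model_dist Euc d x z \<le> model_dist Euc d x y + model_dist Euc d y z"
    using L2_set_triangle_ineq[of "\<lambda>i. x i - y i" "\<lambda>i. y i - z i" "{..<d}"]
    unfolding euc_dist_L2 by simp
  show "0 < model_dist Euc d x y" if "x \<noteq> y"
  proof -
    obtain i where i: "x i \<noteq> y i" using \<open>x \<noteq> y\<close> by blast
    then have "i < d" using X by (cases "i < d") auto
    then show ?thesis unfolding euc_dist_L2
      using i abs_coordinate_le_L2[of i d "\<lambda>i. x i - y i"] by simp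
  qed
qed

lemma sum_squares_bounded_above:
  fixes x :: "nat \<Rightarrow> real"
  assumes "\<And>i. i < n \<Longrightarrow> \<bar>x i\<bar> \<le> \<rho>"
  shows "(\<Sum>i<n. (x i)\<^sup>2) \<le> real n * \<rho>\<^sup>2"
proof -
  have "(x i)\<^sup>2 \<le> \<rho>\<^sup>2" if "i < n" for i using assms[OF that] by (simp flip: abs_le_square_iff)
  then show ?thesis using sum_bounded_above[of "{..<n}" "\<lambda>i. (x i)\<^sup>2" "\<rho>\<^sup>2"] by simp
qed

lemma stewart_sum_squares:
  fixes p q s y :: "nat \<Rightarrow> real"
  assumes y: "\<And>j. j < d \<Longrightarrow> y j = p j + u * (q j - p j)"
  shows "(1 - u) * (\<Sum>j<d. (p j - s j)\<^sup>2) + u * (\<Sum>j<d. (s j - q j)\<^sup>2)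
     = (\<Sum>j<d. (y j - s j)\<^sup>2) + u * (1 - u) * (\<Sum>j<d. (p j - q j)\<^sup>2)"
proof -
  have "(1 - u) * (p j - s j)\<^sup>2 + u * (s j - q j)\<^sup>2 = (y j - s j)\<^sup>2 + u * (1 - u) * (p j - q j)\<^sup>2"
    if "j < d" for j
    unfolding y[OF that] by algebra
  then have "(\<Sum>j<d. (1 - u) * (p j - s j)\<^sup>2 + u * (s j - q j)\<^sup>2) =
      (\<Sum>j<d. (y j - s j)\<^sup>2 + u * (1 - u) * (p j - q j)\<^sup>2)" by simp
  then show ?thesis by (simp add: sum.distrib sum_distrib_left)
qed

lemma middle_third_product_ge:
  fixes u :: real
  assumes "1 / 3 \<le> u" "u \<le> 2 / 3"
  shows "2 / 9 \<le> u * (1 - u)"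
proof -
  have "0 \<le> (u - 1 / 3) * (2 / 3 - u)" using assms by simp
  also have "\<dots> = u * (1 - u) - 2 / 9" by algebra
  finally show ?thesis by simp
qed

text \<open>By Stewart's theorem the hypothesis holds for the distances \<open>a\<close> and \<open>b\<close> of a point to the ends of a segment of
  length \<open>D\<close> and its distance \<open>\<surd>t\<close> to the point dividing the segment in the ratio \<open>u : 1 - u\<close>.\<close>

lemma stewart_excess:
  fixes a b D t u :: real
  assumes stewart: "(1 - u) * a\<^sup>2 + u * b\<^sup>2 = t + u * (1 - u) * D\<^sup>2"
    and u: "1 / 3 \<le> u" "u \<le> 2 / 3" and D: "0 < D" and t: "0 \<le> t"
  shows "a + b \<le> D + 9 / 4 * t / D"
proof (cases "a + b \<le> D")
  case True
  moreover have "0 \<le> 9 / 4 * t / D" using D t by simp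
  ultimately show ?thesis by linarith
next
  case False
  have "0 \<le> (1 - u) * (a - u * D)\<^sup>2 + u * (b - (1 - u) * D)\<^sup>2" using u by simp
  moreover have "4 / 9 * (D * (a + b - D)) \<le> 2 * (u * (1 - u)) * (D * (a + b - D))"
    using False D middle_third_product_ge[OF u] by (intro mult_right_mono) auto
  moreover have "2 * (u * (1 - u)) * (D * (a + b - D)) = t - ((1 - u) * (a - u * D)\<^sup>2 + u * (b - (1 - u) * D)\<^sup>2)"
    using stewart by algebra
  ultimately have "4 / 9 * (D * (a + b - D)) \<le> t" by linarith
  then have "a + b - D \<le> 9 / 4 * t / D" using D by (simp add: field_simps)
  then show ?thesis by simp
qed

lemma euc_detour_le:
  assumes y: "\<And>j. j < d \<Longrightarrow> y j = p j + u * (q j - p j)" and u: "1 / 3 \<le> u" "u \<le> 2 / 3"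
    and near: "\<And>j. j < d \<Longrightarrow> \<bar>y j - s j\<bar> \<le> \<theta>" and D: "0 < model_dist Euc d p q"
  shows "model_dist Euc d p s + model_dist Euc d s q
    \<le> model_dist Euc d p q + 9 / 4 * (real d * \<theta>\<^sup>2) / model_dist Euc d p q"
proof -
  let ?t = "\<Sum>j<d. (y j - s j)\<^sup>2"
  have "model_dist Euc d p s + model_dist Euc d s q \<le> model_dist Euc d p q + 9 / 4 * ?t / model_dist Euc d p q"
    by (rule stewart_excess[OF _ u D]) (use stewart_sum_squares[OF y, of d] in \<open>simp_all add: sum_nonneg\<close>)
  moreover have "?t \<le> real d * \<theta>\<^sup>2" by (rule sum_squares_bounded_above[OF near])
  then have "9 / 4 * ?t / model_dist Euc d p q \<le> 9 / 4 * (real d * \<theta>\<^sup>2) / model_dist Euc d p q"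
    using D by (intro divide_right_mono mult_left_mono) auto
  ultimately show ?thesis by linarith
qed

lemma abs_diff_corner_segment_le:
  assumes "p \<in> cube N c w" "q \<in> cube N c w" "0 \<le> u" "u \<le> 1" "j < N"
  shows "\<bar>p j + u * (q j - p j) - c j\<bar> \<le> w"
proof -
  have "p j + u * (q j - p j) - c j = (1 - u) * (p j - c j) + u * (q j - c j)" by algebra
  also have "\<bar>\<dots>\<bar> \<le> (1 - u) * \<bar>p j - c j\<bar> + u * \<bar>q j - c j\<bar>"
    using assms(3,4) by (intro order_trans[OF abs_triangle_ineq]) (simp add: abs_mult)
  also have "\<dots> \<le> (1 - u) * w + u * w"
    using assms by (intro add_mono mult_left_mono abs_diff_cube_corner) auto
  finally show ?thesis by (simp add: algebra_simps)
qed

lemma ex_euc_detour_net: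
  assumes d: "1 \<le> d" and \<epsilon>: "0 < \<epsilon>" and w: "0 < w"
  shows "\<exists>S\<subseteq>model_carrier Euc d. finite S \<and> real (card S) \<le> 25 * real d * (400 * real d / sqrt \<epsilon> + 2) ^ (d - 1) \<and>
    detour_net d (model_carrier Euc d) (model_dist Euc d) \<epsilon> c w S"
proof -
  let ?X = "model_carrier Euc d" and ?\<delta> = "model_dist Euc d"
  define \<theta> where "\<theta> = sqrt \<epsilon> * w / (200 * real d)"
  define Q where "Q = {y\<in>?X. \<forall>j<d. \<bar>y j - c j\<bar> \<le> w}"
  have \<theta>: "0 < \<theta>" unfolding \<theta>_def using \<epsilon> w d by simp
  have "2 * w / \<theta> = 400 * real d / sqrt \<epsilon>" unfolding \<theta>_def using w d \<epsilon> by (simp add: field_simps)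
  then obtain S where S: "wall_net d c w \<theta> Q S"
    "real (card S) \<le> 25 * real d * (400 * real d / sqrt \<epsilon> + 2) ^ (d - 1)"
    using ex_wall_net[OF \<theta>, of w Q d c w] w unfolding Q_def by auto
  have "\<exists>s\<in>S. ?\<delta> p s + ?\<delta> s q \<le> (1 + \<epsilon> / 4) * ?\<delta> p q"
    if X: "p \<in> ?X" "q \<in> ?X" and pair: "cube_pair d c w p q" for p q
  proof -
    obtain i u where i: "i < d" "w / 6 < \<bar>p i - q i\<bar>" and u: "1 / 3 \<le> u" "u \<le> 2 / 3"
      and cross: "\<And>y. y \<in> Q \<Longrightarrow> y i = p i + u * (q i - p i) \<Longrightarrow> \<exists>s\<in>S. \<forall>j<d. \<bar>y j - s j\<bar> \<le> \<theta>"
      using wall_net_crossing[OF S(1) pair w] by metis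
    define y where "y j = p j + u * (q j - p j)" for j
    have "\<bar>y j - c j\<bar> \<le> w" if "j < d" for j
      using pair u that unfolding y_def cube_pair_def by (intro abs_diff_corner_segment_le) auto
    then have "y \<in> Q" unfolding Q_def using X by (simp add: y_def)
    then obtain s where s: "s \<in> S" "\<forall>j<d. \<bar>y j - s j\<bar> \<le> \<theta>" using cross y_def by blast
    have D: "w / 6 < ?\<delta> p q"
      using i abs_coordinate_le_L2[of i d "\<lambda>i. p i - q i"] unfolding euc_dist_L2 by linarith
    then have Dpos: "0 < ?\<delta> p q" using w by linarith
    have "?\<delta> p s + ?\<delta> s q \<le> ?\<delta> p q + 9 / 4 * (real d * \<theta>\<^sup>2) / ?\<delta> p q"
      by (rule euc_detour_le[OF y_def u _ Dpos]) (use s(2) in blast)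
    also have "9 / 4 * (real d * \<theta>\<^sup>2) / ?\<delta> p q \<le> \<epsilon> / 4 * ?\<delta> p q"
    proof -
      have "real d * \<theta>\<^sup>2 = \<epsilon> * w\<^sup>2 / (40000 * real d)"
        unfolding \<theta>_def using \<epsilon> d by (simp add: power_mult_distrib power_divide power2_eq_square)
      also have "\<dots> \<le> \<epsilon> * w\<^sup>2 / 324" using d \<epsilon> by (intro divide_left_mono) auto
      also have "\<dots> = \<epsilon> / 9 * (w / 6)\<^sup>2" by (simp add: power_divide)
      also have "\<dots> \<le> \<epsilon> / 9 * (?\<delta> p q)\<^sup>2" using D w \<epsilon> by (intro mult_left_mono power_mono) auto
      finally have "9 / 4 * (real d * \<theta>\<^sup>2) \<le> \<epsilon> / 4 * ?\<delta> p q * ?\<delta> p q"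
        unfolding power2_eq_square[of "?\<delta> p q"] by (simp add: mult.assoc del: model_dist.simps)
      then show ?thesis using Dpos by (simp only: pos_divide_le_eq)
    qed
    finally show ?thesis using s(1) by (auto simp: distrib_right simp del: model_dist.simps)
  qed
  then show ?thesis using S unfolding wall_net_def detour_net_def Q_def by (intro exI[of _ S]) blast
qed

lemma euc_has_spanners:
  assumes d: "1 \<le> d" and \<epsilon>: "0 < \<epsilon>" "\<epsilon> \<le> 1" and M: "96 * real d / \<epsilon> \<le> 2 ^ M"
  shows "has_spanners (model_carrier Euc d) (model_dist Euc d) (1 + \<epsilon>)
    (2 ^ d * (25 * real d * (400 * real d / sqrt \<epsilon> + 2) ^ (d - 1) * (3 * real M + 10)))"
proof (rule coordinate_metric_has_spanners[OF metric_on_Euc _ _ ex_euc_detour_net[OF d \<epsilon>(1)] \<epsilon> _ M])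
  have "1 \<le> (400 * real d / sqrt \<epsilon> + 2) ^ (d - 1)" using \<epsilon> by (intro one_le_power) simp
  then have "1 * 1 \<le> 25 * real d * (400 * real d / sqrt \<epsilon> + 2) ^ (d - 1)"
    using d by (intro mult_mono) auto
  then show "1 \<le> 25 * real d * (400 * real d / sqrt \<epsilon> + 2) ^ (d - 1)" by simp
qed (use abs_coordinate_le_L2 L2_le_coordinate_bound in \<open>simp_all add: euc_dist_L2 del: model_dist.simps\<close>)

section \<open>Trigonometric inequalities\<close>

lemma sin_ge_linear:
  fixes t :: real
  assumes "0 \<le> t" "t \<le> pi / 2"
  shows "2 / pi * t \<le> sin t"
proof -
  have "convex_on {0..pi / 2} (\<lambda>x. - sin x)"
    by (rule f''_ge0_imp_convex[where f' = "\<lambda>x. - cos x" and f'' = sin])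
      (auto intro!: derivative_eq_intros sin_ge_zero)
  from convex_onD[OF this, of "2 / pi * t" 0 "pi / 2"] show ?thesis
    using assms by (simp add: field_simps)
qed

lemma sin_ge_half:
  fixes t :: real
  assumes "0 \<le> t" "t \<le> pi / 2"
  shows "t / 2 \<le> sin t"
proof -
  have "1 / 2 \<le> 2 / pi" using pi_less_4 by (simp add: field_simps)
  then have "1 / 2 * t \<le> 2 / pi * t" using assms(1) by (rule mult_right_mono)
  then show ?thesis using sin_ge_linear[OF assms] by simp
qed

lemma sin_ge_half_of_between:
  fixes b x :: real
  assumes "0 \<le> b" "b \<le> x" "x \<le> pi - b"
  shows "b / 2 \<le> sin x"
  using sin_ge_half[of x] sin_ge_half[of "pi - x"] assms by (cases "x \<le> pi / 2") auto

lemma one_minus_cos_le: "1 - cos t \<le> t\<^sup>2 / 2" for t :: real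
proof -
  have "1 - cos t = 2 * (sin (t / 2))\<^sup>2" using cos_double_sin[of "t / 2"] by simp
  also have "(sin (t / 2))\<^sup>2 \<le> (t / 2)\<^sup>2"
    using abs_sin_x_le_abs_x[of "t / 2"] by (simp only: abs_le_square_iff)
  finally show ?thesis by (simp add: power2_eq_square)
qed

lemma cos_le_cos_of_abs_le: "\<bar>u\<bar> \<le> t \<Longrightarrow> t \<le> pi \<Longrightarrow> cos t \<le> cos u"
  using cos_monotone_0_pi_le[of "\<bar>u\<bar>" t] by simp

lemma add_le_four_sin_add_sin:
  fixes u v :: real
  assumes "\<bar>u\<bar> \<le> 1" "\<bar>v\<bar> \<le> 1" "0 \<le> u + v"
  shows "u + v \<le> 4 * (sin u + sin v)"
proof -
  have "(u + v) / 2 / 2 \<le> sin ((u + v) / 2)" using assms pi_gt3 by (intro sin_ge_half) auto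
  moreover have "\<bar>u - v\<bar> \<le> 2" using assms(1,2) by linarith
  then have "\<bar>(u - v) / 2\<bar> \<le> pi / 3" unfolding abs_divide using pi_gt3 by simp
  then have "1 / 2 \<le> cos ((u - v) / 2)"
    using cos_le_cos_of_abs_le[of _ "pi / 3"] by (simp add: cos_60)
  ultimately have "((u + v) / 2 / 2) * (1 / 2) \<le> sin ((u + v) / 2) * cos ((u - v) / 2)"
    using assms by (intro mult_mono) auto
  then show ?thesis unfolding sin_plus_sin by simp
qed

text \<open>The first order terms of the changes \<open>a' - a\<close> and \<open>b' - b\<close> have the same weight in the spherical
  form \<open>cos t = \<alpha> cos a' + \<beta> cos b'\<close> of Stewart's theorem.\<close>

lemma spherical_stewart:
  fixes a b a' b' t \<alpha> \<beta> :: real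
  assumes stewart: "cos t = \<alpha> * cos a' + \<beta> * cos b'" and one: "1 = \<alpha> * cos a + \<beta> * cos b"
    and \<alpha>: "\<alpha> * sin (a + b) = sin b" and \<beta>: "\<beta> * sin (a + b) = sin a" and nonneg: "0 \<le> \<alpha>" "0 \<le> \<beta>"
    and ab: "0 \<le> a" "0 \<le> b" "a + b \<le> pi" and t: "t \<le> pi" "\<bar>a' - a\<bar> \<le> t" "\<bar>b' - b\<bar> \<le> t"
  shows "sin a * sin b * (sin (a' - a) + sin (b' - b)) \<le> t\<^sup>2 * (sin a + sin b)"
proof -
  define u v where "u = a' - a" and "v = b' - b"
  have s: "0 \<le> sin a" "0 \<le> sin b" "0 \<le> sin (a + b)" using ab by (auto intro: sin_ge_zero)
  have second_order: "k * (cos z - 1) \<le> 1 - cos t" if "\<bar>k\<bar> \<le> 1" "\<bar>z\<bar> \<le> t" for k z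
  proof -
    have "- k * (1 - cos z) \<le> 1 * (1 - cos z)" using that by (intro mult_right_mono) auto
    then show ?thesis using cos_le_cos_of_abs_le[OF that(2) t(1)] by (simp add: algebra_simps)
  qed
  have "cos a' = cos a * cos u - sin a * sin u" "cos b' = cos b * cos v - sin b * sin v"
    unfolding u_def v_def cos_add[symmetric] by simp_all
  then have "\<alpha> * sin a * sin u + \<beta> * sin b * sin v
      = \<alpha> * (cos a * (cos u - 1)) + \<beta> * (cos b * (cos v - 1)) + (1 - cos t)"
    using stewart one by algebra
  also have "\<dots> \<le> \<alpha> * (1 - cos t) + \<beta> * (1 - cos t) + (1 - cos t)"
    using nonneg t by (intro add_mono mult_left_mono second_order) (auto simp: u_def v_def)
  finally have "sin (a + b) * (\<alpha> * sin a * sin u + \<beta> * sin b * sin v) \<le> sin (a + b) * ((\<alpha> + \<beta> + 1) * (1 - cos t))"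
    using s(3) by (intro mult_left_mono) (simp_all add: algebra_simps)
  also have "\<dots> = (\<alpha> * sin (a + b) + \<beta> * sin (a + b) + sin (a + b)) * (1 - cos t)"
    by (simp add: algebra_simps)
  also have "\<dots> = (sin a + sin b + sin (a + b)) * (1 - cos t)" unfolding \<alpha> \<beta> by simp
  also have "\<dots> \<le> (2 * (sin a + sin b)) * (1 - cos t)"
  proof (rule mult_right_mono)
    have "sin (a + b) \<le> sin a * 1 + 1 * sin b"
      unfolding sin_add using s by (intro add_mono mult_left_mono mult_right_mono) auto
    then show "sin a + sin b + sin (a + b) \<le> 2 * (sin a + sin b)" by simp
  qed simp
  also have "\<dots> \<le> (2 * (sin a + sin b)) * (t\<^sup>2 / 2)"
    using s one_minus_cos_le by (intro mult_left_mono) auto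
  also have "\<dots> = t\<^sup>2 * (sin a + sin b)" by simp
  also have "sin (a + b) * (\<alpha> * sin a * sin u + \<beta> * sin b * sin v)
      = \<alpha> * sin (a + b) * sin a * sin u + \<beta> * sin (a + b) * sin b * sin v"
    by (simp add: algebra_simps)
  also have "\<dots> = sin a * sin b * (sin u + sin v)" unfolding \<alpha> \<beta> by (simp add: algebra_simps)
  finally show ?thesis unfolding u_def v_def .
qed

lemma spherical_excess:
  fixes a b a' b' t \<alpha> \<beta> b0 :: real
  assumes stewart: "cos t = \<alpha> * cos a' + \<beta> * cos b'" and one: "1 = \<alpha> * cos a + \<beta> * cos b"
    and \<alpha>: "\<alpha> * sin (a + b) = sin b" and \<beta>: "\<beta> * sin (a + b) = sin a" and nonneg: "0 \<le> \<alpha>" "0 \<le> \<beta>"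
    and ab: "0 < b0" "b0 \<le> a" "b0 \<le> b" "a + b \<le> pi" and t: "t \<le> 1" "\<bar>a' - a\<bar> \<le> t" "\<bar>b' - b\<bar> \<le> t"
  shows "a' + b' \<le> a + b + 16 * t\<^sup>2 / b0"
proof -
  let ?X = "sin (a' - a) + sin (b' - b)"
  have s: "b0 / 2 \<le> sin a" "b0 / 2 \<le> sin b" by (rule sin_ge_half_of_between; use ab in linarith)+
  have "sin a * sin b * ?X \<le> t\<^sup>2 * (sin a + sin b)"
    by (rule spherical_stewart[OF stewart one \<alpha> \<beta> nonneg]) (use ab t pi_gt3 in auto)
  then have "?X \<le> t\<^sup>2 * (sin a + sin b) / (sin a * sin b)"
    using s ab(1) by (subst pos_le_divide_eq) (auto simp: mult.commute)
  also have "\<dots> = t\<^sup>2 * (1 / sin b + 1 / sin a)" using s ab(1) by (simp add: field_simps)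
  also have "\<dots> \<le> t\<^sup>2 * (2 / b0 + 2 / b0)"
    using s ab(1) by (intro mult_left_mono add_mono) (auto simp: field_simps)
  finally have "4 * ?X \<le> 4 * (t\<^sup>2 * (2 / b0 + 2 / b0))" by (rule mult_left_mono) simp
  also have "\<dots> = 16 * t\<^sup>2 / b0" by simp
  finally have X: "4 * ?X \<le> 16 * t\<^sup>2 / b0" .
  show ?thesis
  proof (cases "a' + b' \<le> a + b")
    case True
    moreover have "0 \<le> 16 * t\<^sup>2 / b0" using ab(1) by simp
    ultimately show ?thesis by linarith
  next
    case False
    then show ?thesis using add_le_four_sin_add_sin[of "a' - a" "b' - b"] X t by linarith
  qed
qed

section \<open>The sphere\<close>

definition ip :: "nat \<Rightarrow> (nat \<Rightarrow> real) \<Rightarrow> (nat \<Rightarrow> real) \<Rightarrow> real" where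
  "ip N x y = (\<Sum>i<N. x i * y i)"

lemma ip_commute: "ip N x y = ip N y x"
  unfolding ip_def by (simp add: mult.commute)

lemma ip_comb_left: "ip N (\<lambda>i. a * x i + b * y i) z = a * ip N x z + b * ip N y z"
  unfolding ip_def by (simp add: sum_distrib_left sum.distrib algebra_simps)

lemma ip_comb_right: "ip N z (\<lambda>i. a * x i + b * y i) = a * ip N z x + b * ip N z y"
  using ip_comb_left ip_commute by metis

lemma ip_self: "ip N x x = (\<Sum>i<N. (x i)\<^sup>2)"
  unfolding ip_def by (simp add: power2_eq_square)

lemma ip_self_nonneg: "0 \<le> ip N x x"
  unfolding ip_self by (simp add: sum_nonneg)

lemma ip_self_diff: "(\<Sum>i<N. (x i - y i)\<^sup>2) = ip N x x + ip N y y - 2 * ip N x y"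
  unfolding ip_def power2_diff by (simp add: sum.distrib sum_subtractf sum_distrib_left power2_eq_square mult.assoc)

lemma ip_cauchy_schwarz: "\<bar>ip N x y\<bar> \<le> sqrt (ip N x x) * sqrt (ip N y y)"
proof -
  have "\<bar>ip N x y\<bar> \<le> (\<Sum>i<N. \<bar>x i\<bar> * \<bar>y i\<bar>)" unfolding ip_def abs_mult[symmetric] by (rule sum_abs)
  also have "\<dots> \<le> L2_set x {..<N} * L2_set y {..<N}" by (rule L2_set_mult_ineq)
  finally show ?thesis unfolding ip_self L2_set_def .
qed

lemma ivt_unit_interval:
  fixes f :: "real \<Rightarrow> real"
  assumes cont: "continuous_on {0..1} f" and c: "min (f 0) (f 1) \<le> c" "c \<le> max (f 0) (f 1)"
  obtains \<tau> where "0 \<le> \<tau>" "\<tau> \<le> 1" "f \<tau> = c"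
proof (cases "f 0 \<le> f 1")
  case True
  then show thesis using IVT'[of f 0 c 1] cont c that by auto
next
  case False
  then show thesis using IVT2'[of f 1 c 0] cont c that by auto
qed

lemma segment_between:
  fixes a b u :: real
  assumes "0 \<le> u" "u \<le> 1"
  shows "min a b \<le> a + u * (b - a)" "a + u * (b - a) \<le> max a b"
proof -
  have "min a b = (1 - u) * min a b + u * min a b" by (simp add: left_diff_distrib)
  also have "\<dots> \<le> (1 - u) * a + u * b" using assms by (intro add_mono mult_left_mono) auto
  finally show "min a b \<le> a + u * (b - a)" by (simp add: algebra_simps)
  have "(1 - u) * a + u * b \<le> (1 - u) * max a b + u * max a b"
    using assms by (intro add_mono mult_left_mono) auto
  also have "\<dots> = max a b" by (simp add: left_diff_distrib)
  finally show "a + u * (b - a) \<le> max a b" by (simp add: algebra_simps)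
qed

lemma middle_third_far:
  fixes a b u w y :: real
  assumes y: "y = a + u * (b - a)" and u: "1 / 3 \<le> u" "u \<le> 2 / 3" and w: "w / 6 < \<bar>a - b\<bar>"
  shows "w / 18 \<le> \<bar>a - y\<bar>" "w / 18 \<le> \<bar>y - b\<bar>"
proof -
  have "a - y = u * (a - b)" "y - b = (1 - u) * (a - b)" unfolding y by algebra+
  then have "\<bar>a - y\<bar> = u * \<bar>a - b\<bar>" "\<bar>y - b\<bar> = (1 - u) * \<bar>a - b\<bar>"
    using u by (simp_all add: abs_mult)
  moreover have "1 / 3 * \<bar>a - b\<bar> \<le> u * \<bar>a - b\<bar>" "1 / 3 * \<bar>a - b\<bar> \<le> (1 - u) * \<bar>a - b\<bar>"
    using u by (intro mult_right_mono; simp)+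
  ultimately show "w / 18 \<le> \<bar>a - y\<bar>" "w / 18 \<le> \<bar>y - b\<bar>" using w by simp_all
qed

definition dominant :: "nat \<Rightarrow> nat \<Rightarrow> (nat \<Rightarrow> real) \<Rightarrow> nat \<Rightarrow> bool" where
  "dominant N i y j \<longleftrightarrow> j \<in> {..<N} - {i} \<and> (\<forall>l\<in>{..<N} - {i}. \<bar>y l\<bar> \<le> \<bar>y j\<bar>)"

lemma dominantD: "dominant N i y j \<Longrightarrow> l < N \<Longrightarrow> l \<noteq> i \<Longrightarrow> \<bar>y l\<bar> \<le> \<bar>y j\<bar>"
  unfolding dominant_def by simp

lemma ex_dominant:
  assumes "2 \<le> N"
  shows "\<exists>j. dominant N i y j"
proof -
  let ?A = "(\<lambda>l. \<bar>y l\<bar>) ` ({..<N} - {i})"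
  have "(if i = 0 then 1 else 0) \<in> {..<N} - {i}" using assms by auto
  then have "Max ?A \<in> ?A" by (intro Max_in) auto
  then obtain j where "j \<in> {..<N} - {i}" "\<bar>y j\<bar> = Max ?A" by force
  then have "dominant N i y j" unfolding dominant_def using Max_ge[of ?A] by auto
  then show ?thesis ..
qed

definition dominant_wall_net ::
  "nat \<Rightarrow> (nat \<Rightarrow> real) \<Rightarrow> real \<Rightarrow> real \<Rightarrow> (nat \<Rightarrow> real) set \<Rightarrow> (nat \<Rightarrow> real) set \<Rightarrow> bool" where
  "dominant_wall_net N c w \<theta> Q S \<longleftrightarrow> S \<subseteq> Q \<and> finite S \<and>
     (\<forall>y\<in>Q. \<forall>i<N. \<forall>k\<le>24. \<forall>j. y i = c i + real k * w / 24 \<longrightarrow> dominant N i y j \<longrightarrow>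
       (\<exists>s\<in>S. s i = y i \<and> dominant N i s j \<and> (0 \<le> y j \<longleftrightarrow> 0 \<le> s j) \<and>
         (\<forall>l\<in>{..<N} - {i, j}. \<bar>y l - s l\<bar> \<le> \<theta>)))"

lemma ex_dominant_wall_net:
  assumes \<theta>: "0 < \<theta>" and \<rho>: "0 \<le> \<rho>" and bound: "\<And>y j. y \<in> Q \<Longrightarrow> j < N \<Longrightarrow> \<bar>y j - c j\<bar> \<le> \<rho>"
  shows "\<exists>S. dominant_wall_net N c w \<theta> Q S \<and> real (card S) \<le> 50 * real N ^ 2 * (2 * \<rho> / \<theta> + 2) ^ (N - 2)"
proof -
  define T where "T = {(i, k, j, b :: bool). i < N \<and> k \<le> (24 :: nat) \<and> j < N \<and> j \<noteq> i}"
  define Y where "Y = (\<lambda>(i, k, j, b). {y\<in>Q. y i = c i + real k * w / 24 \<and> dominant N i y j \<and> (0 \<le> y j \<longleftrightarrow> b)})"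
  define J where "J = (\<lambda>(i, k :: nat, j, b :: bool). {..<N} - {i, j})"
  have T: "T \<subseteq> {..<N} \<times> {..24} \<times> {..<N} \<times> UNIV" unfolding T_def by auto
  have finT: "finite T" by (rule finite_subset[OF T]) auto
  have "card T \<le> card ({..<N} \<times> {..24::nat} \<times> {..<N} \<times> (UNIV :: bool set))"
    by (rule card_mono[OF _ T]) auto
  also have "\<dots> = 50 * N ^ 2" by (simp add: power2_eq_square)
  finally have cardT: "real (card T) \<le> 50 * real N ^ 2"
    using of_nat_mono[of "card T" "50 * N ^ 2", where 'a = real] by simp
  have "\<exists>S\<subseteq>(\<Union>x\<in>T. Y x). finite S \<and> real (card S) \<le> (2 * \<rho> / \<theta> + 2) ^ (N - 2) * real (card T) \<and>
    (\<forall>x\<in>T. \<forall>y\<in>Y x. \<exists>s\<in>S \<inter> Y x. \<forall>j\<in>J x. \<bar>y j - s j\<bar> \<le> \<theta>)"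
  proof (rule ex_grid_net_family[OF finT _ \<theta> \<rho>])
    show "finite (J x) \<and> card (J x) = N - 2" if "x \<in> T" for x
      using that unfolding T_def J_def by (cases x) (simp add: card_Diff_subset)
    show "\<bar>y j - c j\<bar> \<le> \<rho>" if "x \<in> T" "y \<in> Y x" "j \<in> J x" for x y j
      using that bound unfolding T_def Y_def J_def by (cases x) auto
  qed
  then obtain S where S: "S \<subseteq> (\<Union>x\<in>T. Y x)" "finite S"
      "real (card S) \<le> (2 * \<rho> / \<theta> + 2) ^ (N - 2) * real (card T)"
    and net: "\<And>x y. x \<in> T \<Longrightarrow> y \<in> Y x \<Longrightarrow> \<exists>s\<in>S \<inter> Y x. \<forall>j\<in>J x. \<bar>y j - s j\<bar> \<le> \<theta>"
    by blast
  have "\<exists>s\<in>S. s i = y i \<and> dominant N i s j \<and> (0 \<le> y j \<longleftrightarrow> 0 \<le> s j) \<and> (\<forall>l\<in>{..<N} - {i, j}. \<bar>y l - s l\<bar> \<le> \<theta>)"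
    if "y \<in> Q" "i < N" "k \<le> 24" "y i = c i + real k * w / 24" "dominant N i y j" for y i k j
    using net[of "(i, k, j, 0 \<le> y j)" y] that unfolding T_def Y_def J_def dominant_def by auto
  moreover have "S \<subseteq> Q" using S(1) unfolding Y_def by auto
  ultimately have "dominant_wall_net N c w \<theta> Q S"
    unfolding dominant_wall_net_def using S(2) by blast
  moreover have "(2 * \<rho> / \<theta> + 2) ^ (N - 2) * real (card T) \<le> (2 * \<rho> / \<theta> + 2) ^ (N - 2) * (50 * real N ^ 2)"
    using cardT \<theta> \<rho> by (intro mult_left_mono) auto
  then have "real (card S) \<le> 50 * real N ^ 2 * (2 * \<rho> / \<theta> + 2) ^ (N - 2)"
    using S(3) by (simp only: mult.commute)
  ultimately show ?thesis by blast
qed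

context
  fixes d :: nat
begin

private abbreviation (input) "N \<equiv> Suc d"
private abbreviation (input) "SPH \<equiv> model_carrier Sph d"
private abbreviation (input) "sdist \<equiv> model_dist Sph d"

lemma sph_dist: "sdist x y = arccos (ip N x y)"
  by (simp add: ip_def)

lemma sph_carrier: "x \<in> SPH \<longleftrightarrow> (\<forall>i\<ge>N. x i = 0) \<and> ip N x x = 1"
  by (simp add: ip_self)

declare model_dist.simps(2)[simp del] model_carrier.simps(2)[simp del]

lemma ip_sph_self: "x \<in> SPH \<Longrightarrow> ip N x x = 1"
  by (simp add: sph_carrier)

lemma abs_ip_sph_le: "x \<in> SPH \<Longrightarrow> y \<in> SPH \<Longrightarrow> \<bar>ip N x y\<bar> \<le> 1"
  using ip_cauchy_schwarz[of N x y] by (simp add: ip_sph_self)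

lemma cos_sph_dist: "x \<in> SPH \<Longrightarrow> y \<in> SPH \<Longrightarrow> cos (sdist x y) = ip N x y"
  unfolding sph_dist using abs_ip_sph_le[of x y] by simp

lemma sph_dist_nonneg: "x \<in> SPH \<Longrightarrow> y \<in> SPH \<Longrightarrow> 0 \<le> sdist x y"
  and sph_dist_le_pi: "x \<in> SPH \<Longrightarrow> y \<in> SPH \<Longrightarrow> sdist x y \<le> pi"
  unfolding sph_dist using abs_ip_sph_le[of x y] by (auto intro: arccos_lbound arccos_ubound)

lemma sph_dist_sym: "sdist x y = sdist y x"
  unfolding sph_dist by (simp add: ip_commute)

lemma sin_sph_dist: "x \<in> SPH \<Longrightarrow> y \<in> SPH \<Longrightarrow> sin (sdist x y) = sqrt (1 - (ip N x y)\<^sup>2)"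
  unfolding sph_dist using abs_ip_sph_le[of x y] by (simp add: sin_arccos_abs)

lemma sph_dist_triangle:
  assumes "x \<in> SPH" "y \<in> SPH" "z \<in> SPH"
  shows "sdist x z \<le> sdist x y + sdist y z"
proof (cases "pi \<le> sdist x y + sdist y z")
  case True
  then show ?thesis using sph_dist_le_pi[of x z] assms by simp
next
  case False
  let ?a = "ip N x y" and ?b = "ip N y z"
  define u v where "u = (\<lambda>i. 1 * x i + (- ?a) * y i)" and "v = (\<lambda>i. 1 * z i + (- ?b) * y i)"
  have gram: "ip N u u = 1 - ?a\<^sup>2" "ip N v v = 1 - ?b\<^sup>2" "ip N u v = ip N x z - ?a * ?b"
    unfolding u_def v_def ip_comb_left ip_comb_right using assms
    by (simp_all add: ip_sph_self ip_commute[of N y x] ip_commute[of N z y] power2_eq_square)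
  have "cos (sdist x y + sdist y z) = ?a * ?b - sqrt (1 - ?a\<^sup>2) * sqrt (1 - ?b\<^sup>2)"
    unfolding cos_add using assms by (simp add: cos_sph_dist sin_sph_dist)
  also have "\<dots> \<le> ip N x z" using ip_cauchy_schwarz[of N u v] unfolding gram by linarith
  also have "\<dots> = cos (sdist x z)" using assms by (simp add: cos_sph_dist)
  finally show ?thesis
    using cos_mono_le_eq[of "sdist x y + sdist y z" "sdist x z"] False assms
      sph_dist_nonneg[of x y] sph_dist_nonneg[of y z] sph_dist_nonneg[of x z] sph_dist_le_pi[of x z]
    by simp
qed

lemma L2_diff_sph:
  assumes "x \<in> SPH" "y \<in> SPH"
  shows "L2_set (\<lambda>i. x i - y i) {..<N} = 2 * sin (sdist x y / 2)"
proof -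
  have "(\<Sum>i<N. (x i - y i)\<^sup>2) = 2 - 2 * cos (2 * (sdist x y / 2))"
    unfolding ip_self_diff using assms by (simp add: cos_sph_dist ip_sph_self)
  also have "\<dots> = (2 * sin (sdist x y / 2))\<^sup>2"
    unfolding cos_double_sin by (simp add: power2_eq_square)
  finally have "L2_set (\<lambda>i. x i - y i) {..<N} = \<bar>2 * sin (sdist x y / 2)\<bar>"
    unfolding L2_set_def by (simp only: real_sqrt_abs)
  moreover have "0 \<le> sin (sdist x y / 2)"
    using sph_dist_nonneg sph_dist_le_pi assms by (intro sin_ge_zero) force+
  ultimately show ?thesis by simp
qed

lemma abs_coordinate_le_sph_dist:
  assumes "x \<in> SPH" "y \<in> SPH" "i < N"
  shows "\<bar>x i - y i\<bar> \<le> sdist x y"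
proof -
  have "\<bar>x i - y i\<bar> \<le> 2 * sin (sdist x y / 2)"
    using abs_coordinate_le_L2[OF assms(3)] unfolding L2_diff_sph[OF assms(1,2), symmetric] .
  also have "\<dots> \<le> sdist x y" using sph_dist_nonneg assms sin_x_le_x[of "sdist x y / 2"] by simp
  finally show ?thesis .
qed

lemma sph_dist_le_coordinate_bound:
  assumes "x \<in> SPH" "y \<in> SPH" "\<And>i. i < N \<Longrightarrow> \<bar>x i - y i\<bar> \<le> \<rho>"
  shows "sdist x y \<le> 2 * real N * \<rho>"
proof -
  have "sdist x y / 2 / 2 \<le> sin (sdist x y / 2)"
    using sph_dist_nonneg sph_dist_le_pi assms by (intro sin_ge_half) auto
  also have "2 * \<dots> \<le> real N * \<rho>"
    unfolding L2_diff_sph[OF assms(1,2), symmetric] by (rule L2_le_coordinate_bound[OF assms(3)])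
  finally show ?thesis by (simp del: of_nat_Suc)
qed

lemma metric_on_Sph: "metric_on SPH sdist"
proof
  fix x y assume "x \<in> SPH" "y \<in> SPH" "x \<noteq> y"
  moreover from this obtain i where "x i \<noteq> y i" by blast
  moreover from calculation have "i < N" unfolding sph_carrier by (cases "i < N") auto
  ultimately show "0 < sdist x y" using abs_coordinate_le_sph_dist[of x y i] by simp
qed (use sph_dist_nonneg sph_dist_sym sph_dist_triangle in blast)+

lemma sph_between:
  assumes p: "p \<in> SPH" and q: "q \<in> SPH"
    and y: "y \<in> SPH" "y = (\<lambda>i. \<alpha> * p i + \<beta> * q i)" "0 \<le> \<alpha>" "0 \<le> \<beta>"
    and D: "0 < sdist p q"
  shows "\<alpha> * sin (sdist p q) = sin (sdist y q)" "\<beta> * sin (sdist p q) = sin (sdist p y)"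
    and "sdist p y + sdist y q = sdist p q"
proof -
  let ?c = "ip N p q"
  have norm: "\<alpha>\<^sup>2 + \<beta>\<^sup>2 + 2 * \<alpha> * \<beta> * ?c = 1"
    using ip_sph_self[OF y(1)] ip_sph_self[OF p] ip_sph_self[OF q]
    unfolding y(2) ip_comb_left ip_comb_right ip_commute[of N q p] by algebra
  have cos: "cos (sdist p q) = ?c" "cos (sdist p y) = \<alpha> + \<beta> * ?c" "cos (sdist y q) = \<alpha> * ?c + \<beta>"
    using p q y(1) by (simp_all add: cos_sph_dist) (simp_all add: y(2) ip_comb_left ip_comb_right ip_sph_self)
  have nonneg: "0 \<le> sin (sdist p q)" "0 \<le> sin (sdist p y)" "0 \<le> sin (sdist y q)"
    using sph_dist_nonneg sph_dist_le_pi p q y(1) by (auto intro!: sin_ge_zero)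
  have "(\<alpha> * sin (sdist p q))\<^sup>2 = (sin (sdist y q))\<^sup>2"
    unfolding power_mult_distrib sin_squared_eq cos using norm by algebra
  then show \<alpha>: "\<alpha> * sin (sdist p q) = sin (sdist y q)" using nonneg y(3) by simp
  have "(\<beta> * sin (sdist p q))\<^sup>2 = (sin (sdist p y))\<^sup>2"
    unfolding power_mult_distrib sin_squared_eq cos using norm by algebra
  then show \<beta>: "\<beta> * sin (sdist p q) = sin (sdist p y)" using nonneg y(4) by simp
  let ?s = "sdist p y + sdist y q"
  have "sin ?s = sin (sdist p q)" unfolding sin_add cos \<alpha>[symmetric] \<beta>[symmetric]
    using norm by algebra
  moreover have "cos ?s = cos (sdist p q)"
    unfolding cos_add cos \<alpha>[symmetric] \<beta>[symmetric]
    using norm sin_squared_eq[of "sdist p q"] unfolding cos by algebra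
  ultimately obtain n :: int where n: "?s = sdist p q + 2 * pi * n" using sin_cos_eq_iff by blast
  have "2 * pi * n < 2 * pi" "- pi \<le> 2 * pi * n"
    using n D sph_dist_le_pi sph_dist_nonneg p q y(1) by (smt (verit))+
  then have "(2 * pi) * real_of_int n < (2 * pi) * 1" "pi * (- 1) \<le> pi * (2 * real_of_int n)"
    by simp_all
  then have "real_of_int n < 1" "- 1 \<le> 2 * real_of_int n"
    using pi_gt_zero by (simp_all only: mult_less_cancel_left_pos mult_le_cancel_left_pos)
  then have "n = 0" by linarith
  then show "?s = sdist p q" using n by simp
qed

lemma interpolated_norm_pos:
  fixes c \<tau> :: real
  assumes "- 1 < c" "0 \<le> \<tau>" "\<tau> \<le> 1"
  shows "0 < (1 - \<tau>)\<^sup>2 + \<tau>\<^sup>2 + 2 * \<tau> * (1 - \<tau>) * c"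
proof (cases "\<tau> * (1 - \<tau>) = 0")
  case True
  then show ?thesis by auto
next
  case False
  then have "0 < \<tau> * (1 - \<tau>)" using assms by (simp add: less_le)
  then have "0 < 2 * (\<tau> * (1 - \<tau>)) * (1 + c)" using assms by simp
  also have "\<dots> \<le> (1 - 2 * \<tau>)\<^sup>2 + 2 * (\<tau> * (1 - \<tau>)) * (1 + c)" by simp
  also have "\<dots> = (1 - \<tau>)\<^sup>2 + \<tau>\<^sup>2 + 2 * \<tau> * (1 - \<tau>) * c" by algebra
  finally show ?thesis .
qed

lemma sph_geodesic_crossing:
  assumes p: "p \<in> SPH" and q: "q \<in> SPH" and not_antipodal: "- 1 < ip N p q"
    and c: "min (p i) (q i) \<le> c" "c \<le> max (p i) (q i)"
  obtains y \<alpha> \<beta> where "y \<in> SPH" "y = (\<lambda>j. \<alpha> * p j + \<beta> * q j)" "0 \<le> \<alpha>" "0 \<le> \<beta>" "y i = c"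
proof -
  define m where "m \<tau> = (1 - \<tau>)\<^sup>2 + \<tau>\<^sup>2 + 2 * \<tau> * (1 - \<tau>) * ip N p q" for \<tau> :: real
  define f where "f \<tau> = ((1 - \<tau>) * p i + \<tau> * q i) / sqrt (m \<tau>)" for \<tau>
  have m_pos: "0 < m \<tau>" if "0 \<le> \<tau>" "\<tau> \<le> 1" for \<tau>
    unfolding m_def using interpolated_norm_pos[OF not_antipodal that] .
  have "continuous_on {0..1} f"
    unfolding f_def m_def using m_pos unfolding m_def by (intro continuous_intros) force
  moreover have "f 0 = p i" "f 1 = q i" unfolding f_def m_def by simp_all
  ultimately obtain \<tau> where \<tau>: "0 \<le> \<tau>" "\<tau> \<le> 1" "f \<tau> = c" using c ivt_unit_interval[of f c] by metis
  define \<alpha> \<beta> where "\<alpha> = (1 - \<tau>) / sqrt (m \<tau>)" and "\<beta> = \<tau> / sqrt (m \<tau>)"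
  define y where "y = (\<lambda>j. \<alpha> * p j + \<beta> * q j)"
  have "ip N y y = \<alpha>\<^sup>2 + \<beta>\<^sup>2 + 2 * \<beta> * \<alpha> * ip N p q"
    unfolding y_def ip_comb_left ip_comb_right ip_sph_self[OF p] ip_sph_self[OF q] ip_commute[of N q p] by algebra
  also have "\<dots> = ((1 - \<tau>)\<^sup>2 + \<tau>\<^sup>2 + 2 * \<tau> * (1 - \<tau>) * ip N p q) / (sqrt (m \<tau>))\<^sup>2"
    unfolding \<alpha>_def \<beta>_def by (simp add: power_divide add_divide_distrib power2_eq_square)
  also have "\<dots> = 1" using m_pos[OF \<tau>(1,2)] by (simp flip: m_def)
  finally have "y \<in> SPH" using p q by (simp add: sph_carrier y_def)
  moreover have "0 \<le> \<alpha>" "0 \<le> \<beta>" unfolding \<alpha>_def \<beta>_def using \<tau> m_pos[OF \<tau>(1,2)] by auto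
  moreover have "y i = c" using \<tau>(3)
    unfolding y_def \<alpha>_def \<beta>_def f_def by (simp add: add_divide_distrib)
  ultimately show thesis using that y_def by blast
qed

lemma sph_dist_antipodal:
  assumes "p \<in> SPH" "q \<in> SPH" "ip N p q = - 1" "s \<in> SPH"
  shows "sdist p s + sdist s q = sdist p q"
proof -
  let ?v = "\<lambda>i. 1 * p i + 1 * q i"
  have "ip N ?v ?v = 0"
    unfolding ip_comb_left ip_comb_right using assms ip_commute[of N q p] by (simp add: ip_sph_self)
  then have "ip N s ?v = 0" using ip_cauchy_schwarz[of N s ?v] by simp
  then have "ip N s q = - ip N p s" unfolding ip_comb_right using ip_commute[of N s p] by simp
  then show ?thesis unfolding sph_dist assms(3)
    using abs_ip_sph_le[OF assms(1,4)] by (simp add: arccos_minus)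
qed

lemma ex_sph_coordinate:
  assumes "1 \<le> d" "i < N" "\<bar>c\<bar> \<le> 1"
  obtains y where "y \<in> SPH" "y i = c"
proof -
  define j where "j = (if i = 0 then 1 else 0 :: nat)"
  have j: "j < N" "j \<noteq> i" unfolding j_def using assms(1) by auto
  have c: "c\<^sup>2 \<le> 1" using assms(3) by (simp add: abs_square_le_1)
  define y where "y = (\<lambda>l. if l = i then c else if l = j then sqrt (1 - c\<^sup>2) else 0)"
  have "ip N y y = (\<Sum>l\<in>{i, j}. (y l)\<^sup>2)"
    unfolding ip_self by (rule sum.mono_neutral_right) (use assms(2) j in \<open>auto simp: y_def\<close>)
  also have "\<dots> = 1" using j c by (simp add: y_def)
  finally have "y \<in> SPH" unfolding sph_carrier using assms(2) j by (auto simp: y_def)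
  then show thesis by (rule that) (simp add: y_def)
qed

lemma abs_sph_coordinate_le: "x \<in> SPH \<Longrightarrow> i < N \<Longrightarrow> \<bar>x i\<bar> \<le> 1"
  using abs_coordinate_le_L2[of i N x] by (simp add: L2_set_def ip_sph_self flip: ip_self)

lemma sph_detour_le:
  assumes p: "p \<in> SPH" and q: "q \<in> SPH"
    and y: "y \<in> SPH" "y = (\<lambda>j. \<alpha> * p j + \<beta> * q j)" "0 \<le> \<alpha>" "0 \<le> \<beta>"
    and far: "0 < b" "b \<le> sdist p y" "b \<le> sdist y q" and D: "0 < sdist p q"
    and s: "s \<in> SPH" "sdist y s \<le> 1"
  shows "sdist p s + sdist s q \<le> sdist p q + 16 * (sdist y s)\<^sup>2 / b"
proof -
  note between = sph_between[OF p q y D]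
  have stewart: "ip N y z = \<alpha> * ip N p z + \<beta> * ip N z q" for z
    unfolding y(2) ip_comb_left ip_commute[of N z q] ..
  have "sdist p s + sdist s q \<le> sdist p y + sdist y q + 16 * (sdist y s)\<^sup>2 / b"
  proof (rule spherical_excess[where \<alpha> = \<alpha> and \<beta> = \<beta>])
    show "cos (sdist y s) = \<alpha> * cos (sdist p s) + \<beta> * cos (sdist s q)"
      using p q y(1) s(1) by (simp only: cos_sph_dist stewart)
    show "1 = \<alpha> * cos (sdist p y) + \<beta> * cos (sdist y q)"
      using p q y(1) stewart[of y] by (simp add: cos_sph_dist ip_sph_self)
    show "\<bar>sdist p s - sdist p y\<bar> \<le> sdist y s"
      using sph_dist_triangle[OF p y(1) s(1)] sph_dist_triangle[OF p s(1) y(1)] sph_dist_sym[of s y]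
      by linarith
    show "\<bar>sdist s q - sdist y q\<bar> \<le> sdist y s"
      using sph_dist_triangle[OF y(1) s(1) q] sph_dist_triangle[OF s(1) y(1) q] sph_dist_sym[of s y]
      by linarith
  qed (use between y far s sph_dist_le_pi[OF p q] in auto)
  then show ?thesis unfolding between(3) .
qed

lemma ex_sph_wall_point:
  assumes d: "1 \<le> d" and p: "p \<in> SPH" and q: "q \<in> SPH" and i: "i < N" and u: "1 / 3 \<le> u" "u \<le> 2 / 3"
    and w: "0 < w" "w / 6 < \<bar>p i - q i\<bar>"
  obtains y where "y \<in> SPH" "y i = p i + u * (q i - p i)" "sdist p y \<le> sdist p q"
    "\<And>s. s \<in> SPH \<Longrightarrow> sdist y s \<le> 1 \<Longrightarrow> sdist p s + sdist s q \<le> sdist p q + 288 * (sdist y s)\<^sup>2 / w"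
proof -
  let ?c = "p i + u * (q i - p i)"
  have D: "w / 6 < sdist p q" using abs_coordinate_le_sph_dist[OF p q i] w by linarith
  have c: "min (p i) (q i) \<le> ?c" "?c \<le> max (p i) (q i)" using u by (auto intro!: segment_between)
  show thesis
  proof (cases "ip N p q = - 1")
    case True
    have "\<bar>?c\<bar> \<le> 1" using c abs_sph_coordinate_le[OF p i] abs_sph_coordinate_le[OF q i] by linarith
    then obtain y where y: "y \<in> SPH" "y i = ?c" by (rule ex_sph_coordinate[OF d i])
    note on_geodesic = sph_dist_antipodal[OF p q True]
    show thesis
      by (rule that[OF y]) (use on_geodesic y sph_dist_nonneg[OF y(1) q] w in force)+
  next
    case False
    then have "- 1 < ip N p q" using abs_ip_sph_le[OF p q] by linarith
    then obtain y \<alpha> \<beta> where y: "y \<in> SPH" "y = (\<lambda>j. \<alpha> * p j + \<beta> * q j)" "0 \<le> \<alpha>" "0 \<le> \<beta>" "y i = ?c"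
      using sph_geodesic_crossing[OF p q _ c] by metis
    have far: "w / 18 \<le> sdist p y" "w / 18 \<le> sdist y q"
      using middle_third_far[OF y(5) u w(2)] abs_coordinate_le_sph_dist[OF p y(1) i]
        abs_coordinate_le_sph_dist[OF y(1) q i] by (blast intro: order_trans)+
    have "sdist p s + sdist s q \<le> sdist p q + 288 * (sdist y s)\<^sup>2 / w"
      if "s \<in> SPH" "sdist y s \<le> 1" for s
      using sph_detour_le[OF p q y(1-4) _ far _ that] D w by simp
    moreover have "sdist p y \<le> sdist p q"
      using sph_between(3)[OF p q y(1-4)] sph_dist_nonneg[OF y(1) q] D w by simp
    ultimately show thesis using that[OF y(1,5)] by blast
  qed
qed

text \<open>On the wall \<open>y i = c\<close> the coordinate of largest modulus among the others is determined, up to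
  sign and in a Lipschitz way, by the remaining \<open>d - 1\<close> coordinates.\<close>

lemma sph_dominant_close:
  assumes y: "y \<in> SPH" and s: "s \<in> SPH" and i: "i < N" "y i = s i"
    and dominant: "dominant N i y j" "dominant N i s j" and sign: "0 \<le> y j \<longleftrightarrow> 0 \<le> s j" and \<theta>: "0 \<le> \<theta>"
    and close: "\<And>l. l \<in> {..<N} - {i, j} \<Longrightarrow> \<bar>y l - s l\<bar> \<le> \<theta>"
  shows "\<bar>y j - s j\<bar> \<le> real N * \<theta>"
proof (cases "y j + s j = 0")
  case True
  then have "y j = 0" "s j = 0" using sign by linarith+
  then show ?thesis using \<theta> by simp
next
  case False
  let ?J = "{..<N} - {i, j}"
  have j: "j < N" "j \<noteq> i" using dominant(1) unfolding dominant_def by auto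
  have split: "1 = (x i)\<^sup>2 + ((x j)\<^sup>2 + (\<Sum>l\<in>?J. (x l)\<^sup>2))" if "x \<in> SPH" for x
  proof -
    have "{..<N} - {i} - {j} = ?J" by auto
    then show ?thesis using ip_sph_self[OF that] i(1) j unfolding ip_self
      by (simp add: sum.remove[of "{..<N}" i] sum.remove[of "{..<N} - {i}" j] del: sum.lessThan_Suc)
  qed
  have "\<bar>(s l)\<^sup>2 - (y l)\<^sup>2\<bar> \<le> \<theta> * \<bar>y j + s j\<bar>" if l: "l \<in> ?J" for l
  proof -
    have "\<bar>(s l)\<^sup>2 - (y l)\<^sup>2\<bar> = \<bar>y l - s l\<bar> * \<bar>y l + s l\<bar>"
      unfolding abs_mult[symmetric] by (subst abs_minus_cancel[symmetric]) (simp add: power2_eq_square algebra_simps)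
    also have "\<dots> \<le> \<theta> * \<bar>y j + s j\<bar>"
      using close[OF l] dominantD[OF dominant(1), of l] dominantD[OF dominant(2), of l] l sign \<theta>
      by (intro mult_mono) auto
    finally show ?thesis .
  qed
  then have "(\<Sum>l\<in>?J. \<bar>(s l)\<^sup>2 - (y l)\<^sup>2\<bar>) \<le> real (card ?J) * (\<theta> * \<bar>y j + s j\<bar>)"
    by (rule sum_bounded_above)
  also have "\<dots> \<le> real N * (\<theta> * \<bar>y j + s j\<bar>)"
    using card_mono[of "{..<N}" ?J] \<theta> by (intro mult_right_mono) auto
  finally have "\<bar>\<Sum>l\<in>?J. (s l)\<^sup>2 - (y l)\<^sup>2\<bar> \<le> real N * (\<theta> * \<bar>y j + s j\<bar>)"
    by (rule order_trans[OF sum_abs])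
  moreover have "(y j - s j) * (y j + s j) = (\<Sum>l\<in>?J. (s l)\<^sup>2 - (y l)\<^sup>2)"
    using split[OF y] split[OF s] i(2)
    unfolding sum_subtractf by (simp add: power2_eq_square algebra_simps)
  ultimately have "\<bar>y j - s j\<bar> * \<bar>y j + s j\<bar> \<le> real N * \<theta> * \<bar>y j + s j\<bar>"
    unfolding abs_mult[symmetric] by (simp only: mult.assoc)
  then show ?thesis by (rule mult_right_le_imp_le) (use False in simp)
qed

lemma ex_sph_wall_net:
  assumes d: "1 \<le> d" and \<theta>: "0 < \<theta>" and \<rho>: "0 \<le> \<rho>"
    and Q: "Q \<subseteq> SPH" and bound: "\<And>y j. y \<in> Q \<Longrightarrow> j < N \<Longrightarrow> \<bar>y j - c j\<bar> \<le> \<rho>"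
  shows "\<exists>S. wall_net N c w (real N * \<theta>) Q S \<and> real (card S) \<le> 50 * real N ^ 2 * (2 * \<rho> / \<theta> + 2) ^ (d - 1)"
proof -
  have "\<exists>S. dominant_wall_net N c w \<theta> Q S \<and> real (card S) \<le> 50 * real N ^ 2 * (2 * \<rho> / \<theta> + 2) ^ (N - 2)"
    using bound by (rule ex_dominant_wall_net[OF \<theta> \<rho>])
  then obtain S where net: "dominant_wall_net N c w \<theta> Q S"
    and card: "real (card S) \<le> 50 * real N ^ 2 * (2 * \<rho> / \<theta> + 2) ^ (N - 2)"
    by blast
  have S: "S \<subseteq> Q" "finite S" using net unfolding dominant_wall_net_def by simp_all
  have "\<exists>s\<in>S. \<forall>l<N. \<bar>y l - s l\<bar> \<le> real N * \<theta>"
    if y: "y \<in> Q" "i < N" "k \<le> 24" "y i = c i + real k * w / 24" for y i k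
  proof -
    obtain j where j: "dominant N i y j" using ex_dominant[of N i y] d by auto
    obtain s where s: "s \<in> S" "s i = y i" "dominant N i s j" "0 \<le> y j \<longleftrightarrow> 0 \<le> s j"
      "\<And>l. l \<in> {..<N} - {i, j} \<Longrightarrow> \<bar>y l - s l\<bar> \<le> \<theta>"
      using net[unfolded dominant_wall_net_def, THEN conjunct2, THEN conjunct2, rule_format, OF y j]
      by blast
    have sph: "y \<in> SPH" "s \<in> SPH" using S(1) Q s(1) y(1) by auto
    have "\<bar>y j - s j\<bar> \<le> real N * \<theta>"
      by (rule sph_dominant_close[OF sph y(2) _ j s(3,4) _ s(5)]) (use s(2) \<theta> in auto)
    moreover have "\<theta> \<le> real N * \<theta>" "0 \<le> real N * \<theta>" using \<theta> by simp_all
    ultimately have "\<bar>y l - s l\<bar> \<le> real N * \<theta>" if "l < N" for l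
      using s(2) s(5)[of l] that by (cases "l = i"; cases "l = j") (auto simp del: of_nat_Suc)
    then show ?thesis using s(1) by blast
  qed
  then have "wall_net N c w (real N * \<theta>) Q S" unfolding wall_net_def using S by blast
  moreover have "N - 2 = d - 1" by simp
  ultimately show ?thesis using card by auto
qed

lemma sph_dist_cube_pair:
  assumes "p \<in> SPH" "q \<in> SPH" and pair: "cube_pair N c w p q"
  shows "w / 6 < sdist p q" "sdist p q \<le> 2 * real N * w"
proof -
  show "w / 6 < sdist p q"
    using pair abs_coordinate_le_sph_dist[OF assms(1,2)] unfolding cube_pair_def by force
  show "sdist p q \<le> 2 * real N * w"
    using pair abs_diff_cube less_imp_le unfolding cube_pair_def
    by (intro sph_dist_le_coordinate_bound[OF assms(1,2)]) blast
qed

lemma sph_excess_small: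
  assumes X: "p \<in> SPH" "q \<in> SPH" and w: "0 < w" "w / 6 < sdist p q" and \<epsilon>: "0 < \<epsilon>" "\<epsilon> \<le> 1"
    and t: "0 \<le> t" "t \<le> sqrt \<epsilon> * w / 100"
  shows "t \<le> 1" "288 * t\<^sup>2 / w \<le> \<epsilon> / 4 * sdist p q"
proof -
  have "sqrt \<epsilon> * w / 100 \<le> 1 * 24 / 100"
    using w \<epsilon> sph_dist_le_pi[OF X] pi_less_4 by (intro divide_right_mono mult_mono) auto
  then show "t \<le> 1" using t(2) by linarith
  have "288 * t\<^sup>2 / w \<le> 288 * (sqrt \<epsilon> * w / 100)\<^sup>2 / w"
    using t w by (intro divide_right_mono mult_left_mono power_mono) auto
  also have "\<dots> = \<epsilon> * (w / 6) * (1728 / 10000)"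
    using \<epsilon> w by (simp add: power_mult_distrib power_divide power2_eq_square)
  also have "\<dots> \<le> \<epsilon> * sdist p q * (1 / 4)" using w \<epsilon> by (intro mult_mono) auto
  finally show "288 * t\<^sup>2 / w \<le> \<epsilon> / 4 * sdist p q" by simp
qed

lemma ex_sph_detour_net:
  assumes d: "1 \<le> d" and \<epsilon>: "0 < \<epsilon>" "\<epsilon> \<le> 1" and w: "0 < w"
  shows "\<exists>S\<subseteq>SPH. finite S \<and> real (card S) \<le> 50 * real N ^ 2 * (1200 * real N ^ 3 / sqrt \<epsilon> + 2) ^ (d - 1) \<and>
    detour_net N SPH sdist \<epsilon> c w S"
proof -
  define \<theta> where "\<theta> = sqrt \<epsilon> * w / (200 * real N ^ 2)"
  define Q where "Q = {y\<in>SPH. \<forall>l<N. \<bar>y l - c l\<bar> \<le> 3 * real N * w}"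
  have \<theta>: "0 < \<theta>" unfolding \<theta>_def using \<epsilon> w by (intro divide_pos_pos mult_pos_pos) auto
  have "2 * (3 * real N * w) / \<theta> = 1200 * real N ^ 3 / sqrt \<epsilon>"
    unfolding \<theta>_def using w \<epsilon> by (simp add: field_simps power2_eq_square power3_eq_cube del: of_nat_Suc)
  then obtain S where S: "wall_net N c w (real N * \<theta>) Q S"
    "real (card S) \<le> 50 * real N ^ 2 * (1200 * real N ^ 3 / sqrt \<epsilon> + 2) ^ (d - 1)"
    using ex_sph_wall_net[OF d \<theta>, of "3 * real N * w" Q c w] w unfolding Q_def by auto
  have "\<exists>s\<in>S. sdist p s + sdist s q \<le> (1 + \<epsilon> / 4) * sdist p q"
    if X: "p \<in> SPH" "q \<in> SPH" and pair: "cube_pair N c w p q" for p q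
  proof -
    note D = sph_dist_cube_pair[OF X pair]
    obtain i u where i: "i < N" "w / 6 < \<bar>p i - q i\<bar>" and u: "1 / 3 \<le> u" "u \<le> 2 / 3"
      and cross: "\<And>y. y \<in> Q \<Longrightarrow> y i = p i + u * (q i - p i) \<Longrightarrow> \<exists>s\<in>S. \<forall>j<N. \<bar>y j - s j\<bar> \<le> real N * \<theta>"
      using wall_net_crossing[OF S(1) pair w] by metis
    obtain y where y: "y \<in> SPH" "y i = p i + u * (q i - p i)" "sdist p y \<le> sdist p q"
      and excess: "\<And>s. s \<in> SPH \<Longrightarrow> sdist y s \<le> 1 \<Longrightarrow> sdist p s + sdist s q \<le> sdist p q + 288 * (sdist y s)\<^sup>2 / w"
      using ex_sph_wall_point[OF d X i(1) u w i(2)] by metis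
    have "\<bar>y l - c l\<bar> \<le> 3 * real N * w" if l: "l < N" for l
    proof -
      have "\<bar>p l - y l\<bar> \<le> 2 * real N * w"
        using abs_coordinate_le_sph_dist[OF X(1) y(1) l] y(3) D by linarith
      moreover have "\<bar>p l - c l\<bar> \<le> w"
        using abs_diff_cube_corner[OF _ l] pair unfolding cube_pair_def by blast
      moreover have "w \<le> real N * w" using w by simp
      ultimately show ?thesis by linarith
    qed
    then obtain s where s: "s \<in> S" "\<forall>l<N. \<bar>y l - s l\<bar> \<le> real N * \<theta>"
      using cross[of y] y(1,2) unfolding Q_def by auto
    have sX: "s \<in> SPH" using S(1) s(1) unfolding wall_net_def Q_def by blast
    have "sdist y s \<le> 2 * real N * (real N * \<theta>)"
      using s(2) by (intro sph_dist_le_coordinate_bound[OF y(1) sX]) blast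
    also have "\<dots> = sqrt \<epsilon> * w / 100" unfolding \<theta>_def by (simp add: power2_eq_square del: of_nat_Suc)
    finally have t: "sdist y s \<le> sqrt \<epsilon> * w / 100" .
    note small = sph_excess_small[OF X w D(1) \<epsilon> sph_dist_nonneg[OF y(1) sX] t]
    from excess[OF sX small(1)] small(2) have "sdist p s + sdist s q \<le> (1 + \<epsilon> / 4) * sdist p q"
      by (simp add: distrib_right)
    then show ?thesis using s(1) by blast
  qed
  then show ?thesis using S unfolding wall_net_def detour_net_def Q_def by (intro exI[of _ S]) blast
qed

lemma sph_has_spanners:
  assumes d: "1 \<le> d" and \<epsilon>: "0 < \<epsilon>" "\<epsilon> \<le> 1" and M: "192 * real N / \<epsilon> \<le> 2 ^ M"
  shows "has_spanners SPH sdist (1 + \<epsilon>)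
    (2 ^ N * (50 * real N ^ 2 * (1200 * real N ^ 3 / sqrt \<epsilon> + 2) ^ (d - 1) * (3 * real M + 10)))"
proof (rule coordinate_metric_has_spanners[OF metric_on_Sph abs_coordinate_le_sph_dist
      sph_dist_le_coordinate_bound ex_sph_detour_net[OF d \<epsilon>] \<epsilon>])
  have "1 * 1 * 1 \<le> 50 * real N ^ 2 * (1200 * real N ^ 3 / sqrt \<epsilon> + 2) ^ (d - 1)"
    using \<epsilon> by (intro mult_mono one_le_power) auto
  then show "1 \<le> 50 * real N ^ 2 * (1200 * real N ^ 3 / sqrt \<epsilon> + 2) ^ (d - 1)" by simp
  show "96 * (2 * real N) / \<epsilon> \<le> 2 ^ M" using M by simp
qed

end

section \<open>Hyperbolic functions\<close>

lemma cosh_ge_tangent: "cosh a + sinh a * (b - a) \<le> cosh b" for a b :: real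
proof -
  have "exp a * (1 + (b - a)) \<le> exp a * exp (b - a)" "exp (- a) * (1 + (a - b)) \<le> exp (- a) * exp (a - b)"
    using exp_ge_add_one_self[of "b - a"] exp_ge_add_one_self[of "a - b"]
    by (intro mult_left_mono; simp)+
  then have "exp a * (1 + (b - a)) \<le> exp b" "exp (- a) * (1 + (a - b)) \<le> exp (- b)"
    by (simp_all flip: exp_add)
  then have "(exp a * (1 + (b - a)) + exp (- a) * (1 + (a - b))) / 2 \<le> (exp b + exp (- b)) / 2"
    by simp
  moreover have "(exp a * (1 + (b - a)) + exp (- a) * (1 + (a - b))) / 2 = cosh a + sinh a * (b - a)"
    unfolding cosh_def sinh_def by (simp add: field_simps)
  ultimately show ?thesis unfolding cosh_def by simp
qed

lemma sinh_ge_self: "0 \<le> x \<Longrightarrow> x \<le> sinh x" for x :: real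
proof -
  assume x: "0 \<le> x"
  have "sinh 0 - 0 \<le> sinh x - x"
  proof (rule DERIV_nonneg_imp_nondecreasing[OF x])
    fix t :: real
    show "\<exists>y. ((\<lambda>t. sinh t - t) has_real_derivative y) (at t) \<and> 0 \<le> y"
      by (intro exI[of _ "cosh t - 1"] conjI) (auto intro!: derivative_eq_intros cosh_real_ge_1)
  qed
  then show ?thesis by simp
qed

lemma cosh_ge_quadratic: "1 + x\<^sup>2 / 2 \<le> cosh x" for x :: real
proof -
  have "\<bar>x / 2\<bar> \<le> \<bar>sinh (x / 2)\<bar>"
    using sinh_ge_self[of "x / 2"] sinh_ge_self[of "- (x / 2)"] by (cases "0 \<le> x") auto
  then have "(x / 2)\<^sup>2 \<le> (sinh (x / 2))\<^sup>2" by (simp only: abs_le_square_iff)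
  moreover have "cosh x = 1 + 2 * (sinh (x / 2))\<^sup>2"
    using cosh_double[of "x / 2"] cosh_square_eq[of "x / 2"] by simp
  ultimately show ?thesis by (simp add: power_divide)
qed

lemma cosh_le_quadratic:
  fixes a :: real
  assumes "0 \<le> a" "a \<le> 1"
  shows "cosh a \<le> 1 + a\<^sup>2"
proof -
  have "exp (- a) \<le> 1 / (1 + a)"
    using assms exp_ge_add_one_self[of a]
    by (simp add: exp_minus inverse_eq_divide divide_left_mono)
  also have "\<dots> \<le> 1 - a + a\<^sup>2"
  proof -
    have "(1 - a + a\<^sup>2) * (1 + a) = 1 + a ^ 3" by algebra
    then show ?thesis using assms by (subst pos_divide_le_eq) auto
  qed
  finally have "exp (- a) \<le> 1 - a + a\<^sup>2" .
  moreover have "exp a \<le> 1 + a + a\<^sup>2" by (rule exp_bound) (use assms in auto)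
  ultimately show ?thesis unfolding cosh_def by simp
qed

lemma le_of_quadratic_le_cosh:
  fixes a x :: real
  assumes "0 \<le> a" "0 \<le> x" "x \<le> 1" "1 + x\<^sup>2 \<le> cosh a"
  shows "x \<le> a"
proof (rule ccontr)
  assume "\<not> x \<le> a"
  then have "cosh a \<le> 1 + a\<^sup>2" "a\<^sup>2 < x\<^sup>2"
    using assms by (auto intro!: cosh_le_quadratic power_strict_mono)
  then show False using assms(4) by simp
qed

lemma coth_le:
  fixes a x :: real
  assumes "0 < x" "x \<le> 1" "x \<le> a"
  shows "cosh a / sinh a \<le> 2 / x"
proof -
  have a: "0 < a" "0 < sinh a" using assms by auto
  have "cosh a = sinh a + exp (- a)" unfolding cosh_def sinh_def by (simp add: field_simps)
  also have "exp (- a) \<le> 1" using a by simp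
  also have "1 \<le> sinh a / a" using sinh_ge_self[of a] a by simp
  also have "sinh a + sinh a / a \<le> sinh a / x + sinh a / x"
    using a assms divide_left_mono[of x 1 "sinh a"] by (intro add_mono divide_left_mono) auto
  finally show ?thesis using a by (simp add: pos_divide_le_eq)
qed

text \<open>The hyperbolic form of Stewart's theorem is \<open>cosh t = \<alpha> cosh a' + \<beta> cosh b'\<close>; bounding \<open>cosh\<close> below by its
  tangents at \<open>a\<close> and \<open>b\<close> bounds the excess of a detour.\<close>

lemma hyperbolic_excess:
  fixes a b a' b' t \<alpha> \<beta> D x :: real
  assumes stewart: "cosh t = \<alpha> * cosh a' + \<beta> * cosh b'"
    and a: "cosh a = \<alpha> + \<beta> * cosh D" and b: "cosh b = \<alpha> * cosh D + \<beta>"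
    and one: "1 = \<alpha> * cosh a + \<beta> * cosh b"
    and nonneg: "0 \<le> \<alpha>" "0 \<le> \<beta>" "0 \<le> D" and x: "0 < x" "x \<le> 1" "x \<le> a" "x \<le> b"
  shows "a + b = D" "a' + b' \<le> D + (cosh t - 1) * (4 / x)"
proof -
  have norm: "\<alpha>\<^sup>2 + \<beta>\<^sup>2 + 2 * \<alpha> * \<beta> * cosh D = 1" using a b one by algebra
  have "(sinh a)\<^sup>2 = (\<beta> * sinh D)\<^sup>2"
    unfolding power_mult_distrib sinh_square_eq a using norm by algebra
  then have sa: "sinh a = \<beta> * sinh D" using nonneg x by (simp add: power2_eq_iff_nonneg)
  have "(sinh b)\<^sup>2 = (\<alpha> * sinh D)\<^sup>2"
    unfolding power_mult_distrib sinh_square_eq b using norm by algebra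
  then have sb: "sinh b = \<alpha> * sinh D" using nonneg x by (simp add: power2_eq_iff_nonneg)
  have "cosh (a + b) = cosh D" unfolding cosh_add a b sa sb
    using norm sinh_square_eq[of D] by algebra
  then show D: "a + b = D" using x nonneg by simp
  have s0: "0 < sinh a" "0 < sinh b" using x by auto
  let ?e = "a' + b' - D"
  have "1 + \<alpha> * \<beta> * sinh D * ?e = \<alpha> * (cosh a + sinh a * (a' - a)) + \<beta> * (cosh b + sinh b * (b' - b))"
    using one D unfolding sa sb by algebra
  also have "\<dots> \<le> cosh t" unfolding stewart
    using nonneg by (intro add_mono mult_left_mono cosh_ge_tangent)
  finally have "sinh D * (\<alpha> * \<beta> * sinh D * ?e) \<le> sinh D * (cosh t - 1)"
    using nonneg by (intro mult_left_mono) auto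
  moreover have "sinh D * (\<alpha> * \<beta> * sinh D * ?e) = ?e * (sinh a * sinh b)" unfolding sa sb by algebra
  ultimately have "?e \<le> sinh D * (cosh t - 1) / (sinh a * sinh b)"
    using s0 by (simp add: pos_le_divide_eq)
  also have "sinh D = sinh a * cosh b + cosh a * sinh b" unfolding D[symmetric] by (rule sinh_add)
  also have "(sinh a * cosh b + cosh a * sinh b) * (cosh t - 1) / (sinh a * sinh b)
      = (cosh t - 1) * (cosh b / sinh b + cosh a / sinh a)" using s0 by (simp add: field_simps)
  also have "\<dots> \<le> (cosh t - 1) * (2 / x + 2 / x)"
    using x cosh_real_ge_1[of t] by (intro mult_left_mono add_mono coth_le) auto
  finally show "a' + b' \<le> D + (cosh t - 1) * (4 / x)" by simp
qed

section \<open>The hyperboloid\<close>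

definition mink :: "nat \<Rightarrow> (nat \<Rightarrow> real) \<Rightarrow> (nat \<Rightarrow> real) \<Rightarrow> real" where
  "mink d x y = x d * y d - ip d x y"

lemma mink_commute: "mink d x y = mink d y x"
  unfolding mink_def by (simp add: ip_commute mult.commute)

lemma mink_comb_left: "mink d (\<lambda>i. a * x i + b * y i) z = a * mink d x z + b * mink d y z"
  unfolding mink_def ip_comb_left by (simp add: algebra_simps)

lemma mink_comb_right: "mink d z (\<lambda>i. a * x i + b * y i) = a * mink d z x + b * mink d z y"
  using mink_comb_left mink_commute by metis

lemma hyp_dist: "model_dist Hyp d x y = arcosh (mink d x y)"
  by (simp add: mink_def ip_def)

lemma hyp_carrier: "x \<in> model_carrier Hyp d \<longleftrightarrow> (\<forall>i\<ge>Suc d. x i = 0) \<and> 0 < x d \<and> mink d x x = 1"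
  by (auto simp: mink_def ip_def power2_eq_square)

lemma mink_orthogonal_nonpos:
  assumes y: "mink d y y = 1" and o: "mink d v y = 0"
  shows "mink d v v \<le> 0"
proof -
  have "(v d * y d)\<^sup>2 = \<bar>ip d v y\<bar>\<^sup>2" using o unfolding mink_def by simp
  also have "\<dots> \<le> (sqrt (ip d v v) * sqrt (ip d y y))\<^sup>2"
    by (rule power_mono[OF ip_cauchy_schwarz]) simp
  also have "\<dots> = ip d v v * ip d y y" using ip_self_nonneg by (simp add: power_mult_distrib)
  also have "ip d y y = (y d)\<^sup>2 - 1" using y unfolding mink_def by (simp add: power2_eq_square)
  finally have "(v d)\<^sup>2 * (y d)\<^sup>2 \<le> ip d v v * (y d)\<^sup>2 - ip d v v"
    by (simp add: power_mult_distrib right_diff_distrib)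
  then have "(v d)\<^sup>2 * (y d)\<^sup>2 \<le> ip d v v * (y d)\<^sup>2" using ip_self_nonneg[of d v] by linarith
  moreover have "0 < (y d)\<^sup>2" using y ip_self_nonneg[of d y]
    unfolding mink_def power2_eq_square by linarith
  ultimately have "(v d)\<^sup>2 \<le> ip d v v" by (rule mult_right_le_imp_le)
  then show ?thesis unfolding mink_def by (simp add: power2_eq_square)
qed

lemma discriminant_le_of_nonneg_quadratic:
  fixes A B C :: real
  assumes quadratic: "\<And>t. 0 \<le> A + 2 * t * B + t\<^sup>2 * C" and C: "0 \<le> C"
  shows "B\<^sup>2 \<le> A * C"
proof (cases "C = 0")
  case True
  have "B = 0"
  proof (rule ccontr)
    assume "B \<noteq> 0"
    then have "2 * (- (A + 1) / (2 * B)) * B = - (A + 1)" by simp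
    then show False using quadratic[of "- (A + 1) / (2 * B)"] True by simp
  qed
  then show ?thesis using True by simp
next
  case False
  then have "0 \<le> A - B\<^sup>2 / C" using quadratic[of "- B / C"]
    by (simp add: field_simps power2_eq_square)
  then show ?thesis using False C by (simp add: field_simps)
qed

lemma hyp_mink_ge_1:
  assumes "x \<in> model_carrier Hyp d" "y \<in> model_carrier Hyp d"
  shows "1 \<le> mink d x y"
proof -
  let ?a = "ip d x x" and ?b = "ip d y y"
  have pos: "0 < x d" "0 < y d" and sq: "(x d)\<^sup>2 = 1 + ?a" "(y d)\<^sup>2 = 1 + ?b"
    using assms unfolding hyp_carrier mink_def by (simp_all add: power2_eq_square)
  have ab: "0 \<le> ?a" "0 \<le> ?b" by (rule ip_self_nonneg)+
  have "0 \<le> (sqrt ?a - sqrt ?b)\<^sup>2" by simp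
  then have "2 * (sqrt ?a * sqrt ?b) \<le> ?a + ?b" unfolding power2_diff using ab by simp
  then have "(1 + sqrt ?a * sqrt ?b)\<^sup>2 \<le> (x d * y d)\<^sup>2"
    unfolding power_mult_distrib sq power2_sum
    using ab by (simp add: power_mult_distrib algebra_simps)
  then have "1 + sqrt ?a * sqrt ?b \<le> x d * y d" by (rule power2_le_imp_le) (use pos in simp)
  then show ?thesis using ip_cauchy_schwarz[of d x y] unfolding mink_def by linarith
qed

lemma hyp_dist_triangle:
  assumes "x \<in> model_carrier Hyp d" "y \<in> model_carrier Hyp d" "z \<in> model_carrier Hyp d"
  shows "model_dist Hyp d x z \<le> model_dist Hyp d x y + model_dist Hyp d y z"
proof -
  let ?a = "mink d x y" and ?b = "mink d y z" and ?c = "mink d x z"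
  have norm: "mink d x x = 1" "mink d y y = 1" "mink d z z = 1" using assms hyp_carrier by auto
  have ge: "1 \<le> ?a" "1 \<le> ?b" "1 \<le> ?c" using assms by (auto intro: hyp_mink_ge_1)
  define u v where "u = (\<lambda>i. 1 * x i + (- ?a) * y i)" and "v = (\<lambda>i. 1 * z i + (- ?b) * y i)"
  have gram: "mink d u u = 1 - ?a\<^sup>2" "mink d v v = 1 - ?b\<^sup>2" "mink d u v = ?c - ?a * ?b"
    and orthogonal: "mink d u y = 0" "mink d v y = 0"
    unfolding u_def v_def mink_comb_left mink_comb_right norm
    by (simp_all add: mink_commute[of d y x] mink_commute[of d z y] power2_eq_square)
  have "(- mink d u v)\<^sup>2 \<le> (- mink d u u) * (- mink d v v)"
  proof (rule discriminant_le_of_nonneg_quadratic)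
    fix t
    have "mink d (\<lambda>i. 1 * u i + t * v i) y = 0" unfolding mink_comb_left orthogonal by simp
    from mink_orthogonal_nonpos[OF norm(2) this]
    show "0 \<le> - mink d u u + 2 * t * (- mink d u v) + t\<^sup>2 * (- mink d v v)"
      unfolding mink_comb_left mink_comb_right mink_commute[of d v u]
      by (simp add: power2_eq_square algebra_simps)
  qed (use mink_orthogonal_nonpos[OF norm(2) orthogonal(2)] in simp)
  then have "\<bar>?a * ?b - ?c\<bar> \<le> sqrt ((?a\<^sup>2 - 1) * (?b\<^sup>2 - 1))"
    unfolding gram by (intro real_le_rsqrt) simp
  then have "?c \<le> ?a * ?b + sqrt (?a\<^sup>2 - 1) * sqrt (?b\<^sup>2 - 1)" unfolding real_sqrt_mult by linarith
  then have "cosh (arcosh ?c) \<le> cosh (arcosh ?a + arcosh ?b)"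
    unfolding cosh_add using ge by (simp add: cosh_arcosh_real sinh_arcosh_real)
  then show ?thesis
    unfolding hyp_dist using ge cosh_real_nonneg_le_iff[of "arcosh ?c" "arcosh ?a + arcosh ?b"]
    by simp
qed

section \<open>The half-space model\<close>

definition halfspace :: "nat \<Rightarrow> (nat \<Rightarrow> real) set" where
  "halfspace e = {x. (\<forall>i\<ge>Suc e. x i = 0) \<and> 0 < x e}"

definition hsq :: "nat \<Rightarrow> (nat \<Rightarrow> real) \<Rightarrow> (nat \<Rightarrow> real) \<Rightarrow> real" where
  "hsq e x y = (\<Sum>i<e. (x i - y i)\<^sup>2)"

definition hcosh :: "nat \<Rightarrow> (nat \<Rightarrow> real) \<Rightarrow> (nat \<Rightarrow> real) \<Rightarrow> real" where
  "hcosh e x y = (hsq e x y + (x e)\<^sup>2 + (y e)\<^sup>2) / (2 * x e * y e)"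

definition hdist :: "nat \<Rightarrow> (nat \<Rightarrow> real) \<Rightarrow> (nat \<Rightarrow> real) \<Rightarrow> real" where
  "hdist e x y = arcosh (hcosh e x y)"

definition to_hyp :: "nat \<Rightarrow> (nat \<Rightarrow> real) \<Rightarrow> nat \<Rightarrow> real" where
  "to_hyp e u = (\<lambda>i. if i < e then u i / u e
     else if i = e then (ip (Suc e) u u - 1) / (2 * u e)
     else if i = Suc e then (ip (Suc e) u u + 1) / (2 * u e) else 0)"

definition from_hyp :: "nat \<Rightarrow> (nat \<Rightarrow> real) \<Rightarrow> nat \<Rightarrow> real" where
  "from_hyp e x = (\<lambda>i. if i < e then x i / (x (Suc e) - x e) else if i = e then 1 / (x (Suc e) - x e) else 0)"

lemma hsq_nonneg: "0 \<le> hsq e x y"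
  unfolding hsq_def by (simp add: sum_nonneg)

lemma hcosh_commute: "hcosh e x y = hcosh e y x"
  unfolding hcosh_def hsq_def by (simp add: power2_commute add_ac mult_ac)

lemma hcosh_self: "0 < x e \<Longrightarrow> hcosh e x x = 1"
  unfolding hcosh_def hsq_def by (simp add: power2_eq_square)

lemma hcosh_minus_one:
  assumes "0 < x e" "0 < y e"
  shows "hcosh e x y - 1 = (\<Sum>i<Suc e. (x i - y i)\<^sup>2) / (2 * x e * y e)"
proof -
  have "hcosh e x y - 1 = (hsq e x y + (x e)\<^sup>2 + (y e)\<^sup>2 - 2 * x e * y e) / (2 * x e * y e)"
    unfolding hcosh_def diff_divide_distrib using assms by simp
  also have "hsq e x y + (x e)\<^sup>2 + (y e)\<^sup>2 - 2 * x e * y e = (\<Sum>i<Suc e. (x i - y i)\<^sup>2)"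
    unfolding hsq_def power2_diff by (simp add: power2_diff)
  finally show ?thesis .
qed

lemma hcosh_ge_1: "0 < x e \<Longrightarrow> 0 < y e \<Longrightarrow> 1 \<le> hcosh e x y"
  using hcosh_minus_one[of x e y] by (smt (verit) divide_nonneg_pos mult_pos_pos sum_nonneg zero_le_power2)

lemma halfspace_pos: "x \<in> halfspace e \<Longrightarrow> 0 < x e"
  unfolding halfspace_def by simp

lemma mink_to_hyp:
  assumes "0 < u e" "0 < v e"
  shows "mink (Suc e) (to_hyp e u) (to_hyp e v) = hcosh e u v"
proof -
  define A B where "A = ip (Suc e) u u" and "B = ip (Suc e) v v"
  have "ip e (to_hyp e u) (to_hyp e v) = ip e u v / (u e * v e)"
    unfolding ip_def sum_divide_distrib by (rule sum.cong) (auto simp: to_hyp_def)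
  then have "mink (Suc e) (to_hyp e u) (to_hyp e v)
      = (A + 1) / (2 * u e) * ((B + 1) / (2 * v e))
        - (ip e u v / (u e * v e) + (A - 1) / (2 * u e) * ((B - 1) / (2 * v e)))"
    unfolding mink_def A_def B_def by (simp add: ip_def) (simp add: to_hyp_def ip_def)
  also have "\<dots> = (A + B - 2 * ip e u v) / (2 * u e * v e)"
    using assms by (simp add: field_simps)
  also have "A + B - 2 * ip e u v = hsq e u v + (u e)\<^sup>2 + (v e)\<^sup>2"
    unfolding A_def B_def hsq_def ip_self_diff by (simp add: ip_def power2_eq_square)
  finally show ?thesis unfolding hcosh_def .
qed

lemma to_hyp_carrier:
  assumes "u \<in> halfspace e"
  shows "to_hyp e u \<in> model_carrier Hyp (Suc e)"
proof -
  have u: "0 < u e" using assms by (rule halfspace_pos)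
  then have "0 < to_hyp e u (Suc e)" unfolding to_hyp_def using ip_self_nonneg[of "Suc e" u] by simp
  then show ?thesis unfolding hyp_carrier mink_to_hyp[of u e u, OF u u] hcosh_self[of u e, OF u]
    by (simp add: to_hyp_def)
qed

lemma to_hyp_dist:
  "u \<in> halfspace e \<Longrightarrow> v \<in> halfspace e \<Longrightarrow> model_dist Hyp (Suc e) (to_hyp e u) (to_hyp e v) = hdist e u v"
  unfolding hyp_dist hdist_def using mink_to_hyp[of u e v] halfspace_pos by simp

lemma hyp_light_cone:
  assumes "x \<in> model_carrier Hyp (Suc e)"
  shows "x e < x (Suc e)" "(x (Suc e) - x e) * (x (Suc e) + x e) = 1 + ip e x x"
proof -
  show cone: "(x (Suc e) - x e) * (x (Suc e) + x e) = 1 + ip e x x"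
    using assms unfolding hyp_carrier mink_def by (simp add: ip_def algebra_simps)
  have "(x e)\<^sup>2 < (x (Suc e))\<^sup>2" using cone ip_self_nonneg[of e x]
    by (simp add: power2_eq_square algebra_simps)
  then show "x e < x (Suc e)" by (rule power2_less_imp_less) (use assms in \<open>simp add: hyp_carrier\<close>)
qed

lemma from_hyp_halfspace: "x \<in> model_carrier Hyp (Suc e) \<Longrightarrow> from_hyp e x \<in> halfspace e"
  unfolding halfspace_def from_hyp_def using hyp_light_cone(1) by simp

lemma to_hyp_from_hyp:
  assumes x: "x \<in> model_carrier Hyp (Suc e)"
  shows "to_hyp e (from_hyp e x) = x"
proof
  define a where "a = x (Suc e) - x e"
  have a: "0 < a" using hyp_light_cone(1)[OF x] unfolding a_def by simp
  have from_height: "from_hyp e x e = 1 / a" unfolding from_hyp_def a_def by simp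
  have "ip e (from_hyp e x) (from_hyp e x) = ip e x x / (a * a)"
    unfolding ip_def sum_divide_distrib by (rule sum.cong) (auto simp: from_hyp_def a_def)
  then have "ip (Suc e) (from_hyp e x) (from_hyp e x) = (1 + ip e x x) / (a * a)"
    unfolding ip_def by (simp add: from_height add_divide_distrib)
  also have "\<dots> = (x (Suc e) + x e) / a"
    unfolding hyp_light_cone(2)[OF x, symmetric, folded a_def] using a by simp
  finally have norm: "ip (Suc e) (from_hyp e x) (from_hyp e x) = (x (Suc e) + x e) / a" .
  fix i
  consider (horizontal) "i < e" | (height) "i = e" | (time) "i = Suc e" | (beyond) "Suc (Suc e) \<le> i" by linarith
  then show "to_hyp e (from_hyp e x) i = x i"
  proof cases
    case horizontal
    then show ?thesis unfolding to_hyp_def from_height using a by (simp add: from_hyp_def a_def)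
  next
    case height
    then have "to_hyp e (from_hyp e x) i = (x (Suc e) + x e - a) / 2"
      unfolding to_hyp_def from_height norm using a by (simp add: field_simps)
    then show ?thesis using height by (simp add: a_def)
  next
    case time
    then have "to_hyp e (from_hyp e x) i = (x (Suc e) + x e + a) / 2"
      unfolding to_hyp_def from_height norm using a by (simp add: field_simps)
    then show ?thesis using time by (simp add: a_def)
  next
    case beyond
    then show ?thesis unfolding to_hyp_def using x by (simp add: hyp_carrier)
  qed
qed

context
  fixes e :: nat
begin

private abbreviation (input) "U \<equiv> halfspace e"
private abbreviation (input) "\<delta> \<equiv> hdist e"

lemma cosh_hdist: "x \<in> U \<Longrightarrow> y \<in> U \<Longrightarrow> cosh (\<delta> x y) = hcosh e x y"
  unfolding hdist_def using hcosh_ge_1 halfspace_pos by (simp add: cosh_arcosh_real)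

lemma hdist_nonneg: "x \<in> U \<Longrightarrow> y \<in> U \<Longrightarrow> 0 \<le> \<delta> x y"
  unfolding hdist_def using hcosh_ge_1 halfspace_pos by (simp add: arcosh_nonneg_real)

lemma hdist_le_iff: "x \<in> U \<Longrightarrow> y \<in> U \<Longrightarrow> 0 \<le> t \<Longrightarrow> \<delta> x y \<le> t \<longleftrightarrow> hcosh e x y \<le> cosh t"
  using cosh_real_nonneg_le_iff[OF hdist_nonneg] cosh_hdist by metis

lemma hdist_ge_iff: "x \<in> U \<Longrightarrow> y \<in> U \<Longrightarrow> 0 \<le> t \<Longrightarrow> t \<le> \<delta> x y \<longleftrightarrow> cosh t \<le> hcosh e x y"
  using cosh_real_nonneg_le_iff[OF _ hdist_nonneg] cosh_hdist by metis

lemma halfspace_coordinates: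
  assumes "x \<in> U" "y \<in> U" "\<And>i. i < Suc e \<Longrightarrow> x i = y i"
  shows "x = y"
proof
  show "x i = y i" for i using assms unfolding halfspace_def by (cases "i < Suc e") auto
qed

lemma metric_on_halfspace: "metric_on U \<delta>"
proof
  fix x y z assume X: "x \<in> U" "y \<in> U"
  show "0 \<le> \<delta> x y" using X by (rule hdist_nonneg)
  show "\<delta> x y = \<delta> y x" unfolding hdist_def by (simp add: hcosh_commute)
  show "\<delta> x z \<le> \<delta> x y + \<delta> y z" if "z \<in> U"
    using hyp_dist_triangle[OF to_hyp_carrier[OF X(1)] to_hyp_carrier[OF X(2)] to_hyp_carrier[OF that]]
    unfolding to_hyp_dist[OF X] to_hyp_dist[OF X(1) that] to_hyp_dist[OF X(2) that] .
  assume "x \<noteq> y"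
  then obtain i where i: "i < Suc e" "x i \<noteq> y i" using halfspace_coordinates[OF X] by blast
  then have "0 < (\<Sum>j<Suc e. (x j - y j)\<^sup>2)" by (intro sum_pos2[of _ i]) auto
  then have "1 < hcosh e x y"
    using hcosh_minus_one[of x e y] X halfspace_pos
    by (simp add: zero_less_divide_iff flip: diff_gt_0_iff_gt[of _ 1])
  then show "0 < \<delta> x y" unfolding hdist_def by simp
qed

lemma cosh_ln_ratio: "0 < a \<Longrightarrow> 0 < b \<Longrightarrow> cosh (ln (a / b)) = (a\<^sup>2 + b\<^sup>2) / (2 * a * b)" for a b :: real
  by (simp add: cosh_ln_real field_simps power2_eq_square)

lemma sinh_ln_ratio: "0 < a \<Longrightarrow> 0 < b \<Longrightarrow> sinh (ln (a / b)) = (a\<^sup>2 - b\<^sup>2) / (2 * a * b)" for a b :: real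
  by (simp add: sinh_ln_real field_simps power2_eq_square)

lemma hdist_le_vertical:
  assumes x: "x \<in> U" and y: "y \<in> U" and lt: "y e < x e"
  shows "\<delta> x y \<le> ln (x e / y e) + hsq e x y / ((x e)\<^sup>2 - (y e)\<^sup>2)"
proof -
  let ?l = "ln (x e / y e)" and ?t = "hsq e x y / ((x e)\<^sup>2 - (y e)\<^sup>2)"
  have pos: "0 < x e" "0 < y e" using x y halfspace_pos by auto
  have l: "0 \<le> ?l" using pos lt by simp
  have sqd: "0 < (x e)\<^sup>2 - (y e)\<^sup>2" using pos lt by (simp add: power_strict_mono)
  have t: "0 \<le> ?t" using hsq_nonneg sqd by (intro divide_nonneg_pos) auto
  have "hcosh e x y = cosh ?l + hsq e x y / (2 * x e * y e)"
    unfolding cosh_ln_ratio[OF pos] hcosh_def by (simp add: add_divide_distrib)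
  also have "hsq e x y / (2 * x e * y e) = sinh ?l * ?t"
    unfolding sinh_ln_ratio[OF pos] using sqd by simp
  also have "cosh ?l + sinh ?l * ?t \<le> cosh (?l + ?t)" using cosh_ge_tangent[of ?l "?l + ?t"] by simp
  finally show ?thesis using hdist_le_iff[OF x y, of "?l + ?t"] l t by simp
qed

lemma hdist_ge_vertical:
  assumes x: "x \<in> U" and y: "y \<in> U" and le: "y e \<le> x e"
  shows "ln (x e / y e) \<le> \<delta> x y"
proof -
  have pos: "0 < x e" "0 < y e" using x y halfspace_pos by auto
  have "cosh (ln (x e / y e)) \<le> hcosh e x y"
    unfolding cosh_ln_ratio[OF pos] hcosh_def using pos hsq_nonneg by (intro divide_right_mono) auto
  then show ?thesis using hdist_ge_iff[OF x y, of "ln (x e / y e)"] pos le by simp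
qed

lemma hdist_le_ln:
  assumes "x \<in> U" "y \<in> U"
  shows "\<delta> x y \<le> ln (2 * hcosh e x y)"
proof -
  have "exp (\<delta> x y) \<le> 2 * hcosh e x y" unfolding cosh_hdist[OF assms, symmetric] cosh_def by simp
  then show ?thesis by (metis exp_gt_zero less_le_trans ln_exp ln_le_cancel_iff)
qed

lemma exp_minus_le_one_minus_half:
  fixes t :: real
  assumes "0 \<le> t" "t \<le> 1"
  shows "exp (- t) \<le> 1 - t / 2"
proof -
  have "exp (- t) \<le> 1 / (1 + t)"
    using assms exp_ge_add_one_self[of t]
    by (simp add: exp_minus inverse_eq_divide divide_left_mono)
  also have "(1 - t / 2) * (1 + t) = 1 + t * (1 - t) / 2" by (simp add: field_simps)
  then have "1 / (1 + t) \<le> 1 - t / 2" using assms by (subst pos_divide_le_eq) auto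
  finally show ?thesis .
qed

lemma hdist_ge_ln:
  assumes "x \<in> U" "y \<in> U"
  shows "ln (2 * hcosh e x y) - 1 / (hcosh e x y)\<^sup>2 \<le> \<delta> x y"
proof -
  define g D where "g = hcosh e x y" and "D = \<delta> x y"
  have g: "1 \<le> g" "0 \<le> D" and gD: "2 * g = exp D + exp (- D)"
    using assms hcosh_ge_1 halfspace_pos cosh_hdist[OF assms] hdist_nonneg cosh_field_def[of D]
    unfolding g_def D_def by auto
  have "exp (- D) \<le> exp D" using g(2) by simp
  then have "g \<le> exp D" using gD by linarith
  then have "exp (- D) \<le> 1 / g" using g(1)
    by (simp add: exp_minus inverse_eq_divide divide_left_mono)
  moreover have "1 / g\<^sup>2 \<le> 1" using g(1) by simp
  then have "2 * g * exp (- (1 / g\<^sup>2)) \<le> 2 * g * (1 - 1 / g\<^sup>2 / 2)"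
    using g(1) by (intro mult_left_mono exp_minus_le_one_minus_half) auto
  moreover have "2 * g * (1 - 1 / g\<^sup>2 / 2) = 2 * g - 1 / g"
    using g(1) by (simp add: field_simps power2_eq_square)
  ultimately have "2 * g * exp (- (1 / g\<^sup>2)) \<le> exp D" using gD by linarith
  then have "ln (2 * g * exp (- (1 / g\<^sup>2))) \<le> ln (exp D)"
    using g(1) by (subst ln_le_cancel_iff) auto
  then show ?thesis using g(1) unfolding g_def[symmetric] D_def[symmetric] by (simp add: ln_mult)
qed

lemma hdist_ge_coordinate:
  assumes x: "x \<in> U" and y: "y \<in> U" and i: "i \<le> e" and t: "0 \<le> t" "t \<le> 1"
    and le: "t\<^sup>2 * (2 * x e * y e) \<le> (x i - y i)\<^sup>2"
  shows "t \<le> \<delta> x y"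
proof (rule le_of_quadratic_le_cosh[OF hdist_nonneg[OF x y] t])
  have pos: "0 < x e" "0 < y e" using x y halfspace_pos by auto
  have "(x i - y i)\<^sup>2 \<le> (\<Sum>j<Suc e. (x j - y j)\<^sup>2)"
    using i by (intro member_le_sum[of i "{..<Suc e}" "\<lambda>j. (x j - y j)\<^sup>2"]) auto
  then have "t\<^sup>2 \<le> (\<Sum>j<Suc e. (x j - y j)\<^sup>2) / (2 * x e * y e)"
    using le pos by (subst pos_le_divide_eq) auto
  then show "1 + t\<^sup>2 \<le> cosh (\<delta> x y)"
    unfolding cosh_hdist[OF x y] using hcosh_minus_one[of x e y] pos by simp
qed

lemma hcosh_le_coordinate_bound:
  assumes x: "x \<in> U" and y: "y \<in> U" and close: "\<And>j. j < Suc e \<Longrightarrow> \<bar>x j - y j\<bar> \<le> \<rho>"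
    and height: "x e / 2 \<le> y e"
  shows "hcosh e x y - 1 \<le> real (Suc e) * \<rho>\<^sup>2 / (x e)\<^sup>2"
proof -
  have pos: "0 < x e" "0 < y e" using x y halfspace_pos by auto
  have "hcosh e x y - 1 \<le> real (Suc e) * \<rho>\<^sup>2 / (2 * x e * y e)"
    unfolding hcosh_minus_one[of x e y, OF pos]
    using pos sum_squares_bounded_above[of "Suc e" "\<lambda>j. x j - y j" \<rho>] close
    by (intro divide_right_mono) auto
  also have "\<dots> \<le> real (Suc e) * \<rho>\<^sup>2 / (2 * x e * (x e / 2))"
    using height pos by (intro divide_left_mono mult_left_mono mult_pos_pos mult_nonneg_nonneg) auto
  finally show ?thesis by (simp add: power2_eq_square)
qed

section \<open>Detours in the half-space\<close>

text \<open>The geodesic from \<open>p\<close> to \<open>q\<close> is an arc orthogonal to the boundary; \<open>v\<close> is the fraction of the horizontal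
  displacement.\<close>

definition hpoint :: "(nat \<Rightarrow> real) \<Rightarrow> (nat \<Rightarrow> real) \<Rightarrow> real \<Rightarrow> nat \<Rightarrow> real" where
  "hpoint p q v = (\<lambda>j. if j < e then p j + v * (q j - p j)
     else if j = e then sqrt ((1 - v) * (p e)\<^sup>2 + v * (q e)\<^sup>2 + v * (1 - v) * hsq e p q) else 0)"

lemma
  assumes p: "p \<in> U" and q: "q \<in> U" and v: "0 \<le> v" "v \<le> 1"
  shows hpoint_in_halfspace: "hpoint p q v \<in> U"
    and hpoint_height_sq: "(hpoint p q v e)\<^sup>2 = (1 - v) * (p e)\<^sup>2 + v * (q e)\<^sup>2 + v * (1 - v) * hsq e p q"
    and hpoint_height_ge: "min (p e) (q e) \<le> hpoint p q v e"
    and hpoint_height_le: "hpoint p q v e \<le> max (p e) (q e) + sqrt (hsq e p q)"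
proof -
  let ?h = "hsq e p q" and ?a = "min (p e) (q e)" and ?b = "max (p e) (q e)"
  let ?Q = "(1 - v) * (p e)\<^sup>2 + v * (q e)\<^sup>2 + v * (1 - v) * ?h"
  have pos: "0 < p e" "0 < q e" using p q halfspace_pos by auto
  have h: "0 \<le> ?h" by (rule hsq_nonneg)
  have "?a\<^sup>2 = (1 - v) * ?a\<^sup>2 + v * ?a\<^sup>2 + 0" by algebra
  also have "\<dots> \<le> ?Q" using v pos h by (intro add_mono mult_left_mono power_mono mult_nonneg_nonneg) auto
  finally have lo: "?a\<^sup>2 \<le> ?Q" .
  have "v * (1 - v) \<le> 1" using v by (intro mult_le_one) auto
  then have "?Q \<le> (1 - v) * ?b\<^sup>2 + v * ?b\<^sup>2 + 1 * ?h"
    using v pos h by (intro add_mono mult_left_mono power_mono mult_right_mono) auto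
  also have "\<dots> = ?b\<^sup>2 + ?h" by algebra
  also have "\<dots> \<le> (?b + sqrt ?h)\<^sup>2" unfolding power2_sum using pos h by simp
  finally have hi: "?Q \<le> (?b + sqrt ?h)\<^sup>2" .
  have height: "hpoint p q v e = sqrt ?Q" unfolding hpoint_def by simp
  show "(hpoint p q v e)\<^sup>2 = ?Q" unfolding height
    using lo by (simp add: order_trans[OF zero_le_power2])
  show ge: "?a \<le> hpoint p q v e" unfolding height using lo by (rule real_le_rsqrt)
  show "hpoint p q v e \<le> ?b + sqrt ?h" unfolding height using hi pos h by (intro real_le_lsqrt) auto
  have "0 < hpoint p q v e" using ge pos by linarith
  then show "hpoint p q v \<in> U" unfolding halfspace_def by (simp add: hpoint_def)
qed

lemma hcosh_hpoint:
  assumes p: "p \<in> U" and q: "q \<in> U" and v: "0 \<le> v" "v \<le> 1" and s: "s \<in> U"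
  shows "hcosh e (hpoint p q v) s = (1 - v) * p e / hpoint p q v e * hcosh e p s
      + v * q e / hpoint p q v e * hcosh e s q"
proof -
  let ?y = "hpoint p q v"
  have pos: "0 < p e" "0 < q e" "0 < s e" "0 < ?y e"
    using p q s hpoint_in_halfspace[OF p q v] halfspace_pos by auto
  have "(1 - v) * hsq e p s + v * hsq e s q = hsq e ?y s + v * (1 - v) * hsq e p q"
    unfolding hsq_def by (rule stewart_sum_squares) (simp add: hpoint_def)
  then have numerator: "hsq e ?y s + (?y e)\<^sup>2 + (s e)\<^sup>2
      = (1 - v) * (hsq e p s + (p e)\<^sup>2 + (s e)\<^sup>2) + v * (hsq e s q + (s e)\<^sup>2 + (q e)\<^sup>2)"
    unfolding hpoint_height_sq[OF p q v] by algebra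
  show ?thesis unfolding hcosh_def numerator using pos by (simp add: field_simps)
qed

lemma hyp_detour_le:
  assumes p: "p \<in> U" and q: "q \<in> U" and v: "0 \<le> v" "v \<le> 1" and s: "s \<in> U"
    and x: "0 < x" "x \<le> 1" "x \<le> \<delta> p (hpoint p q v)" "x \<le> \<delta> (hpoint p q v) q"
  shows "\<delta> p (hpoint p q v) + \<delta> (hpoint p q v) q = \<delta> p q"
    and "\<delta> p s + \<delta> s q \<le> \<delta> p q + (hcosh e (hpoint p q v) s - 1) * (4 / x)"
proof -
  let ?y = "hpoint p q v"
  have y: "?y \<in> U" by (rule hpoint_in_halfspace[OF p q v])
  have pos: "0 < p e" "0 < q e" "0 < ?y e" using p q y halfspace_pos by auto
  define \<alpha> \<beta> where "\<alpha> = (1 - v) * p e / ?y e" and "\<beta> = v * q e / ?y e"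
  have nonneg: "0 \<le> \<alpha>" "0 \<le> \<beta>" unfolding \<alpha>_def \<beta>_def using v pos by auto
  have stewart: "hcosh e ?y z = \<alpha> * hcosh e p z + \<beta> * hcosh e z q" if "z \<in> U" for z
    using hcosh_hpoint[OF p q v that] unfolding \<alpha>_def \<beta>_def .
  have "cosh (\<delta> ?y s) = \<alpha> * cosh (\<delta> p s) + \<beta> * cosh (\<delta> s q)"
    using stewart[OF s] p q y s by (simp add: cosh_hdist)
  moreover have "cosh (\<delta> p ?y) = \<alpha> + \<beta> * cosh (\<delta> p q)"
    using stewart[OF p] p q y pos by (simp add: cosh_hdist hcosh_commute[of e p ?y] hcosh_self)
  moreover have "cosh (\<delta> ?y q) = \<alpha> * cosh (\<delta> p q) + \<beta>"
    using stewart[OF q] p q y pos by (simp add: cosh_hdist hcosh_self)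
  moreover have "1 = \<alpha> * cosh (\<delta> p ?y) + \<beta> * cosh (\<delta> ?y q)"
    using stewart[OF y] p q y pos by (simp add: cosh_hdist hcosh_self)
  ultimately have "\<delta> p ?y + \<delta> ?y q = \<delta> p q \<and> \<delta> p s + \<delta> s q \<le> \<delta> p q + (cosh (\<delta> ?y s) - 1) * (4 / x)"
    using hyperbolic_excess[OF _ _ _ _ nonneg hdist_nonneg[OF p q] x] by blast
  then show "\<delta> p ?y + \<delta> ?y q = \<delta> p q" "\<delta> p s + \<delta> s q \<le> \<delta> p q + (hcosh e ?y s - 1) * (4 / x)"
    unfolding cosh_hdist[OF y s] by auto
qed

lemma ex_hpoint_height:
  assumes p: "p \<in> U" and q: "q \<in> U" and c: "min (p e) (q e) \<le> c" "c \<le> max (p e) (q e)"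
  obtains v where "0 \<le> v" "v \<le> 1" "hpoint p q v e = c"
proof -
  define f where "f v = (1 - v) * (p e)\<^sup>2 + v * (q e)\<^sup>2 + v * (1 - v) * hsq e p q" for v
  have pos: "0 < p e" "0 < q e" using p q halfspace_pos by auto
  have "(min (p e) (q e))\<^sup>2 \<le> c\<^sup>2" "c\<^sup>2 \<le> (max (p e) (q e))\<^sup>2"
    using c pos by (intro power_mono; simp)+
  then have "min (f 0) (f 1) \<le> c\<^sup>2" "c\<^sup>2 \<le> max (f 0) (f 1)"
    unfolding f_def by (auto simp: min_def max_def split: if_splits)
  moreover have "continuous_on {0..1} f" unfolding f_def by (intro continuous_intros)
  ultimately obtain v where v: "0 \<le> v" "v \<le> 1" "f v = c\<^sup>2" using ivt_unit_interval by metis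
  have "hpoint p q v e = sqrt (f v)" unfolding hpoint_def f_def by simp
  then have "hpoint p q v e = c" unfolding v(3) using c(1) pos by simp
  with v(1,2) show thesis by (rule that)
qed

lemma ex_hpoint_on_wall:
  assumes p: "p \<in> U" and q: "q \<in> U" and i: "i < Suc e" and u: "1 / 3 \<le> u" "u \<le> 2 / 3"
    and w: "0 < w" "w / 6 < \<bar>p i - q i\<bar>"
  obtains v where "0 \<le> v" "v \<le> 1" "hpoint p q v i = p i + u * (q i - p i)" "w / 18 \<le> hpoint p q v e"
proof (cases "i = e")
  case False
  then have ie: "i < e" using i by simp
  have u01: "0 \<le> u" "u \<le> 1" using u by auto
  have "(w / 6)\<^sup>2 \<le> \<bar>p i - q i\<bar>\<^sup>2" using w by (intro power_mono) auto
  also have "\<dots> \<le> hsq e p q" unfolding hsq_def power2_abs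
    using ie by (intro member_le_sum[of i "{..<e}" "\<lambda>j. (p j - q j)\<^sup>2"]) auto
  finally have "2 / 9 * (w / 6)\<^sup>2 \<le> u * (1 - u) * hsq e p q"
    using middle_third_product_ge[OF u] by (intro mult_mono) auto
  also have "\<dots> \<le> (hpoint p q u e)\<^sup>2" unfolding hpoint_height_sq[OF p q u01] using u01 by simp
  finally have "2 / 9 * (w / 6)\<^sup>2 \<le> (hpoint p q u e)\<^sup>2" .
  moreover have "(w / 18)\<^sup>2 \<le> 2 / 9 * (w / 6)\<^sup>2" by (simp add: power_divide)
  ultimately have "w / 18 \<le> hpoint p q u e"
    using halfspace_pos[OF hpoint_in_halfspace[OF p q u01]]
    by (intro power2_le_imp_le[of "w / 18"]) auto
  then show thesis using that[OF u01] ie by (simp add: hpoint_def)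
next
  case True
  let ?c = "p e + u * (q e - p e)"
  have c: "min (p e) (q e) \<le> ?c" "?c \<le> max (p e) (q e)" using u by (auto intro!: segment_between)
  have "0 < p e" "0 < q e" using p q halfspace_pos by auto
  then have "w / 18 \<le> ?c"
    using middle_third_far[OF refl u, of w "p e" "q e"] w c
    unfolding True by (auto simp: min_def split: if_splits)
  then show thesis using ex_hpoint_height[OF p q c] that unfolding True by metis
qed

lemma hpoint_close:
  assumes p: "p \<in> U" and q: "q \<in> U" and v: "0 \<le> v" "v \<le> 1"
    and close: "\<And>j. j < Suc e \<Longrightarrow> \<bar>p j - q j\<bar> \<le> r" and j: "j < Suc e"
  shows "\<bar>hpoint p q v j - p j\<bar> \<le> real (Suc e) * r"
proof (cases "j = e")
  case False
  have "0 \<le> r" using close[OF j] by linarith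
  have "\<bar>hpoint p q v j - p j\<bar> = v * \<bar>p j - q j\<bar>"
    using False j v unfolding hpoint_def by (simp add: abs_mult abs_minus_commute)
  also have "\<dots> \<le> 1 * r" using v close[OF j] by (intro mult_mono) auto
  also have "\<dots> \<le> real (Suc e) * r" using \<open>0 \<le> r\<close> by (intro mult_right_mono) auto
  finally show ?thesis .
next
  case True
  have "sqrt (hsq e p q) \<le> real e * r"
    using L2_le_coordinate_bound[of e "\<lambda>j. p j - q j" r] close unfolding hsq_def L2_set_def by simp
  then have "hpoint p q v e \<le> max (p e) (q e) + real e * r"
    using hpoint_height_le[OF p q v] by linarith
  moreover have "0 \<le> real e * r" "real (Suc e) * r = r + real e * r"
    using close[of e] by (simp_all add: distrib_right)
  ultimately show ?thesis
    using hpoint_height_ge[OF p q v] close[of e] unfolding True by linarith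
qed

lemma hdist_ge_on_wall:
  assumes x: "x \<in> U" and y: "y \<in> U" and i: "i < Suc e" and w: "0 < w" "w \<le> 18 * y e"
    and far: "w / 18 \<le> \<bar>x i - y i\<bar>" and height: "x e \<le> 7 * y e"
  shows "w / (68 * y e) \<le> \<delta> x y"
proof (rule hdist_ge_coordinate[OF x y])
  have pos: "0 < x e" "0 < y e" using x y halfspace_pos by auto
  show "0 \<le> w / (68 * y e)" "w / (68 * y e) \<le> 1" using w pos by (auto simp: pos_divide_le_eq)
  have "(w / (68 * y e))\<^sup>2 * (2 * x e * y e) \<le> (w / (68 * y e))\<^sup>2 * (2 * (7 * y e) * y e)"
    using height pos by (intro mult_left_mono mult_right_mono) auto
  also have "\<dots> = w\<^sup>2 * (14 / 4624)" using pos
    by (simp add: power_divide power_mult_distrib power2_eq_square)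
  also have "\<dots> \<le> (w / 18)\<^sup>2" by (simp add: power_divide)
  also have "\<dots> \<le> \<bar>x i - y i\<bar>\<^sup>2" using far w by (intro power_mono) auto
  finally show "(w / (68 * y e))\<^sup>2 * (2 * x e * y e) \<le> (x i - y i)\<^sup>2" by simp
qed (use i in simp)

lemma ex_hyp_wall_point:
  assumes p: "p \<in> U" and q: "q \<in> U" and i: "i < Suc e" and u: "1 / 3 \<le> u" "u \<le> 2 / 3"
    and w: "0 < w" "w / 6 < \<bar>p i - q i\<bar>" and close: "\<And>j. j < Suc e \<Longrightarrow> \<bar>p j - q j\<bar> \<le> w / 3"
  obtains y where "y \<in> U" "y i = p i + u * (q i - p i)" "w / 18 \<le> y e"
    "\<And>j. j < Suc e \<Longrightarrow> \<bar>y j - p j\<bar> \<le> real (Suc e) * w" "w / (68 * y e) \<le> \<delta> p q"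
    "\<And>s. s \<in> U \<Longrightarrow> \<delta> p s + \<delta> s q \<le> \<delta> p q + (hcosh e y s - 1) * (4 / (w / (68 * y e)))"
proof -
  obtain v where v: "0 \<le> v" "v \<le> 1" and wall: "hpoint p q v i = p i + u * (q i - p i)"
    and height: "w / 18 \<le> hpoint p q v e" by (rule ex_hpoint_on_wall[OF p q i u w])
  define y where "y = hpoint p q v"
  have y: "y \<in> U" unfolding y_def by (rule hpoint_in_halfspace[OF p q v])
  have pos: "0 < p e" "0 < q e" "0 < y e" using p q y halfspace_pos by auto
  have wy: "w \<le> 18 * y e" using height unfolding y_def by simp
  have "p e \<le> 7 * y e" "q e \<le> 7 * y e"
    using hpoint_height_ge[OF p q v] close[of e] wy pos
    unfolding y_def[symmetric] by (auto simp: min_def split: if_splits)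
  moreover have "w / 18 \<le> \<bar>p i - y i\<bar>" "w / 18 \<le> \<bar>y i - q i\<bar>"
    using middle_third_far[OF wall u w(2)] unfolding y_def by auto
  ultimately have x: "w / (68 * y e) \<le> \<delta> p y" "w / (68 * y e) \<le> \<delta> q y"
    by (intro hdist_ge_on_wall[OF _ y i w(1) wy]; use p q in \<open>simp add: abs_minus_commute\<close>)+
  interpret metric_on U \<delta> by (rule metric_on_halfspace)
  note detour = hyp_detour_le[OF p q v, of _ "w / (68 * y e)", folded y_def]
  have x': "0 < w / (68 * y e)" "w / (68 * y e) \<le> 1" "w / (68 * y e) \<le> \<delta> y q"
    using w pos wy x(2) sym[OF q y] by (auto simp: pos_divide_le_eq)
  show thesis
  proof (rule that[OF y])
    show "y i = p i + u * (q i - p i)" "w / 18 \<le> y e" using wall height unfolding y_def by auto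
    show "w / (68 * y e) \<le> \<delta> p q" using detour(1)[OF p x'(1,2) x(1) x'(3)] x(1) nonneg[OF y q]
      by linarith
    show "\<delta> p s + \<delta> s q \<le> \<delta> p q + (hcosh e y s - 1) * (4 / (w / (68 * y e)))" if "s \<in> U" for s
      using detour(2)[OF that x'(1,2) x(1) x'(3)] .
    show "\<bar>y j - p j\<bar> \<le> real (Suc e) * w" if "j < Suc e" for j
    proof -
      have "\<bar>p k - q k\<bar> \<le> w" if "k < Suc e" for k using close[OF that] w(1) by linarith
      then show ?thesis unfolding y_def by (rule hpoint_close[OF p q v _ that])
    qed
  qed
qed

definition hyp_net_region :: "(nat \<Rightarrow> real) \<Rightarrow> real \<Rightarrow> (nat \<Rightarrow> real) set" where
  "hyp_net_region c w = {y\<in>U. w / 18 \<le> y e \<and> (\<forall>j<Suc e. \<bar>y j - c j\<bar> \<le> 2 * real (Suc e) * w)}"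

lemma hyp_excess_small:
  assumes y: "y \<in> U" and s: "s \<in> U" and \<epsilon>: "0 < \<epsilon>" "\<epsilon> \<le> 1" and w: "0 < w" "w / 18 \<le> y e"
    and near: "\<And>j. j < Suc e \<Longrightarrow> \<bar>y j - s j\<bar> \<le> sqrt \<epsilon> * w / (300 * real (Suc e))"
  shows "(hcosh e y s - 1) * (4 / (w / (68 * y e))) \<le> \<epsilon> / 4 * (w / (68 * y e))"
proof -
  let ?\<theta> = "sqrt \<epsilon> * w / (300 * real (Suc e))" and ?x = "w / (68 * y e)"
  have pos: "0 < y e" using y halfspace_pos by auto
  have "?\<theta> \<le> 1 * w / (300 * 1)" using \<epsilon> w by (intro frac_le mult_right_mono) auto
  then have "y e / 2 \<le> s e" using near[of e] w by simp
  then have "hcosh e y s - 1 \<le> real (Suc e) * ?\<theta>\<^sup>2 / (y e)\<^sup>2"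
    using near by (intro hcosh_le_coordinate_bound y s) auto
  also have "real (Suc e) * ?\<theta>\<^sup>2 = \<epsilon> * w\<^sup>2 / (90000 * real (Suc e))"
    using \<epsilon> by (simp add: power_mult_distrib power_divide power2_eq_square del: of_nat_Suc)
  also have "\<dots> / (y e)\<^sup>2 \<le> \<epsilon> * w\<^sup>2 / 90000 / (y e)\<^sup>2"
    using \<epsilon> by (intro divide_right_mono divide_left_mono) auto
  finally have "(hcosh e y s - 1) * (4 / ?x) \<le> \<epsilon> * w\<^sup>2 / 90000 / (y e)\<^sup>2 * (4 / ?x)"
    using w pos by (intro mult_right_mono) auto
  also have "\<dots> = \<epsilon> * ?x * (4 * 68 * 68 / 90000)"
    using w pos by (simp add: field_simps power2_eq_square)
  also have "\<dots> \<le> \<epsilon> * ?x * (1 / 4)" using \<epsilon> w pos by (intro mult_left_mono) auto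
  finally show ?thesis by simp
qed

lemma ex_hyp_detour_net:
  assumes \<epsilon>: "0 < \<epsilon>" "\<epsilon> \<le> 1" and w: "0 < w"
  shows "\<exists>S\<subseteq>hyp_net_region c w. finite S \<and>
     real (card S) \<le> 25 * real (Suc e) * (1200 * real (Suc e) ^ 2 / sqrt \<epsilon> + 2) ^ e \<and>
     detour_net (Suc e) U \<delta> \<epsilon> c w S"
proof -
  define \<theta> where "\<theta> = sqrt \<epsilon> * w / (300 * real (Suc e))"
  let ?Q = "hyp_net_region c w" and ?\<rho> = "2 * real (Suc e) * w"
  have \<theta>: "0 < \<theta>" unfolding \<theta>_def using \<epsilon> w by (intro divide_pos_pos mult_pos_pos) auto
  have "2 * ?\<rho> / \<theta> = 1200 * real (Suc e) ^ 2 / sqrt \<epsilon>"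
    unfolding \<theta>_def using w \<epsilon> by (simp add: field_simps power2_eq_square del: of_nat_Suc)
  then obtain S where S: "wall_net (Suc e) c w \<theta> ?Q S"
    "real (card S) \<le> 25 * real (Suc e) * (1200 * real (Suc e) ^ 2 / sqrt \<epsilon> + 2) ^ e"
    using ex_wall_net[OF \<theta>, of ?\<rho> ?Q "Suc e" c w] w unfolding hyp_net_region_def by auto
  have "\<exists>s\<in>S. \<delta> p s + \<delta> s q \<le> (1 + \<epsilon> / 4) * \<delta> p q"
    if X: "p \<in> U" "q \<in> U" and pair: "cube_pair (Suc e) c w p q" for p q
  proof -
    have close: "\<bar>p j - q j\<bar> \<le> w / 3" and corner: "\<bar>p j - c j\<bar> \<le> w" if "j < Suc e" for j
      using pair that abs_diff_cube_corner[of p "Suc e" c w j] unfolding cube_pair_def by auto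
    obtain i u where i: "i < Suc e" "w / 6 < \<bar>p i - q i\<bar>" and u: "1 / 3 \<le> u" "u \<le> 2 / 3"
      and cross: "\<And>y. y \<in> ?Q \<Longrightarrow> y i = p i + u * (q i - p i) \<Longrightarrow> \<exists>s\<in>S. \<forall>j<Suc e. \<bar>y j - s j\<bar> \<le> \<theta>"
      using wall_net_crossing[OF S(1) pair w] by metis
    obtain y where y: "y \<in> U" "y i = p i + u * (q i - p i)" "w / 18 \<le> y e"
        "\<And>j. j < Suc e \<Longrightarrow> \<bar>y j - p j\<bar> \<le> real (Suc e) * w" "w / (68 * y e) \<le> \<delta> p q"
      and excess: "\<And>s. s \<in> U \<Longrightarrow> \<delta> p s + \<delta> s q \<le> \<delta> p q + (hcosh e y s - 1) * (4 / (w / (68 * y e)))"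
      using ex_hyp_wall_point[OF X i(1) u w i(2) close] by metis
    have "\<bar>y j - c j\<bar> \<le> 2 * real (Suc e) * w" if "j < Suc e" for j
    proof -
      have "1 * w \<le> real (Suc e) * w" using w by (intro mult_right_mono) auto
      then show ?thesis using y(4)[OF that] corner[OF that] by linarith
    qed
    then have "y \<in> ?Q" unfolding hyp_net_region_def using y by simp
    then obtain s where s: "s \<in> S" "\<forall>j<Suc e. \<bar>y j - s j\<bar> \<le> \<theta>" using cross[of y] y(2) by blast
    have sU: "s \<in> U" using S(1) s(1) unfolding wall_net_def hyp_net_region_def by blast
    have "(hcosh e y s - 1) * (4 / (w / (68 * y e))) \<le> \<epsilon> / 4 * (w / (68 * y e))"
      using s(2) unfolding \<theta>_def by (intro hyp_excess_small y sU \<epsilon> w) auto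
    also have "\<dots> \<le> \<epsilon> / 4 * \<delta> p q" using y(5) \<epsilon> by (intro mult_left_mono) auto
    finally have "\<delta> p s + \<delta> s q \<le> (1 + \<epsilon> / 4) * \<delta> p q"
      using excess[OF sU] by (simp add: distrib_right)
    then show ?thesis using s(1) by blast
  qed
  then show ?thesis using S unfolding wall_net_def detour_net_def by (intro exI[of _ S]) blast
qed

section \<open>Anchors in the half-space\<close>

private abbreviation (input) "d \<equiv> Suc e"

lemma hdist_le_steep:
  assumes x: "x \<in> U" and y: "y \<in> U" and le: "2 * y e \<le> x e"
    and close: "\<And>j. j < e \<Longrightarrow> \<bar>x j - y j\<bar> \<le> \<omega> * x e"
  shows "\<delta> x y \<le> (1 + 2 * real d * \<omega>\<^sup>2) * (ln (x e) - ln (y e))"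
proof -
  have pos: "0 < x e" "0 < y e" using x y halfspace_pos by auto
  have "hsq e x y \<le> real e * (\<omega> * x e)\<^sup>2"
    unfolding hsq_def by (rule sum_squares_bounded_above[OF close])
  also have "\<dots> \<le> real d * (\<omega> * x e)\<^sup>2" by (intro mult_right_mono) auto
  finally have h: "hsq e x y \<le> real d * \<omega>\<^sup>2 * (x e)\<^sup>2" by (simp add: power_mult_distrib)
  have "(2 * y e)\<^sup>2 \<le> (x e)\<^sup>2" using le pos by (intro power_mono) auto
  then have q: "3 / 4 * (x e)\<^sup>2 \<le> (x e)\<^sup>2 - (y e)\<^sup>2" by (simp add: power_mult_distrib)
  have ln: "ln (x e / y e) = ln (x e) - ln (y e)" using pos by (simp add: ln_divide_pos)
  have "2 / 3 \<le> ln (2 :: real)" by (rule ln2_ge_two_thirds)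
  also have "\<dots> \<le> ln (x e / y e)" using le pos
    by (subst ln_le_cancel_iff) (auto simp: pos_le_divide_eq)
  finally have steep: "2 / 3 \<le> ln (x e) - ln (y e)" unfolding ln .
  have "hsq e x y / ((x e)\<^sup>2 - (y e)\<^sup>2) \<le> (real d * \<omega>\<^sup>2 * (x e)\<^sup>2) / (3 / 4 * (x e)\<^sup>2)"
    using h q pos hsq_nonneg[of e x y] by (intro frac_le) auto
  also have "\<dots> = 2 * real d * \<omega>\<^sup>2 * (2 / 3)" using pos by simp
  also have "\<dots> \<le> 2 * real d * \<omega>\<^sup>2 * (ln (x e) - ln (y e))" by (rule mult_left_mono[OF steep]) simp
  finally show ?thesis using hdist_le_vertical[OF x y] le pos
    unfolding ln by (simp add: distrib_right)
qed

lemma hdist_le_coordinate_bound: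
  assumes x: "x \<in> U" and y: "y \<in> U" and close: "\<And>j. j < d \<Longrightarrow> \<bar>x j - y j\<bar> \<le> \<rho>" and \<rho>: "\<rho> \<le> x e / 2"
  shows "\<delta> x y \<le> 2 * real d * \<rho> / x e"
proof (rule power2_le_imp_le)
  have pos: "0 < x e" using x by (rule halfspace_pos)
  have "0 \<le> \<rho>" using close[of e] by simp
  then show "0 \<le> 2 * real d * \<rho> / x e" using pos by simp
  have "x e / 2 \<le> y e" using close[of e] \<rho> by simp
  from hcosh_le_coordinate_bound[OF x y close this]
  have "(\<delta> x y)\<^sup>2 \<le> 2 * (real d * \<rho>\<^sup>2 / (x e)\<^sup>2)"
    using cosh_ge_quadratic[of "\<delta> x y"] unfolding cosh_hdist[OF x y] by linarith
  also have "\<dots> = 2 * real d * (\<rho>\<^sup>2 / (x e)\<^sup>2)" by simp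
  also have "\<dots> \<le> (2 * real d)\<^sup>2 * (\<rho>\<^sup>2 / (x e)\<^sup>2)"
    by (intro mult_right_mono) (simp_all add: power2_eq_square)
  finally show "(\<delta> x y)\<^sup>2 \<le> (2 * real d * \<rho> / x e)\<^sup>2" by (simp add: power_mult_distrib power_divide)
qed

lemma hsq_shift_le:
  assumes "\<And>j. j < e \<Longrightarrow> \<bar>s j - x j\<bar> \<le> A" "\<And>j. j < e \<Longrightarrow> \<bar>z j - x j\<bar> \<le> B"
  shows "hsq e s z \<le> hsq e s x + real e * (2 * A * B + B\<^sup>2)"
proof -
  have "(s j - z j)\<^sup>2 \<le> (s j - x j)\<^sup>2 + (2 * A * B + B\<^sup>2)" if j: "j < e" for j
  proof -
    have "(s j - z j)\<^sup>2 = (s j - x j)\<^sup>2 - 2 * ((s j - x j) * (z j - x j)) + (z j - x j)\<^sup>2"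
      by algebra
    also have "\<dots> \<le> (s j - x j)\<^sup>2 + 2 * (\<bar>s j - x j\<bar> * \<bar>z j - x j\<bar>) + \<bar>z j - x j\<bar>\<^sup>2"
      using abs_ge_minus_self[of "(s j - x j) * (z j - x j)"] by (simp add: abs_mult)
    also have "\<bar>s j - x j\<bar> * \<bar>z j - x j\<bar> \<le> A * B" using assms[OF j] by (intro mult_mono) auto
    also have "\<bar>z j - x j\<bar>\<^sup>2 \<le> B\<^sup>2" using assms(2)[OF j] by (intro power_mono) auto
    finally show ?thesis by simp
  qed
  then have "hsq e s z \<le> (\<Sum>j<e. (s j - x j)\<^sup>2 + (2 * A * B + B\<^sup>2))"
    unfolding hsq_def by (intro sum_mono) simp
  then show ?thesis unfolding hsq_def by (simp add: sum.distrib)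
qed

lemma ln_two_hcosh:
  assumes "0 < s e" "0 < x e"
  shows "ln (2 * hcosh e s x) = ln (hsq e s x + (s e)\<^sup>2 + (x e)\<^sup>2) - ln (s e) - ln (x e)"
proof -
  have "0 < hsq e s x + (s e)\<^sup>2 + (x e)\<^sup>2"
    using hsq_nonneg[of e s x] assms by (simp add: add_nonneg_pos)
  moreover have "2 * hcosh e s x = (hsq e s x + (s e)\<^sup>2 + (x e)\<^sup>2) / (s e * x e)"
    unfolding hcosh_def using assms by (simp add: field_simps)
  ultimately show ?thesis using assms by (simp add: ln_divide_pos ln_mult_pos)
qed

text \<open>Far below \<open>s\<close>, geodesics from \<open>s\<close> are almost vertical: passing from \<open>s\<close> to \<open>x\<close> through \<open>z\<close> above \<open>x\<close> is cheap.\<close>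

lemma hdist_add_descent_le:
  assumes U: "s \<in> U" "z \<in> U" "x \<in> U" and \<kappa>: "0 \<le> \<kappa>"
    and le: "hsq e s z + (s e)\<^sup>2 + (z e)\<^sup>2 \<le> (1 + \<kappa>) * (hsq e s x + (s e)\<^sup>2 + (x e)\<^sup>2)"
  shows "\<delta> s z + (ln (z e) - ln (x e)) \<le> \<delta> s x + \<kappa> + 1 / (hcosh e s x)\<^sup>2"
proof -
  have pos: "0 < s e" "0 < z e" "0 < x e" using U halfspace_pos by auto
  have num_pos: "0 < hsq e s v + (s e)\<^sup>2 + (v e)\<^sup>2" for v
    using hsq_nonneg[of e s v] pos by (intro add_pos_nonneg add_nonneg_pos) auto
  have "ln (hsq e s z + (s e)\<^sup>2 + (z e)\<^sup>2) \<le> ln ((1 + \<kappa>) * (hsq e s x + (s e)\<^sup>2 + (x e)\<^sup>2))"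
    using le num_pos[of z] num_pos[of x] \<kappa> by (subst ln_le_cancel_iff) auto
  also have "\<dots> = ln (1 + \<kappa>) + ln (hsq e s x + (s e)\<^sup>2 + (x e)\<^sup>2)"
    using num_pos[of x] \<kappa> by (intro ln_mult_pos) auto
  also have "ln (1 + \<kappa>) \<le> \<kappa>" by (rule ln_add_one_self_le_self[OF \<kappa>])
  finally have "ln (2 * hcosh e s z) + (ln (z e) - ln (x e)) \<le> ln (2 * hcosh e s x) + \<kappa>"
    using pos by (simp add: ln_two_hcosh)
  then show ?thesis using hdist_le_ln[OF U(1,2)] hdist_ge_ln[OF U(1,3)] by linarith
qed

context
  fixes \<epsilon> \<omega> w :: real
  assumes \<epsilon>: "0 < \<epsilon>" "\<epsilon> \<le> 1" and \<omega>: "0 < \<omega>" "4096 * real d ^ 2 * \<omega> \<le> \<epsilon>" and w: "0 < w"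
begin

private lemma \<omega>_le: "\<omega> \<le> 1 / 4096" and \<omega>_sq_le: "\<omega>\<^sup>2 \<le> 1 / 4096"
proof -
  have "4096 * 1 * \<omega> \<le> 4096 * real d ^ 2 * \<omega>"
    using \<omega>(1) by (intro mult_right_mono mult_left_mono one_le_power) auto
  then show "\<omega> \<le> 1 / 4096" using \<omega>(2) \<epsilon>(2) by simp
  then show "\<omega>\<^sup>2 \<le> 1 / 4096" using \<omega>(1) mult_mono[of \<omega> "1 / 4096" \<omega> 1]
    by (simp add: power2_eq_square)
qed

lemma low_pair_far:
  assumes x: "x \<in> U" and y: "y \<in> U" and low: "x e \<le> w"
    and xy: "\<bar>x e - y e\<bar> \<le> w / 3" "i \<le> e" "w / 6 < \<bar>x i - y i\<bar>"
  shows "1 / 12 \<le> \<delta> x y"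
proof (rule hdist_ge_coordinate[OF x y xy(2)])
  have pos: "0 < x e" "0 < y e" using x y halfspace_pos by auto
  have "y e \<le> 2 * w" using low xy(1) w by linarith
  then have "x e * y e \<le> w * (2 * w)" using low pos by (intro mult_mono) auto
  moreover have "(w / 6)\<^sup>2 \<le> \<bar>x i - y i\<bar>\<^sup>2" using xy(3) w by (intro power_mono) auto
  ultimately show "(1 / 12)\<^sup>2 * (2 * x e * y e) \<le> (x i - y i)\<^sup>2" by (simp add: power2_eq_square)
qed auto

lemma low_numerator_le:
  assumes s: "w / 18 \<le> s e" "\<And>j. j < e \<Longrightarrow> \<bar>s j - x j\<bar> \<le> 3 * real d * w"
    and z: "z e = \<omega> * w" "\<And>j. j < e \<Longrightarrow> \<bar>z j - x j\<bar> \<le> \<omega>\<^sup>2 * w"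
  shows "hsq e s z + (s e)\<^sup>2 + (z e)\<^sup>2
    \<le> (1 + 2592 * (real d ^ 2 * \<omega>\<^sup>2)) * (hsq e s x + (s e)\<^sup>2 + (x e)\<^sup>2)"
proof -
  let ?\<eta> = "real d ^ 2 * \<omega>\<^sup>2" and ?N = "hsq e s x + (s e)\<^sup>2 + (x e)\<^sup>2"
  have "(w / 18)\<^sup>2 \<le> (s e)\<^sup>2" using s(1) w by (intro power_mono) auto
  then have "w\<^sup>2 \<le> 324 * (s e)\<^sup>2" by (simp add: power_divide)
  also have "324 * (s e)\<^sup>2 \<le> 324 * ?N"
    using hsq_nonneg[of e s x] by (intro mult_left_mono) (auto simp: add_nonneg_nonneg)
  finally have wN: "w\<^sup>2 \<le> 324 * ?N" .
  have "(\<omega>\<^sup>2 * w)\<^sup>2 \<le> (\<omega>\<^sup>2 * w) * (real d * w)"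
    unfolding power2_eq_square[of "\<omega>\<^sup>2 * w"]
    using \<omega>_sq_le w by (intro mult_left_mono mult_right_mono) auto
  then have "2 * (3 * real d * w) * (\<omega>\<^sup>2 * w) + (\<omega>\<^sup>2 * w)\<^sup>2 \<le> 7 * (real d * \<omega>\<^sup>2 * w\<^sup>2)"
    by (simp add: power2_eq_square mult_ac del: of_nat_Suc)
  then have "real e * (2 * (3 * real d * w) * (\<omega>\<^sup>2 * w) + (\<omega>\<^sup>2 * w)\<^sup>2) \<le> real d * (7 * (real d * \<omega>\<^sup>2 * w\<^sup>2))"
    using w by (intro mult_mono) auto
  also have "\<dots> = 7 * ?\<eta> * w\<^sup>2" by (simp add: power2_eq_square del: of_nat_Suc)
  finally have "hsq e s z \<le> hsq e s x + 7 * ?\<eta> * w\<^sup>2"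
    using hsq_shift_le[of s x _ z, OF s(2) z(2)] by linarith
  moreover have "1 * (\<omega>\<^sup>2 * w\<^sup>2) \<le> real d ^ 2 * (\<omega>\<^sup>2 * w\<^sup>2)"
    by (intro mult_right_mono one_le_power) auto
  then have "(z e)\<^sup>2 \<le> ?\<eta> * w\<^sup>2" unfolding z(1) by (simp add: power_mult_distrib mult.assoc)
  ultimately have "hsq e s z + (s e)\<^sup>2 + (z e)\<^sup>2 \<le> ?N + 8 * ?\<eta> * w\<^sup>2"
    using zero_le_power2[of "x e"] by linarith
  also have "8 * ?\<eta> * w\<^sup>2 \<le> 8 * ?\<eta> * (324 * ?N)" using wN by (intro mult_left_mono) auto
  finally show ?thesis by (simp add: algebra_simps)
qed

lemma low_hcosh_large:
  assumes "s \<in> U" "x \<in> U" and s: "w / 18 \<le> s e" and x: "x e \<le> 2 * \<omega>\<^sup>2 * w"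
  shows "1 / (hcosh e s x)\<^sup>2 \<le> 5184 * \<omega>\<^sup>2"
proof -
  have pos: "0 < s e" "0 < x e" using assms(1,2) halfspace_pos by auto
  have "w / 18 / (4 * \<omega>\<^sup>2 * w) \<le> s e / (2 * x e)"
    using s x pos w by (intro frac_le) (auto simp: mult_ac)
  also have "\<dots> = (s e)\<^sup>2 / (2 * s e * x e)" using pos by (simp add: power2_eq_square)
  also have "\<dots> \<le> hcosh e s x" unfolding hcosh_def
    using hsq_nonneg[of e s x] pos by (intro divide_right_mono) auto
  finally have "1 / (72 * \<omega>\<^sup>2) \<le> hcosh e s x" using w by simp
  then have "1 / (hcosh e s x)\<^sup>2 \<le> 1 / (1 / (72 * \<omega>\<^sup>2))\<^sup>2"
    using \<omega> hcosh_ge_1[of s e x] pos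
    by (intro divide_left_mono power_mono mult_pos_pos zero_less_power) auto
  also have "\<dots> = 5184 * \<omega>\<^sup>2 * \<omega>\<^sup>2" by (simp add: power2_eq_square)
  also have "\<dots> \<le> 5184 * \<omega>\<^sup>2 * 1" using \<omega>_sq_le by (intro mult_left_mono) auto
  finally show ?thesis by simp
qed

lemma low_anchor_detour:
  assumes U: "s \<in> U" "z \<in> U" "x \<in> U" "y \<in> U"
    and s: "w / 18 \<le> s e" "\<And>j. j < e \<Longrightarrow> \<bar>s j - x j\<bar> \<le> 3 * real d * w"
    and z: "z e = \<omega> * w" "\<And>j. j < e \<Longrightarrow> \<bar>z j - x j\<bar> \<le> \<omega>\<^sup>2 * w" and x: "x e \<le> 2 * \<omega>\<^sup>2 * w"
    and xy: "\<bar>x e - y e\<bar> \<le> w / 3" "i \<le> e" "w / 6 < \<bar>x i - y i\<bar>" and sx: "\<delta> s x \<le> 2 * \<delta> x y"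
  shows "\<delta> s z + (1 + 2 * real d * \<omega>\<^sup>2) * (ln (z e) - ln (x e)) \<le> \<delta> s x + \<epsilon> / 4 * \<delta> x y"
proof -
  define \<eta> D where "\<eta> = real d ^ 2 * \<omega>\<^sup>2" and "D = \<delta> x y"
  have pos: "0 < s e" "0 < x e" using U halfspace_pos by auto
  have \<omega>w: "\<omega>\<^sup>2 * w \<le> 1 / 4096 * w" "\<omega> * w \<le> 1 / 4096 * w"
    using \<omega>_sq_le \<omega>_le w by (intro mult_right_mono; simp)+
  have D: "1 / 12 \<le> D" unfolding D_def
    by (rule low_pair_far[OF U(3,4) _ xy]) (use x \<omega>w w in linarith)
  have "real d \<le> real d ^ 2" "1 \<le> real d ^ 2"
    by (simp_all add: self_le_power one_le_power del: of_nat_Suc)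
  then have \<eta>: "0 \<le> \<eta>" "real d * \<omega>\<^sup>2 \<le> \<eta>" "\<omega>\<^sup>2 \<le> \<eta>"
    unfolding \<eta>_def using mult_right_mono[of 1 "real d ^ 2" "\<omega>\<^sup>2"] by (auto intro: mult_right_mono)
  have "real d ^ 2 * \<omega> * \<omega> \<le> \<epsilon> / 4096 * (1 / 4096)" using \<omega> \<omega>_le \<epsilon> by (intro mult_mono) auto
  then have \<eta>\<epsilon>: "\<eta> \<le> \<epsilon> / 4096 / 4096" unfolding \<eta>_def by (simp add: power2_eq_square)
  have "\<delta> s z + (ln (z e) - ln (x e)) \<le> \<delta> s x + 2592 * \<eta> + 1 / (hcosh e s x)\<^sup>2"
    using \<eta>(1) low_numerator_le[of s x z, OF s z, folded \<eta>_def]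
    by (intro hdist_add_descent_le U) auto
  also have "\<dots> \<le> \<delta> s x + 7776 * \<eta>" using low_hcosh_large[OF U(1,3) s(1) x] \<eta>(3) by linarith
  finally have descent: "\<delta> s z + (ln (z e) - ln (x e)) \<le> \<delta> s x + 7776 * \<eta>" .
  have "z e \<le> s e" "x e \<le> s e" using s(1) z(1) x \<omega>w w by linarith+
  then have "ln (z e) - ln (x e) \<le> ln (s e / x e)"
    using pos z(1) \<omega>(1) w by (simp add: ln_divide_pos)
  also have "\<dots> \<le> \<delta> s x" by (rule hdist_ge_vertical[OF U(1,3) \<open>x e \<le> s e\<close>])
  finally have "2 * real d * \<omega>\<^sup>2 * (ln (z e) - ln (x e)) \<le> 2 * real d * \<omega>\<^sup>2 * (2 * D)"
    using sx unfolding D_def by (intro mult_left_mono) auto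
  also have "\<dots> \<le> 2 * \<eta> * (2 * D)" using \<eta>(2) D
    by (intro mult_right_mono) (auto simp del: of_nat_Suc)
  finally have steep: "2 * real d * \<omega>\<^sup>2 * (ln (z e) - ln (x e)) \<le> 4 * \<eta> * D" by simp
  have "7776 * \<eta> + 4 * \<eta> * D \<le> (7776 * 12 + 4) * \<eta> * D"
    using D \<eta>(1) mult_left_mono[of "1 / 12" D "7776 * 12 * \<eta>"] by (simp add: algebra_simps)
  also have "\<dots> \<le> \<epsilon> / 4 * D" using \<eta>\<epsilon> D \<epsilon> by (intro mult_right_mono) auto
  finally show ?thesis using descent steep unfolding D_def distrib_right mult_1 by linarith
qed

lemma high_pair_far:
  assumes x: "x \<in> U" and y: "y \<in> U" and high: "\<omega>\<^sup>2 * w < x e"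
    and xy: "\<bar>x e - y e\<bar> \<le> w / 3" "i \<le> e" "w / 6 < \<bar>x i - y i\<bar>"
  shows "\<omega> * (\<omega>\<^sup>2 * w / x e) / 12 \<le> \<delta> x y"
proof (rule hdist_ge_coordinate[OF x y xy(2)])
  have pos: "0 < x e" "0 < y e" using x y halfspace_pos by auto
  define r where "r = \<omega>\<^sup>2 * w / x e"
  have r: "0 < r" "r \<le> 1" and rx: "r * x e = \<omega>\<^sup>2 * w" unfolding r_def using \<omega> w pos high by auto
  have "\<omega> * r \<le> 1 * 1" using \<omega>_le r \<omega> by (intro mult_mono) auto
  then show "0 \<le> \<omega> * (\<omega>\<^sup>2 * w / x e) / 12" "\<omega> * (\<omega>\<^sup>2 * w / x e) / 12 \<le> 1"
    unfolding r_def[symmetric] using \<omega> r by auto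
  have "\<omega>\<^sup>2 * y e \<le> \<omega>\<^sup>2 * (x e + w / 3)" by (intro mult_left_mono) (use xy(1) in \<open>linarith, simp\<close>)
  also have "\<dots> = \<omega>\<^sup>2 * x e + (\<omega>\<^sup>2 * w) / 3" by (simp add: algebra_simps)
  also have "\<dots> \<le> (1 / 4096) * x e + x e / 3"
    using \<omega>_sq_le pos high by (intro add_mono mult_right_mono) auto
  finally have ye: "\<omega>\<^sup>2 * y e \<le> x e" using pos by simp
  have "(\<omega> * r / 12)\<^sup>2 * (2 * x e * y e) = r * (r * x e) * (\<omega>\<^sup>2 * y e) / 72"
    by (simp add: power2_eq_square)
  also have "\<dots> \<le> r * (r * x e) * x e / 72"
    using r pos ye by (intro divide_right_mono mult_left_mono) auto
  also have "\<dots> = (r * x e) * (r * x e) / 72" by simp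
  also have "\<dots> \<le> (1 * w) * (1 * w) / 72"
    unfolding rx using \<omega>_sq_le w by (intro divide_right_mono mult_mono) auto
  also have "\<dots> \<le> (w / 6)\<^sup>2" by (simp add: power2_eq_square)
  also have "\<dots> \<le> \<bar>x i - y i\<bar>\<^sup>2" using xy(3) w by (intro power_mono) auto
  finally show "(\<omega> * (\<omega>\<^sup>2 * w / x e) / 12)\<^sup>2 * (2 * x e * y e) \<le> (x i - y i)\<^sup>2"
    unfolding r_def by simp
qed

lemma high_near_le:
  assumes U: "x \<in> U" "x' \<in> U" "y \<in> U" and high: "\<omega>\<^sup>2 * w < x e"
    and near: "\<And>j. j < d \<Longrightarrow> \<bar>x' j - x j\<bar> \<le> \<omega> ^ 4 * w"
    and xy: "\<bar>x e - y e\<bar> \<le> w / 3" "i \<le> e" "w / 6 < \<bar>x i - y i\<bar>"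
  shows "\<delta> x' x \<le> \<epsilon> / 16 * \<delta> x y"
proof -
  interpret metric_on U \<delta> by (rule metric_on_halfspace)
  have "\<omega> ^ 4 * w = \<omega>\<^sup>2 * (\<omega>\<^sup>2 * w)" by (simp add: power2_eq_square power4_eq_xxxx)
  also have "\<dots> \<le> 1 / 4096 * x e" using \<omega>_sq_le \<omega> w high by (intro mult_mono) auto
  finally have "\<delta> x x' \<le> 2 * real d * (\<omega> ^ 4 * w) / x e"
    using near halfspace_pos[OF U(1)]
    by (intro hdist_le_coordinate_bound U) (auto simp: abs_minus_commute)
  also have "\<dots> = 24 * real d * \<omega> * (\<omega> * (\<omega>\<^sup>2 * w / x e) / 12)"
    by (simp add: power2_eq_square power4_eq_xxxx del: of_nat_Suc)
  also have "\<dots> \<le> 24 * real d * \<omega> * \<delta> x y"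
    using \<omega> high_pair_far[OF U(1,3) high xy] by (intro mult_left_mono) auto
  also have "\<dots> \<le> \<epsilon> / 16 * \<delta> x y"
  proof (rule mult_right_mono)
    have "real d * \<omega> \<le> real d ^ 2 * \<omega>" using \<omega> by (intro mult_right_mono self_le_power) auto
    then show "24 * real d * \<omega> \<le> \<epsilon> / 16" using \<omega>(2) \<epsilon> by linarith
  qed (rule nonneg[OF U(1,3)])
  finally show ?thesis using sym[OF U(1,2)] by simp
qed

end

text \<open>At height \<open>2 ^ n * w\<close> the horizontal displacements within a cube of side \<open>w\<close> are at most the fraction
  \<open>1 / 2 ^ n\<close> of the height, so that the way down from the anchor is steep.\<close>

definition cube_anchor :: "nat \<Rightarrow> real \<Rightarrow> (nat \<Rightarrow> real) \<Rightarrow> nat \<Rightarrow> real" where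
  "cube_anchor n w c = (\<lambda>i. if i < e then c i else if i = e then 2 ^ n * w else 0)"

lemma cube_anchor_in_halfspace: "0 < w \<Longrightarrow> cube_anchor n w c \<in> U"
  unfolding halfspace_def cube_anchor_def by simp

lemma cube_anchor_height: "cube_anchor n w c e = 2 ^ n * w"
  unfolding cube_anchor_def by simp

lemma cube_anchor_close: "p \<in> cube d c w \<Longrightarrow> j < e \<Longrightarrow> \<bar>cube_anchor n w c j - p j\<bar> \<le> w"
  using abs_diff_cube_corner[of p d c w j]
  unfolding cube_anchor_def by (simp add: abs_minus_commute)

lemma hdist_cube_anchor_le:
  assumes w: "0 < w" and y: "y \<in> U" and le: "2 * y e \<le> 2 ^ n * w"
    and close: "\<And>j. j < e \<Longrightarrow> \<bar>c j - y j\<bar> \<le> w"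
  shows "\<delta> (cube_anchor n w c) y \<le> (1 + 2 * real d * (1 / 2 ^ n)\<^sup>2) * (ln (2 ^ n * w) - ln (y e))"
proof -
  have "\<bar>cube_anchor n w c j - y j\<bar> \<le> 1 / 2 ^ n * (2 ^ n * w)" if "j < e" for j
    using close[OF that] that by (simp add: cube_anchor_def)
  then show ?thesis
    using hdist_le_steep[OF cube_anchor_in_halfspace[OF w] y, of n c "1 / 2 ^ n"] le
    unfolding cube_anchor_height by blast
qed

context
  fixes \<epsilon> :: real and n :: nat
  assumes \<epsilon>: "0 < \<epsilon>" "\<epsilon> \<le> 1" and n: "4096 * real d ^ 2 / \<epsilon> \<le> 2 ^ n"
begin

private abbreviation (input) "\<omega> \<equiv> 1 / 2 ^ n :: real"
private abbreviation (input) "rate \<equiv> 1 + 2 * real d * \<omega>\<^sup>2"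

private lemma \<omega>_pos: "0 < \<omega>" and \<omega>_small: "4096 * real d ^ 2 * \<omega> \<le> \<epsilon>"
  using n \<epsilon> by (simp_all add: field_simps del: of_nat_Suc)

private lemma subcube_side: "w / 2 ^ (2 * n) = \<omega>\<^sup>2 * w" "w / 2 ^ (4 * n) = \<omega> ^ 4 * w"
  by (simp_all add: power_divide power_mult mult.commute[of _ n])

lemma cube_anchor_chain:
  assumes w: "0 < w'" "2 * w' \<le> w" and p: "p \<in> cube d c w" "p \<in> cube d c' w'"
  shows "\<delta> (cube_anchor n w c) (cube_anchor n w' c') \<le> rate * ln (2 ^ n * w) - rate * ln (2 ^ n * w')"
proof -
  have "\<bar>c j - cube_anchor n w' c' j\<bar> \<le> w" if "j < e" for j
    using w p that unfolding cube_def cube_anchor_def by (smt (verit) less_SucI mem_Collect_eq)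
  then have "\<delta> (cube_anchor n w c) (cube_anchor n w' c') \<le> rate * (ln (2 ^ n * w) - ln (cube_anchor n w' c' e))"
    using w by (intro hdist_cube_anchor_le) (auto simp: cube_anchor_height intro: cube_anchor_in_halfspace)
  then show ?thesis unfolding cube_anchor_height by (simp only: right_diff_distrib)
qed

lemma cube_anchor_end:
  assumes w: "0 < w" and p: "p \<in> U" "p \<in> cube d c w" and low: "c e \<le> w"
  shows "\<delta> (cube_anchor n w c) p \<le> rate * ln (2 ^ n * w) - rate * ln (p e)"
proof -
  have "4096 * 1 / 1 \<le> 4096 * real d ^ 2 / \<epsilon>"
    using \<epsilon> by (intro frac_le mult_left_mono one_le_power) auto
  then have "4 * w \<le> 2 ^ n * w" using n w by (intro mult_right_mono) auto
  moreover have "p e \<le> c e + w" using p(2) unfolding cube_def by auto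
  ultimately have "2 * p e \<le> 2 ^ n * w" using low by linarith
  then have "\<delta> (cube_anchor n w c) p \<le> rate * (ln (2 ^ n * w) - ln (p e))"
    using w p abs_diff_cube_corner[of p d c w]
    by (intro hdist_cube_anchor_le) (auto simp: abs_minus_commute)
  then show ?thesis by (simp only: right_diff_distrib)
qed

lemma cube_pair_coordinates:
  assumes "cube_pair d c w p q"
  obtains i where "\<bar>p e - q e\<bar> \<le> w / 3" "i \<le> e" "w / 6 < \<bar>p i - q i\<bar>"
  using assms unfolding cube_pair_def by (auto simp: less_Suc_eq_le)

lemma cube_low_detour:
  assumes w: "0 < w" and pq: "p \<in> U" "q \<in> U" "cube_pair d c w p q"
    and s: "s \<in> hyp_net_region c w" "\<delta> s p \<le> 2 * \<delta> p q"
    and low: "p \<in> cube d c' (w / 2 ^ (2 * n))" "c' e \<le> w / 2 ^ (2 * n)"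
  shows "\<delta> s (cube_anchor n (w / 2 ^ (2 * n)) c') + (rate * ln (2 ^ n * (w / 2 ^ (2 * n))) - rate * ln (p e))
    \<le> \<delta> s p + \<epsilon> / 4 * \<delta> p q"
proof -
  let ?z = "cube_anchor n (w / 2 ^ (2 * n)) c'"
  obtain i where i: "\<bar>p e - q e\<bar> \<le> w / 3" "i \<le> e" "w / 6 < \<bar>p i - q i\<bar>"
    using pq(3) by (rule cube_pair_coordinates)
  have sU: "s \<in> U" "w / 18 \<le> s e" and near: "\<And>j. j < d \<Longrightarrow> \<bar>s j - c j\<bar> \<le> 2 * real d * w"
    using s(1) unfolding hyp_net_region_def by auto
  have "\<delta> s ?z + rate * (ln (?z e) - ln (p e)) \<le> \<delta> s p + \<epsilon> / 4 * \<delta> p q"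
  proof (rule low_anchor_detour[OF \<epsilon> \<omega>_pos \<omega>_small w sU(1) _ pq(1,2) sU(2) _ _ _ _ i s(2)])
    show "?z \<in> U" using w by (intro cube_anchor_in_halfspace) simp
    show "\<bar>s j - p j\<bar> \<le> 3 * real d * w" if "j < e" for j
    proof -
      have "\<bar>p j - c j\<bar> \<le> w" "1 * w \<le> real d * w"
        using w pq(3) that abs_diff_cube_corner[of p d c w j] unfolding cube_pair_def by auto
      then show ?thesis using near[of j] that by linarith
    qed
    show "?z e = \<omega> * w" unfolding cube_anchor_height subcube_side by (simp add: power2_eq_square)
    show "\<bar>?z j - p j\<bar> \<le> \<omega>\<^sup>2 * w" if "j < e" for j
      using cube_anchor_close[OF low(1) that] unfolding subcube_side .
    show "p e \<le> 2 * \<omega>\<^sup>2 * w" using low unfolding subcube_side cube_def by auto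
  qed
  then show ?thesis unfolding cube_anchor_height by (simp only: right_diff_distrib)
qed

lemma cube_high_near:
  assumes w: "0 < w" and pq: "p \<in> U" "q \<in> U" "cube_pair d c w p q"
    and high: "p \<in> cube d c' (w / 2 ^ (2 * n))" "\<not> c' e \<le> w / 2 ^ (2 * n)"
    and p': "p' \<in> U" "\<And>j. j < d \<Longrightarrow> \<bar>p' j - p j\<bar> \<le> w / 2 ^ (4 * n)"
  shows "\<delta> p' p \<le> \<epsilon> / 16 * \<delta> p q"
proof -
  obtain i where i: "\<bar>p e - q e\<bar> \<le> w / 3" "i \<le> e" "w / 6 < \<bar>p i - q i\<bar>"
    using pq(3) by (rule cube_pair_coordinates)
  have "\<omega>\<^sup>2 * w < p e" using high unfolding subcube_side cube_def by auto
  then show ?thesis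
    by (rule high_near_le[OF \<epsilon> \<omega>_pos \<omega>_small w pq(1) p'(1) pq(2) _ p'(2)[unfolded subcube_side] i])
qed

theorem halfspace_has_spanners:
  "has_spanners U \<delta> (1 + \<epsilon>)
    (2 ^ d * (25 * real d * (1200 * real d ^ 2 / sqrt \<epsilon> + 2) ^ e * (3 * real (4 * n) + 10)))"
proof -
  define K where "K = 25 * real d * (1200 * real d ^ 2 / sqrt \<epsilon> + 2) ^ e"
  have "1 * 1 \<le> 25 * real d * (1200 * real d ^ 2 / sqrt \<epsilon> + 2) ^ e"
    using \<epsilon> by (intro mult_mono one_le_power) auto
  then have K: "1 \<le> K" unfolding K_def by simp
  have "\<exists>net. \<forall>w c. 0 < w \<longrightarrow> net w c \<subseteq> hyp_net_region c w \<and> finite (net w c) \<and> real (card (net w c)) \<le> K \<and>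
      detour_net d U \<delta> \<epsilon> c w (net w c)"
    using ex_hyp_detour_net[OF \<epsilon>, folded K_def] by metis
  then obtain net where net: "\<And>w c. 0 < w \<Longrightarrow> net w c \<subseteq> hyp_net_region c w" "\<And>w c. 0 < w \<Longrightarrow> finite (net w c)"
    "\<And>w c. 0 < w \<Longrightarrow> real (card (net w c)) \<le> K" "\<And>w c. 0 < w \<Longrightarrow> detour_net d U \<delta> \<epsilon> c w (net w c)"
    by metis
  interpret metric_on U \<delta> by (rule metric_on_halfspace)
  interpret cube_routing U \<delta> d net "\<lambda>w c. c e \<le> w" "cube_anchor n" "\<lambda>w. rate * ln (2 ^ n * w)"
    "\<lambda>p. rate * ln (p e)" "2 * n" "4 * n" K \<epsilon>
  proof
    show "net w c \<subseteq> U" if "0 < w" for w c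
      using net(1)[OF that] unfolding hyp_net_region_def by blast
    show "\<delta> (cube_anchor n w c) (cube_anchor n w' c') \<le> rate * ln (2 ^ n * w) - rate * ln (2 ^ n * w')"
      if "0 < w'" "2 * w' \<le> w" "p \<in> cube d c w" "p \<in> cube d c' w'" for w w' c c' p
      using that by (rule cube_anchor_chain)
    show "\<delta> (cube_anchor n w c) p \<le> rate * ln (2 ^ n * w) - rate * ln (p e)"
      if "0 < w" "p \<in> U" "p \<in> cube d c w" "c e \<le> w" for w c p
      using that by (rule cube_anchor_end)
    fix w c c' p q
    assume pq: "0 < w" "p \<in> U" "q \<in> U" "cube_pair d c w p q"
      and p: "p \<in> cube d c' (w / 2 ^ (2 * n))"
    show "\<delta> s (cube_anchor n (w / 2 ^ (2 * n)) c') + (rate * ln (2 ^ n * (w / 2 ^ (2 * n))) - rate * ln (p e))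
        \<le> \<delta> s p + \<epsilon> / 4 * \<delta> p q"
      if "s \<in> net w c" "\<delta> s p \<le> 2 * \<delta> p q" "c' e \<le> w / 2 ^ (2 * n)" for s
      by (rule cube_low_detour[OF pq subsetD[OF net(1)[OF pq(1)] that(1)] that(2) p that(3)])
    show "\<delta> p' p \<le> \<epsilon> / 16 * \<delta> p q"
      if "\<not> c' e \<le> w / 2 ^ (2 * n)" "p' \<in> U" "\<And>j. j < d \<Longrightarrow> \<bar>p' j - p j\<bar> \<le> w / 2 ^ (4 * n)" for p'
      by (rule cube_high_near[OF pq p that])
  qed (use \<epsilon> K net(2-4) in \<open>auto intro: halfspace_coordinates cube_anchor_in_halfspace\<close>)
  show ?thesis using has_spanners unfolding K_def .
qed

end

end

lemma hyp_has_spanners: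
  assumes d: "1 \<le> d" and \<epsilon>: "0 < \<epsilon>" "\<epsilon> \<le> 1" and n: "4096 * real d ^ 2 / \<epsilon> \<le> 2 ^ n"
  shows "has_spanners (model_carrier Hyp d) (model_dist Hyp d) (1 + \<epsilon>)
    (2 ^ d * (25 * real d * (1200 * real d ^ 2 / sqrt \<epsilon> + 2) ^ (d - 1) * (3 * real (4 * n) + 10)))"
proof -
  obtain e where e: "d = Suc e" using d by (cases d) auto
  have "has_spanners (model_carrier Hyp (Suc e)) (model_dist Hyp (Suc e)) (1 + \<epsilon>)
    (2 ^ Suc e * (25 * real (Suc e) * (1200 * real (Suc e) ^ 2 / sqrt \<epsilon> + 2) ^ e * (3 * real (4 * n) + 10)))"
  proof (rule has_spanners_isometric[OF halfspace_has_spanners[OF \<epsilon> n[unfolded e]]])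
    show "to_hyp e u \<in> model_carrier Hyp (Suc e)" if "u \<in> halfspace e" for u
      using that by (rule to_hyp_carrier)
    show "from_hyp e x \<in> halfspace e \<and> to_hyp e (from_hyp e x) = x" if "x \<in> model_carrier Hyp (Suc e)" for x
      using that from_hyp_halfspace to_hyp_from_hyp by blast
  qed (use \<epsilon> to_hyp_dist hdist_nonneg in simp_all)
  then show ?thesis unfolding e by simp
qed

section \<open>Passing to the quotient\<close>

lemma model_dist_nonneg:
  assumes "x \<in> model_carrier k d" "y \<in> model_carrier k d"
  shows "0 \<le> model_dist k d x y"
proof (cases k)
  case Sph
  then show ?thesis using sph_dist_nonneg assms by blast
next
  case Euc
  then show ?thesis by (simp add: sum_nonneg)
next
  case Hyp
  have "1 \<le> mink d x y" using assms unfolding Hyp by (rule hyp_mink_ge_1)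
  then show ?thesis unfolding Hyp hyp_dist by (rule arcosh_nonneg_real)
qed

context
  fixes k :: geom and d :: nat and G :: "((nat \<Rightarrow> real) \<Rightarrow> nat \<Rightarrow> real) set"
  assumes G: "fin_isom_group k d G"
begin

private abbreviation (input) "X \<equiv> model_carrier k d"
private abbreviation (input) "\<rho> \<equiv> model_dist k d"

private lemma finite_G: "finite G" and id_in_G: "restrict id X \<in> G" and G_extensional: "G \<subseteq> X \<rightarrow>\<^sub>E X"
  and compose_in_G: "g \<in> G \<Longrightarrow> h \<in> G \<Longrightarrow> compose X g h \<in> G" and bij_G: "g \<in> G \<Longrightarrow> bij_betw g X X"
  using G unfolding fin_isom_group_def Let_def by auto

lemma mem_orbit_self: "x \<in> X \<Longrightarrow> x \<in> orbit G x"
  unfolding orbit_def using id_in_G by (intro image_eqI[of _ _ "restrict id X"]) auto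

lemma orbit_absorb:
  assumes x: "x \<in> X" and g: "g \<in> G"
  shows "orbit G (g x) = orbit G x"
proof -
  let ?c = "\<lambda>h. compose X h g"
  have "inj_on ?c G"
  proof (rule inj_onI)
    fix h h' assume h: "h \<in> G" "h' \<in> G" "?c h = ?c h'"
    show "h = h'"
    proof (rule PiE_ext[of h X "\<lambda>_. X" h'])
      show "h \<in> X \<rightarrow>\<^sub>E X" "h' \<in> X \<rightarrow>\<^sub>E X" using h G_extensional by auto
      fix y assume "y \<in> X"
      then obtain z where z: "z \<in> X" "y = g z" using bij_G[OF g] unfolding bij_betw_def by blast
      then show "h y = h' y" using fun_cong[OF h(3), of z] by (simp add: compose_def)
    qed
  qed
  then have surj: "?c ` G = G" using finite_G compose_in_G[OF _ g] by (intro endo_inj_surj) auto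
  have "orbit G (g x) = (\<lambda>f. f x) ` ?c ` G"
    unfolding orbit_def image_image using x by (simp add: compose_def)
  also have "\<dots> = orbit G x" unfolding surj orbit_def ..
  finally show ?thesis .
qed

lemma mem_quot_carrier:
  assumes "A \<in> quot_carrier k d G" "x \<in> A"
  shows "x \<in> X" "orbit G x = A"
proof -
  obtain y g where y: "y \<in> X" "A = orbit G y" and g: "g \<in> G" "x = g y"
    using assms unfolding quot_carrier_def orbit_def by blast
  show "orbit G x = A" unfolding g(2) y(2) by (rule orbit_absorb[OF y(1) g(1)])
  show "x \<in> X" using bij_G[OF g(1)] y(1) g(2) by (simp add: bij_betwE)
qed

lemma finite_quot_carrier: "A \<in> quot_carrier k d G \<Longrightarrow> finite A"
  and card_quot_carrier: "A \<in> quot_carrier k d G \<Longrightarrow> card A \<le> card G"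
  and quot_carrier_nonempty: "A \<in> quot_carrier k d G \<Longrightarrow> A \<noteq> {}"
  unfolding quot_carrier_def using mem_orbit_self finite_G card_image_le[OF finite_G]
  by (auto simp: orbit_def)

lemma quot_dist_orbit_le:
  assumes "x \<in> X" "y \<in> X"
  shows "quot_dist k d (orbit G x) (orbit G y) \<le> \<rho> x y"
  unfolding quot_dist_def
proof (rule Min_le)
  show "finite ((\<lambda>(a, b). \<rho> a b) ` (orbit G x \<times> orbit G y))"
    unfolding orbit_def using finite_G by simp
  show "\<rho> x y \<in> (\<lambda>(a, b). \<rho> a b) ` (orbit G x \<times> orbit G y)"
    using assms mem_orbit_self by (intro image_eqI[of _ _ "(x, y)"]) auto
qed

lemma quot_dist_attained:
  assumes "A \<in> quot_carrier k d G" "B \<in> quot_carrier k d G"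
  obtains a b where "a \<in> A" "b \<in> B" "quot_dist k d A B = \<rho> a b"
proof -
  have "quot_dist k d A B \<in> (\<lambda>(a, b). \<rho> a b) ` (A \<times> B)"
    unfolding quot_dist_def using assms finite_quot_carrier quot_carrier_nonempty
    by (intro Min_in) auto
  then show thesis using that by auto
qed

lemma card_Union_quot_carrier:
  assumes "finite P" "P \<subseteq> quot_carrier k d G"
  shows "card (\<Union>P) \<le> card P * card G"
proof -
  have "card (\<Union>P) \<le> (\<Sum>A\<in>P. card A)" using card_UN_le[OF assms(1), of id] by simp
  also have "\<dots> \<le> (\<Sum>A\<in>P. card G)" using assms(2) card_quot_carrier by (intro sum_mono) auto
  finally show ?thesis by simp
qed

lemma quotient_steiner_spanner:
  assumes P: "finite P" "P \<subseteq> quot_carrier k d G" and E: "finite E" "E \<subseteq> edges_on X"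
    and conn: "\<And>p q. p \<in> \<Union>P \<Longrightarrow> q \<in> \<Union>P \<Longrightarrow> connected_within \<rho> E p q (t * \<rho> p q)"
  shows "steiner_spanner (quot_carrier k d G) (quot_dist k d) t P (P \<union> orbit G ` \<Union>E)
      {e \<in> image (orbit G) ` E. card e = 2}"
    (is "steiner_spanner _ _ _ _ ?V ?E")
  unfolding steiner_spanner_def
proof (intro conjI ballI)
  have ends: "x \<in> X \<and> y \<in> X" if "{x, y} \<in> E" for x y
    using subsetD[OF E(2) that] by (simp add: doubleton_in_edges_on)
  have E_sub: "e \<subseteq> X" "finite e" if "e \<in> E" for e
    using subsetD[OF E(2) that] unfolding edges_on_def by auto
  show "finite ?V" using P(1) E(1) E_sub(2) by auto
  show "?V \<subseteq> quot_carrier k d G" using P(2) E_sub(1) unfolding quot_carrier_def by blast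
  show "?E \<subseteq> {{u, v} | u v. u \<in> ?V \<and> v \<in> ?V \<and> u \<noteq> v}"
  proof
    fix e' assume "e' \<in> ?E"
    then obtain e where e: "e \<in> E" "e' = orbit G ` e" and "card e' = 2" by auto
    then obtain u v where uv: "e' = {u, v}" "u \<noteq> v" unfolding card_2_iff by blast
    have "e' \<subseteq> ?V" unfolding e(2) using e(1) by auto
    then have "u \<in> ?V" "v \<in> ?V" unfolding uv(1) by simp_all
    then show "e' \<in> {{u, v} | u v. u \<in> ?V \<and> v \<in> ?V \<and> u \<noteq> v}"
      using uv by (intro CollectI exI[of _ u] exI[of _ v] conjI)
  qed
  fix p q assume pq: "p \<in> P" "q \<in> P"
  then have cells: "p \<in> quot_carrier k d G" "q \<in> quot_carrier k d G" using P(2) by auto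
  then obtain a b where ab: "a \<in> p" "b \<in> q" "quot_dist k d p q = \<rho> a b" by (rule quot_dist_attained)
  have "connected_within (quot_dist k d) ?E (orbit G a) (orbit G b) (t * \<rho> a b)"
  proof (rule connected_within_map[where f = "orbit G" and E = E and \<delta> = \<rho>])
    show "connected_within \<rho> E a b (t * \<rho> a b)" using pq ab by (intro conn) auto
    show "{orbit G x, orbit G y} \<in> ?E" if "{x, y} \<in> E" "orbit G x \<noteq> orbit G y" for x y
      using imageI[OF that(1), of "image (orbit G)"] that(2) by simp
    show "quot_dist k d (orbit G x) (orbit G y) \<le> \<rho> x y" "0 \<le> \<rho> x y" if "{x, y} \<in> E" for x y
      using ends[OF that] quot_dist_orbit_le model_dist_nonneg by auto
  qed
  then show "\<exists>xs. is_walk ?E xs p q \<and> walk_weight (quot_dist k d) xs \<le> t * quot_dist k d p q"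
    unfolding mem_quot_carrier(2)[OF cells(1) ab(1)] mem_quot_carrier(2)[OF cells(2) ab(2)] ab(3)
    by (rule walk_of_connected_within)
qed simp

lemma ex_quotient_steiner_spanner:
  assumes sp: "has_spanners X \<rho> t B" and B: "0 \<le> B" and P: "finite P" "P \<subseteq> quot_carrier k d G"
  shows "\<exists>V E. steiner_spanner (quot_carrier k d G) (quot_dist k d) t P V E \<and>
    real (card E) \<le> B * real (card P) * real (card G)"
proof -
  have "finite (\<Union>P)" "\<Union>P \<subseteq> X" using P finite_quot_carrier mem_quot_carrier(1) by blast+
  from sp[unfolded has_spanners_def, rule_format, OF this] obtain E
    where E: "E \<subseteq> edges_on X" "finite E" "real (card E) \<le> B * real (card (\<Union>P))"
    and conn: "\<forall>p\<in>\<Union>P. \<forall>q\<in>\<Union>P. connected_within \<rho> E p q (t * \<rho> p q)"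
    by (elim exE conjE)
  let ?E = "{e \<in> image (orbit G) ` E. card e = 2}"
  have "card ?E \<le> card (image (orbit G) ` E)" using E(2) by (intro card_mono) auto
  also have "\<dots> \<le> card E" by (rule card_image_le[OF E(2)])
  finally have "real (card ?E) \<le> B * real (card (\<Union>P))" using E(3) by linarith
  also have "\<dots> \<le> B * real (card P * card G)"
    by (intro mult_left_mono of_nat_mono card_Union_quot_carrier P B)
  finally have "real (card ?E) \<le> B * real (card P) * real (card G)" by (simp add: mult.assoc)
  moreover have "steiner_spanner (quot_carrier k d G) (quot_dist k d) t P (P \<union> orbit G ` \<Union>E) ?E"
    using conn by (intro quotient_steiner_spanner P E) auto
  ultimately show ?thesis by blast
qed

end

section \<open>The edge bound\<close>

lemma ex_pow2_between:
  fixes a :: real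
  assumes "1 \<le> a"
  obtains n :: nat where "a \<le> 2 ^ n" "real n \<le> log 2 a + 1"
proof -
  define n where "n = nat \<lceil>log 2 a\<rceil>"
  have l: "0 \<le> log 2 a" using assms by simp
  have "log 2 a \<le> real n" unfolding n_def using l by linarith
  then have "a \<le> 2 ^ n" using assms by (simp add: log_le_iff powr_realpow)
  moreover have "real n \<le> log 2 a + 1" unfolding n_def using l by linarith
  ultimately show thesis by (rule that)
qed

definition edge_bound :: "nat \<Rightarrow> real \<Rightarrow> nat \<Rightarrow> real" where
  "edge_bound d \<epsilon> n =
     2 ^ Suc d *
       (50 * real (Suc d) ^ 2 * (1200 * real (Suc d) ^ 3 / sqrt \<epsilon> + 2) ^ (d - 1) * (3 * real (4 * n) + 10))"

lemma le_edge_bound: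
  assumes "b \<le> Suc d" "0 \<le> K" "K \<le> 50 * real (Suc d) ^ 2" "0 \<le> A" "A \<le> 1200 * real (Suc d) ^ 3"
    and "0 < \<epsilon>" "m \<le> 4 * n"
  shows "2 ^ b * (K * (A / sqrt \<epsilon> + 2) ^ (d - 1) * (3 * real m + 10)) \<le> edge_bound d \<epsilon> n"
  unfolding edge_bound_def using assms
  by (intro mult_mono power_mono power_increasing add_mono divide_right_mono order_refl mult_nonneg_nonneg
      zero_le_power add_nonneg_nonneg) (simp_all del: of_nat_Suc)

lemma model_has_spanners:
  assumes d: "1 \<le> d" and \<epsilon>: "0 < \<epsilon>" "\<epsilon> \<le> 1" and n: "4096 * real (Suc d) ^ 2 / \<epsilon> \<le> 2 ^ n"
  shows "has_spanners (model_carrier k d) (model_dist k d) (1 + \<epsilon>) (edge_bound d \<epsilon> n)"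
proof -
  define M where "M = real (Suc d)"
  have M: "1 \<le> M" "real d \<le> M" unfolding M_def by auto
  have powers: "M \<le> M ^ 2" "M \<le> M ^ 3" "M ^ 2 \<le> M ^ 3"
    using power_increasing[OF _ M(1)] by (auto simp: self_le_power M)
  have d2: "real d ^ 2 \<le> M ^ 2" using M by (intro power_mono) auto
  then have d3: "real d ^ 2 \<le> M ^ 3" using powers(3) by linarith
  have scale: "c / \<epsilon> \<le> 2 ^ n" if "c \<le> 4096 * M ^ 2" for c
    using divide_right_mono[OF that, of \<epsilon>] n \<epsilon> unfolding M_def by linarith
  show ?thesis
  proof (cases k)
    case Sph
    have "192 * M / \<epsilon> \<le> 2 ^ n" by (rule scale) (use powers(1) M in linarith)
    from sph_has_spanners[OF d \<epsilon> this[unfolded M_def]] show ?thesis unfolding Sph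
      by (rule has_spanners_mono) (rule le_edge_bound, use \<epsilon> in simp_all)
  next
    case Euc
    have "96 * real d / \<epsilon> \<le> 2 ^ n" by (rule scale) (use powers(1) M in linarith)
    from euc_has_spanners[OF d \<epsilon> this] show ?thesis unfolding Euc
      by (rule has_spanners_mono)
        (rule le_edge_bound, use \<epsilon> M powers d3 in \<open>simp_all add: M_def[symmetric] del: of_nat_Suc\<close>)
  next
    case Hyp
    have "4096 * real d ^ 2 / \<epsilon> \<le> 2 ^ n" using d2 by (intro scale) simp
    from hyp_has_spanners[OF d \<epsilon> this] show ?thesis unfolding Hyp
      by (rule has_spanners_mono)
        (rule le_edge_bound, use \<epsilon> M powers d2 d3 in \<open>simp_all add: M_def[symmetric] del: of_nat_Suc\<close>)
  qed
qed

context
  fixes d :: nat and \<epsilon> :: real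
  assumes d: "2 \<le> d" and \<epsilon>: "0 < \<epsilon>" "\<epsilon> \<le> 1 / 2"
begin

private abbreviation (input) "D \<equiv> real d"
private abbreviation (input) "M \<equiv> real (Suc d)"

lemma mult_power_Suc_le:
  assumes "0 \<le> c" "c \<le> 2 ^ i"
  shows "c * M ^ j \<le> D ^ (i + 2 * j)"
proof -
  have "M \<le> 2 * D" using d by simp
  also have "\<dots> \<le> D ^ 2" unfolding power2_eq_square using d by (intro mult_right_mono) auto
  finally have "M \<le> D ^ 2" .
  then have "M ^ j \<le> (D ^ 2) ^ j" by (intro power_mono) auto
  moreover have "(2::real) ^ i \<le> D ^ i" using d by (intro power_mono) auto
  then have "c \<le> D ^ i" using assms(2) by linarith
  ultimately have "c * M ^ j \<le> D ^ i * (D ^ 2) ^ j" using assms(1) by (intro mult_mono) auto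
  then show ?thesis by (simp add: power_add power_mult)
qed

lemma one_le_ln_inverse: "1 \<le> 3 / 2 * ln (1 / \<epsilon>)"
proof -
  have "ln 2 \<le> ln (1 / \<epsilon>)" using \<epsilon> by (subst ln_le_cancel_iff) (auto simp: field_simps)
  then show ?thesis using ln2_ge_two_thirds by linarith
qed

lemma level_count_le:
  assumes n: "real n \<le> log 2 (4096 * M ^ 2 / \<epsilon>) + 1"
  shows "3 * real (4 * n) + 10 \<le> D ^ 11 * ln (1 / \<epsilon>)"
proof -
  define L where "L = ln (1 / \<epsilon>)"
  have L: "1 \<le> 3 / 2 * L" unfolding L_def by (rule one_le_ln_inverse)
  have "log 2 (1 / \<epsilon>) = L / ln 2" unfolding log_def L_def ..
  also have "\<dots> \<le> L / (2 / 3)" using L ln2_ge_two_thirds by (intro divide_left_mono) auto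
  finally have log\<epsilon>: "log 2 (1 / \<epsilon>) \<le> 3 / 2 * L" by simp
  have "M \<le> 2 ^ Suc d" using less_exp[of "Suc d"]
    by (metis less_imp_le of_nat_le_iff of_nat_numeral of_nat_power)
  then have "log 2 M \<le> log 2 (2 ^ Suc d)" by (subst log_le_cancel_iff) auto
  then have logN: "log 2 M \<le> M" by (subst (asm) log_pow_cancel) auto
  have "log 2 (4096 * M ^ 2 / \<epsilon>) = log 2 (2 ^ 12) + 2 * log 2 M + log 2 (1 / \<epsilon>)"
    using \<epsilon> by (simp add: log_mult_pos log_divide_pos log_nat_power)
  also have "log 2 (2 ^ 12) = (12::real)" by (subst log_pow_cancel) auto
  finally have "3 * real (4 * n) + 10 \<le> 166 * 1 + 24 * M + 18 * L" using n logN log\<epsilon> by simp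
  also have "\<dots> \<le> 166 * (3 / 2 * (M * L)) + 24 * (3 / 2 * (M * L)) + 18 * (M * L)"
  proof (intro add_mono mult_left_mono)
    have "M * 1 \<le> M * (3 / 2 * L)" using L by (intro mult_left_mono) auto
    then show "M \<le> 3 / 2 * (M * L)" "1 \<le> 3 / 2 * (M * L)" by simp_all
    show "L \<le> M * L" using L mult_right_mono[of 1 M L] by simp
  qed auto
  also have "\<dots> = 303 * M ^ 1 * L" by simp
  also have "\<dots> \<le> D ^ (9 + 2 * 1) * L" using L by (intro mult_right_mono mult_power_Suc_le) auto
  finally show ?thesis unfolding L_def by simp
qed

lemma inverse_sqrt_power: "(1 / sqrt \<epsilon>) ^ (d - 1) = \<epsilon> powr ((1 - D) / 2)"
proof -
  have "1 / sqrt \<epsilon> = \<epsilon> powr (- (1 / 2))" using \<epsilon> by (simp add: powr_minus_divide powr_half_sqrt)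
  then have "(1 / sqrt \<epsilon>) ^ (d - 1) = \<epsilon> powr (- (1 / 2) * real (d - 1))"
    using \<epsilon> by (simp add: powr_realpow[symmetric] powr_powr)
  also have "- (1 / 2) * real (d - 1) = (1 - D) / 2" using d by (simp add: of_nat_diff field_simps)
  finally show ?thesis .
qed

lemma net_size_le:
  "(1200 * M ^ 3 / sqrt \<epsilon> + 2) ^ (d - 1) \<le> D ^ (17 * (d - 1)) * \<epsilon> powr ((1 - D) / 2)"
proof -
  let ?Q = "1 / sqrt \<epsilon>"
  have Q: "1 \<le> ?Q" using \<epsilon> by simp
  then have "1 * 1 \<le> M ^ 3 * ?Q" by (intro mult_mono one_le_power) auto
  then have "1200 * M ^ 3 / sqrt \<epsilon> + 2 \<le> 1202 * M ^ 3 * ?Q" by simp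
  also have "\<dots> \<le> D ^ (11 + 2 * 3) * ?Q" using \<epsilon>(1) by (intro mult_right_mono mult_power_Suc_le) auto
  finally have "(1200 * M ^ 3 / sqrt \<epsilon> + 2) ^ (d - 1) \<le> (D ^ 17 * ?Q) ^ (d - 1)"
    using \<epsilon>(1) by (intro power_mono) simp_all
  also have "\<dots> = D ^ (17 * (d - 1)) * ?Q ^ (d - 1)" by (simp only: power_mult_distrib power_mult)
  finally show ?thesis unfolding inverse_sqrt_power .
qed

lemma edge_bound_le:
  assumes n: "real n \<le> log 2 (4096 * M ^ 2 / \<epsilon>) + 1"
  shows "edge_bound d \<epsilon> n \<le> D powr (21 * D) * \<epsilon> powr ((1 - D) / 2) * ln (1 / \<epsilon>)"
proof -
  let ?L = "ln (1 / \<epsilon>)" and ?Q = "\<epsilon> powr ((1 - D) / 2)"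
  have L: "0 \<le> ?L" using one_le_ln_inverse by linarith
  have "(2::real) ^ Suc d \<le> D ^ Suc d" using d by (intro power_mono) auto
  also have "\<dots> \<le> D ^ (2 * d)" using d by (intro power_increasing) auto
  finally have shifts: "(2::real) ^ Suc d \<le> D ^ (2 * d)" .
  have walls: "50 * M ^ 2 \<le> D ^ 10" using mult_power_Suc_le[of 50 6 2] by simp
  have "edge_bound d \<epsilon> n \<le> D ^ (2 * d) * (D ^ 10 * (D ^ (17 * (d - 1)) * ?Q) * (D ^ 11 * ?L))"
    unfolding edge_bound_def using \<epsilon> L
    by (intro mult_mono shifts walls net_size_le level_count_le[OF n] mult_nonneg_nonneg) auto
  also have "\<dots> = D ^ (2 * d + 10 + 17 * (d - 1) + 11) * ?Q * ?L" by (simp add: power_add)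
  also have "\<dots> \<le> D ^ (21 * d) * ?Q * ?L" using d L by (intro mult_right_mono power_increasing) auto
  also have "D ^ (21 * d) = D powr (21 * D)" using d powr_realpow[of D "21 * d"] by simp
  finally show ?thesis .
qed

lemma model_has_spanners_powr:
  "has_spanners (model_carrier k d) (model_dist k d) (1 + \<epsilon>)
    (D powr (21 * D) * \<epsilon> powr ((1 - D) / 2) * ln (1 / \<epsilon>))"
proof -
  have "1 * 1 \<le> 4096 * M ^ 2" by (intro mult_mono one_le_power) auto
  then have "1 \<le> 4096 * M ^ 2 / \<epsilon>" using \<epsilon> by (subst pos_le_divide_eq) auto
  then obtain n where n: "4096 * M ^ 2 / \<epsilon> \<le> 2 ^ n" "real n \<le> log 2 (4096 * M ^ 2 / \<epsilon>) + 1"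
    by (rule ex_pow2_between)
  have "has_spanners (model_carrier k d) (model_dist k d) (1 + \<epsilon>) (edge_bound d \<epsilon> n)"
    by (rule model_has_spanners) (use d \<epsilon> n in auto)
  then show ?thesis using edge_bound_le[OF n(2)] by (rule has_spanners_mono)
qed

end

theorem mainTheorem15:
  shows "\<exists>C::real. \<forall>(k::geom) (d::nat) (\<epsilon>::real) G P.
    2 \<le> d \<longrightarrow> 0 < \<epsilon> \<longrightarrow> \<epsilon> \<le> 1/2 \<longrightarrow>
    fin_isom_group k d G \<longrightarrow> acts_freely k d G \<longrightarrow>
    finite P \<longrightarrow> P \<subseteq> quot_carrier k d G \<longrightarrow>
    (\<exists>V E. steiner_spanner (quot_carrier k d G) (quot_dist k d) (1 + \<epsilon>) P V E \<and>
       real (card E) \<le> real d powr (C * real d) * \<epsilon> powr ((1 - real d) / 2) * ln (1 / \<epsilon>)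
                         * real (card P) * real (card G))"
proof (intro exI[of _ 21] allI impI)
  fix k :: geom and d :: nat and \<epsilon> :: real and G P
  assume d: "2 \<le> d" and \<epsilon>: "0 < \<epsilon>" "\<epsilon> \<le> 1 / 2" and G: "fin_isom_group k d G"
    and P: "finite P" "P \<subseteq> quot_carrier k d G"
  let ?B = "real d powr (21 * real d) * \<epsilon> powr ((1 - real d) / 2) * ln (1 / \<epsilon>)"
  have "0 \<le> ?B" using \<epsilon> by simp
  then show "\<exists>V E. steiner_spanner (quot_carrier k d G) (quot_dist k d) (1 + \<epsilon>) P V E \<and>
      real (card E) \<le> ?B * real (card P) * real (card G)"
    by (rule ex_quotient_steiner_spanner[OF G model_has_spanners_powr[OF d \<epsilon>] _ P])
qed

end
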